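(* Let $\theta>0$, let $N\in\mathbb{N}$ with $N\ge2$, let $\lambda\in\mathbb{GT}_N$, and let $x,y$ be real numbers with $1>y>x>0$. Then $$J_\lambda(x;N,\theta)\,J_\lambda(y;N,\theta)=\frac{\Gamma(N\theta)\,y^\theta}{\Gamma((N-1)\theta)\,\Gamma(\theta)\,((1-x)(1-y))^\theta}\int_y^1 J_\lambda\!\left(xw,\frac{y}{w};N,\theta\right)\left(1-\frac{xw^2}{y}\right)\left(1-\frac{xw}{y}\right)^{\theta-1}\left(\frac1w-1\right)^{\theta-1}\left(\frac{(1-xw)(1-\frac yw)}{(1-x)(1-y)}\right)^{\theta(N-1)-1}\frac{dw}{w^2}.$$
   Context: $\mathbb{N}=\{1,2,\dots\}$. $\mathbb{GT}_N$ is the set of signatures of length $N$, i.e. integer sequences $\lambda=(\lambda_1\ge\dots\ge\lambda_N)$; $\mathbb{GT}^+_N$ is the subset with $\lambda_N\ge 0$; $|\lambda|=\sum_i\lambda_i$. Jack polynomials: for $\theta>0$ and $\lambda\in\mathbb{GT}_N^+$, $J_\lambda(x_1,\dots,x_N;\theta)$ is the Jack symmetric polynomial with Jack parameter $\alpha=1/\theta$, normalized so that the coefficient of $x_1^{\lambda_1}\cdots x_N^{\lambda_N}$ is $1$ (the limit $q\to1$, $t=q^\theta$, of Macdonald polynomials $P_\lambda(\cdot;q,t)$). Explicitly it is determined by $J_{(\lambda_1)}(x_1;\theta)=x_1^{\lambda_1}$ and the branching rule $J_\lambda(x_1,\dots,x_{N+1};\theta)=\sum_{\mu\prec\lambda}\psi_{\lambda/\mu}(\theta)\,x_{N+1}^{|\lambda|-|\mu|}J_\mu(x_1,\dots,x_N;\theta)$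 for $\lambda\in\mathbb{GT}^+_{N+1}$, where the sum is over $\mu\in\mathbb{GT}^+_N$ with $\lambda_{N+1}\le\mu_N\le\lambda_N\le\dots\le\mu_1\le\lambda_1$, and, with $(a)_n=a(a+1)\cdots(a+n-1)$, $$\psi_{\lambda/\mu}(\theta)=\prod_{1\le i\le j\le N}\frac{(\mu_i-\mu_j+\theta(j-i)+\theta)_{\mu_j-\lambda_{j+1}}}{(\mu_i-\mu_j+\theta(j-i)+1)_{\mu_j-\lambda_{j+1}}}\cdot\frac{(\lambda_i-\mu_j+\theta(j-i)+1)_{\mu_j-\lambda_{j+1}}}{(\lambda_i-\mu_j+\theta(j-i)+\theta)_{\mu_j-\lambda_{j+1}}}.$$ For general $\lambda\in\mathbb{GT}_N$, $J_\lambda(x_1,\dots,x_N;\theta)=(x_1\cdots x_N)^{-K}J_{(\lambda_1+K,\dots,\lambda_N+K)}(x_1,\dots,x_N;\theta)$ for any integer $K\ge0$ with $\lambda_N+K\ge0$ (independent of $K$). Jack characters: for $1\le m\le N$ and $\lambda\in\mathbb{GT}_N$, $J_\lambda(x_1,\dots,x_m;N,\theta)=J_\lambda(x_1,\dots,x_m,1^{N-m};\theta)/J_\lambda(1^N;\theta)$, where $1^k$ is a string of $k$ ones (the denominator is nonzero). *)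

theory Defs
  imports "HOL-Analysis.Analysis"
begin

text \<open>
  Signatures are integer lists. List positions start at \<open>0\<close>, so the part \<open>\<lambda>\<^sub>i\<close> of the
  usual notation is \<open>lam ! (i - 1)\<close>.
\<close>

definition GT :: "nat \<Rightarrow> int list set" where
  "GT N = {lam. length lam = N \<and> sorted_wrt (\<ge>) lam}"

definition GT_plus :: "nat \<Rightarrow> int list set" where
  "GT_plus N = {lam \<in> GT N. \<forall>k\<in>set lam. 0 \<le> k}"

definition interlaces :: "int list \<Rightarrow> int list \<Rightarrow> bool" (infix "\<prec>\<^sub>G\<^sub>T" 50) where
  "\<mu> \<prec>\<^sub>G\<^sub>T lam \<longleftrightarrow> length lam = Suc (length \<mu>) \<and>
     (\<forall>i<length \<mu>. lam ! Suc i \<le> \<mu> ! i \<and> \<mu> ! i \<le> lam ! i)"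

text \<open>
  The branching coefficient \<open>\<psi>\<^bsub>\<lambda>/\<mu>\<^esub>(\<theta>)\<close>. When \<open>\<mu> \<prec>\<^sub>G\<^sub>T lam\<close>, the integer \<open>\<mu>\<^sub>j - \<lambda>\<^bsub>j+1\<^esub>\<close> is
  nonnegative, so \<open>nat\<close> does not truncate, and all denominators are positive for \<open>\<theta> > 0\<close>.
\<close>

definition jack_psi :: "real \<Rightarrow> int list \<Rightarrow> int list \<Rightarrow> real" where
  "jack_psi \<theta> lam \<mu> =
     (\<Prod>j<length \<mu>. \<Prod>i\<le>j.
        let n = nat (\<mu> ! j - lam ! Suc j);
            a = real_of_int (\<mu> ! i - \<mu> ! j) + \<theta> * (real j - real i);
            b = real_of_int (lam ! i - \<mu> ! j) + \<theta> * (real j - real i)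
        in pochhammer (a + \<theta>) n / pochhammer (a + 1) n *
           (pochhammer (b + 1) n / pochhammer (b + \<theta>) n))"

text \<open>
  \<open>jack_plus N \<theta> lam x\<close> is the Jack polynomial \<open>J\<^sub>\<lambda>(x\<^sub>1,\<dots>,x\<^sub>N;\<theta>)\<close> of \<open>lam \<in> GT_plus N\<close>, evaluated at
  the point given by the first \<open>N\<close> entries of \<open>x\<close>. The case of no variables is only there to
  make the function total.
\<close>

fun jack_plus :: "nat \<Rightarrow> real \<Rightarrow> int list \<Rightarrow> real list \<Rightarrow> real" where
  "jack_plus 0 \<theta> lam x = 1"
| "jack_plus (Suc 0) \<theta> lam x = (x ! 0) ^ nat (lam ! 0)"
| "jack_plus (Suc (Suc n)) \<theta> lam x =
     (\<Sum>\<mu>\<in>{\<mu> \<in> GT_plus (Suc n). \<mu> \<prec>\<^sub>G\<^sub>T lam}.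
        jack_psi \<theta> lam \<mu> * (x ! Suc n) ^ nat (sum_list lam - sum_list \<mu>) *
        jack_plus (Suc n) \<theta> \<mu> x)"

text \<open>
  The Jack (Laurent) polynomial of an arbitrary signature, meant for \<open>length x = length lam > 0\<close>
  and nonzero entries of \<open>x\<close>. Any \<open>K \<ge> 0\<close> with \<open>\<lambda>\<^sub>N + K \<ge> 0\<close> gives the same value; the least
  such \<open>K\<close> is used, which is \<open>0\<close> on \<open>GT_plus N\<close>.
\<close>

definition jack :: "real \<Rightarrow> int list \<Rightarrow> real list \<Rightarrow> real" where
  "jack \<theta> lam x =
     (let K = nat (- last lam)
      in jack_plus (length lam) \<theta> (map (\<lambda>k. k + int K) lam) x / prod_list x ^ K)"

text \<open>\<open>jack_char N \<theta> lam [x\<^sub>1,\<dots>,x\<^sub>m]\<close> is the Jack character \<open>J\<^sub>\<lambda>(x\<^sub>1,\<dots>,x\<^sub>m;N,\<theta>)\<close>, for \<open>m \<le> N\<close>.\<close>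

definition jack_char :: "nat \<Rightarrow> real \<Rightarrow> int list \<Rightarrow> real list \<Rightarrow> real" where
  "jack_char N \<theta> lam xs =
     jack \<theta> lam (xs @ replicate (N - length xs) 1) / jack \<theta> lam (replicate N 1)"

end

theory Submission
  imports Defs
begin

text \<open>
  On the curve \<open>u v = x y\<close>, parametrised by \<open>u = x w\<close> and \<open>v = y / w\<close>, the kernel is a multiple of
  the Beta density with parameters \<open>\<theta>\<close> and \<open>\<theta> (N - 1)\<close> in the variable \<open>B\<close> given by
  \<open>u + v = x + y + B (1 - x) (1 - y)\<close>. So the claim is that averaging the two-variable character over \<open>B\<close>
  gives a product of one-variable characters.

  Multiply the average by \<open>x^(s-1) y^(r-1) ((1 - x) (1 - y))^(\<theta> N - 1)\<close> and integrate over the unit square.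
  Integration by parts shows how these moments change when the symmetric polynomial is multiplied by
  \<open>u + v\<close> or \<open>u v\<close>. The characters satisfy the Pieri rule for every elementary symmetric polynomial, which
  expresses each of them through smaller signatures, and the product over \<open>i\<close> of
  \<open>\<Gamma>(l\<^sub>i + s) \<Gamma>(l\<^sub>i + r) / (\<Gamma>(l\<^sub>i + s + \<theta>) \<Gamma>(l\<^sub>i + r + \<theta>))\<close>, with \<open>l\<^sub>i = \<lambda>\<^sub>i + \<theta> (N - i)\<close>, obeys the same
  recursion in \<open>\<lambda>\<close>. Hence the moments are this product up to a constant. It factors into a
  function of \<open>s\<close> and a function of \<open>r\<close>, so the average factors into a function of \<open>x\<close> and a function of \<open>y\<close>.

  The Pieri rule follows from the branching rule by induction on the number of variables: that the
  branching coefficients intertwine the Pieri operators for \<open>N + 1\<close> and \<open>N\<close> variables is an identity between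
  rational functions, and another instance of the same identity gives the recursion of the Gamma products.
\<close>

section \<open>A rational identity for sums over subsets\<close>

text \<open>The double integral behind the moments is never formed. Polynomials and their moments
  are built in parallel by closure rules, only the Beta integral in \<open>B\<close> is analytic,
  and linear independence of shifted Gamma quotients replaces uniqueness of the Mellin transform.
  Since all but two variables equal 1, the Pieri generating function is (1 + t)^(N-2) (1 + (u + v) t
  + u v t^2), so multiplication by u + v and by u v is all that the moments have to follow. The
  first of these raises the power of \<open>B\<close>, which would keep the recursion from closing;
  the integration by parts removes it and leaves the factors (s - r + \<theta>)/(s - r) and (s - r -
  \<theta>)/(s - r). The same factors come out of the rational identity when its second point set is
  {-s, -r}. The start of the recursion explains the second Beta parameter: for the zero signature
  the Gamma product telescopes to \<Gamma>(s)/\<Gamma>(s + N \<theta>), which is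
  \<open>mellin s\<close> for \<theta> + \<kappa> = N \<theta>. Once the average factors, putting y
  = 1 makes the averaged function constant in \<open>B\<close> and so identifies the
  factors.\<close>

definition cut :: "real \<Rightarrow> ('a \<Rightarrow> real) \<Rightarrow> 'a set \<Rightarrow> 'a set \<Rightarrow> real" where
  "cut c l A I = (\<Prod>i\<in>I. \<Prod>k\<in>A - I. (l i - l k + c) / (l i - l k))"

definition prods :: "real \<Rightarrow> ('a \<Rightarrow> real) \<Rightarrow> ('b \<Rightarrow> real) \<Rightarrow> 'a set \<Rightarrow> 'b set \<Rightarrow> real" where
  "prods c l n A B = (\<Prod>i\<in>A. \<Prod>j\<in>B. l i - n j + c)"

text \<open>\<open>cut c l A I\<close> is the coefficient of a rational Macdonald-Ruijsenaars
  difference operator. At c = \<theta> and l = \<open>spart \<theta> lam\<close> it is the Pieri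
  coefficient for raising the rows in \<open>I\<close>, with Jack polynomials divided by
  \<open>at_ones\<close>; \<open>t\<close> marks the degree of the elementary symmetric polynomial.
  \<open>right_sum\<close> is built in the same way on the points \<open>n\<close>, with the
  opposite shift.\<close>

definition left_sum :: "real \<Rightarrow> real \<Rightarrow> ('a \<Rightarrow> real) \<Rightarrow> ('b \<Rightarrow> real) \<Rightarrow> 'a set \<Rightarrow> 'b set \<Rightarrow> real" where
  "left_sum c t l n A B =
     (\<Sum>I\<in>Pow A. t ^ card I * cut c l A I * prods 0 l n I B * prods c l n (A - I) B)"

definition right_sum :: "real \<Rightarrow> real \<Rightarrow> ('a \<Rightarrow> real) \<Rightarrow> ('b \<Rightarrow> real) \<Rightarrow> 'a set \<Rightarrow> 'b set \<Rightarrow> real" where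
  "right_sum c t l n A B =
     (\<Sum>J\<in>Pow B. t ^ card J * cut (- c) n B J * prods 0 l n A J * prods c l n A (B - J))"

lemma sum_Pow_insert:
  assumes "finite A" "a \<notin> A"
  shows "(\<Sum>I\<in>Pow (insert a A). f I) = (\<Sum>I\<in>Pow A. f I + f (insert a I) :: real)"
proof -
  have "inj_on (insert a) (Pow A)" using assms by (auto simp: inj_on_def)
  moreover have "Pow A \<inter> insert a ` Pow A = {}" using assms by auto
  ultimately show ?thesis using assms
    by (simp add: Pow_insert sum.union_disjoint sum.reindex sum.distrib)
qed

lemma cut_insert_notin:
  assumes "finite A" "a \<notin> A" "I \<subseteq> A"
  shows "cut c l (insert a A) I = cut c l A I * (\<Prod>i\<in>I. (l i - l a + c) / (l i - l a))"
proof -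
  have "insert a A - I = insert a (A - I)" using assms by auto
  then have "cut c l (insert a A) I =
      (\<Prod>i\<in>I. (l i - l a + c) / (l i - l a) * (\<Prod>k\<in>A - I. (l i - l k + c) / (l i - l k)))"
    unfolding cut_def using assms by (simp only:, subst prod.insert) auto
  then show ?thesis by (simp only: cut_def prod.distrib mult.commute)
qed

lemma cut_insert_in:
  assumes "finite A" "a \<notin> A" "I \<subseteq> A"
  shows "cut c l (insert a A) (insert a I) =
    cut c l A I * (\<Prod>k\<in>A - I. (l a - l k + c) / (l a - l k))"
proof -
  have "insert a A - insert a I = A - I" "a \<notin> I" "finite I" using assms finite_subset by auto
  then show ?thesis by (simp add: cut_def mult.commute)
qed

lemma cut_cong: "(\<And>i. i \<in> A \<Longrightarrow> l i = l' i) \<Longrightarrow> I \<subseteq> A \<Longrightarrow> cut c l A I = cut c l' A I"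
  unfolding cut_def by (intro prod.cong) (auto simp: subset_iff)

lemma prods_cong:
  "(\<And>i. i \<in> A \<Longrightarrow> l i = l' i) \<Longrightarrow> (\<And>j. j \<in> B \<Longrightarrow> n j = n' j) \<Longrightarrow> prods c l n A B = prods c l' n' A B"
  unfolding prods_def by (intro prod.cong) auto

lemma prods_insert_left:
  "finite A \<Longrightarrow> a \<notin> A \<Longrightarrow> prods c l n (insert a A) B = (\<Prod>j\<in>B. l a - n j + c) * prods c l n A B"
  by (simp add: prods_def)

lemma prods_insert_right:
  "finite B \<Longrightarrow> b \<notin> B \<Longrightarrow> prods c l n A (insert b B) = (\<Prod>i\<in>A. l i - n b + c) * prods c l n A B"
  by (simp add: prods_def prod.distrib)

lemma prod_split:
  fixes f :: "'a \<Rightarrow> 'b::comm_monoid_mult"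
  assumes "finite A" "I \<subseteq> A"
  shows "(\<Prod>i\<in>I. f i) * (\<Prod>i\<in>A - I. f i) = (\<Prod>i\<in>A. f i)"
  using prod.subset_diff[OF assms(2,1), of f] by (simp add: mult.commute)

lemma degree_prod_linear_le:
  "finite A \<Longrightarrow> (\<And>i. i \<in> A \<Longrightarrow> degree (p i) \<le> 1) \<Longrightarrow> degree (\<Prod>i\<in>A. p i :: real poly) \<le> card A"
  using degree_prod_sum_le[of A p] sum_mono[of A "\<lambda>i. degree (p i)" "\<lambda>_. 1"] by force

text \<open>
  The step of the induction: in \<open>X = n b\<close> both sides, multiplied by \<open>\<Prod>k\<in>B. X - n k\<close>, are polynomials
  of degree less than \<open>2 * card A\<close>, and at the \<open>2 * card A\<close> points \<open>l a\<close> and \<open>l a + c\<close> they reduce to the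
  identity without \<open>a\<close> and \<open>b\<close>.
\<close>

lemma left_right_step:
  fixes l :: "'a \<Rightarrow> real" and n :: "'b \<Rightarrow> real"
  assumes fin: "finite A" "finite B" and card: "card A = Suc (card B)"
    and b: "b \<notin> B" and inj: "inj_on l A" "inj_on n (insert b B)"
    and gen: "c \<noteq> 0" "\<And>a a'. a \<in> A \<Longrightarrow> a' \<in> A \<Longrightarrow> l a' - l a \<noteq> c"
    and IH: "\<And>a. a \<in> A \<Longrightarrow> left_sum c t l n (A - {a}) B = right_sum c t l n (A - {a}) B"
  shows "left_sum c t l n A (insert b B) = right_sum c t l n A (insert b B)"
proof -
  define cI where "cI I = t ^ card I * cut c l A I * prods 0 l n I B * prods c l n (A - I) B" for I
  define cJ where "cJ J = t ^ card J * cut (- c) n B J * prods 0 l n A J * prods c l n A (B - J)" for J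
  \<comment> \<open>The polynomial variable stands for \<open>n b\<close>. The product over
    \<open>B\<close> clears the denominators n b - n k, which occur only on the right-hand
    side.\<close>
  define PL where "PL = (\<Sum>I\<in>Pow A. smult (cI I) ((\<Prod>i\<in>I. [:l i, -1:]) * (\<Prod>i\<in>A - I. [:l i + c, -1:])))
      * (\<Prod>k\<in>B. [:- n k, 1:])"
  define PR where "PR = (\<Sum>J\<in>Pow B.
      smult (cJ J) ((\<Prod>i\<in>A. [:l i + c, -1:]) * ((\<Prod>j\<in>J. [:c - n j, 1:]) * (\<Prod>k\<in>B - J. [:- n k, 1:])))
    + smult (t * cJ J) ((\<Prod>i\<in>A. [:l i, -1:]) * ((\<Prod>j\<in>J. [:- n j, 1:]) * (\<Prod>k\<in>B - J. [:- n k - c, 1:]))))"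
  have degL: "degree PL \<le> card A + card B"
  proof -
    have "degree ((\<Prod>i\<in>I. [:l i, -1:]) * (\<Prod>i\<in>A - I. [:l i + c, -1:])) \<le> card A" if "I \<subseteq> A" for I
    proof -
      have "degree (\<Prod>i\<in>I. [:l i, -1:]) \<le> card I" "degree (\<Prod>i\<in>A - I. [:l i + c, -1:]) \<le> card (A - I)"
        using fin that finite_subset by (auto intro!: degree_prod_linear_le)
      moreover have "card I + card (A - I) = card A"
        using that fin by (metis card_Diff_subset card_mono finite_subset le_add_diff_inverse)
      ultimately show ?thesis using degree_mult_le order_trans by (smt (verit) add_mono)
    qed
    then have "degree (\<Sum>I\<in>Pow A. smult (cI I) ((\<Prod>i\<in>I. [:l i, -1:]) * (\<Prod>i\<in>A - I. [:l i + c, -1:]))) \<le> card A"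
      using fin by (intro degree_sum_le) (auto intro!: order_trans[OF degree_smult_le])
    moreover have "degree (\<Prod>k\<in>B. [:- n k, 1:]) \<le> card B"
      using fin by (intro degree_prod_linear_le) auto
    ultimately show ?thesis unfolding PL_def using degree_mult_le order_trans by (smt (verit) add_mono)
  qed
  have degR: "degree PR \<le> card A + card B"
  proof -
    have *: "degree ((\<Prod>i\<in>A. [:f i, -1:]) * ((\<Prod>j\<in>J. [:g j, 1:]) * (\<Prod>k\<in>B - J. [:h k, 1:]))) \<le> card A + card B"
      if "J \<subseteq> B" for J f and g h :: "'b \<Rightarrow> real"
    proof -
      have "degree (\<Prod>i\<in>A. [:f i, -1:]) \<le> card A"
        using fin by (intro degree_prod_linear_le) auto
      moreover have "degree (\<Prod>j\<in>J. [:g j, 1:]) \<le> card J" "degree (\<Prod>k\<in>B - J. [:h k, 1:]) \<le> card (B - J)"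
        using fin that finite_subset by (auto intro!: degree_prod_linear_le)
      moreover have "card J + card (B - J) = card B"
        using that fin by (metis card_Diff_subset card_mono finite_subset le_add_diff_inverse)
      ultimately show ?thesis using degree_mult_le order_trans by (smt (verit) add_mono)
    qed
    show ?thesis unfolding PR_def using fin
      by (intro degree_sum_le degree_add_le order_trans[OF degree_smult_le] *) auto
  qed
  \<comment> \<open>At l a the factor of index a in the product over I vanishes, so only subsets
    avoiding a survive. At l a + c the product over A - I vanishes instead, so only subsets
    containing a survive.\<close>
  have rootL: "poly PL (l a) = left_sum c t l n (A - {a}) B * ((\<Prod>i\<in>A. l i + c - l a) * (\<Prod>j\<in>B. (l a - n j) * (l a - n j + c)))"
     (is "_ = _ * ?W")
    if "a \<in> A" for a
  proof -
    let ?A = "A - {a}"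
    have A: "A = insert a ?A" "finite ?A" "a \<notin> ?A" using that fin by auto
    have *: "cI I * ((\<Prod>i\<in>I. l i - l a) * (\<Prod>i\<in>A - I. l i + c - l a)) * (\<Prod>k\<in>B. l a - n k)
       = t ^ card I * cut c l ?A I * prods 0 l n I B * prods c l n (?A - I) B * ?W" if "I \<subseteq> ?A" for I
    proof -
      have AI: "A - I = insert a (?A - I)" using that A by auto
      have ne: "l i - l a \<noteq> 0" if "i \<in> I" for i
        using inj(1) that \<open>I \<subseteq> ?A\<close> \<open>a \<in> A\<close> by (auto simp: inj_on_def)
      have "cut c l A I = cut c l ?A I * (\<Prod>i\<in>I. (l i - l a + c) / (l i - l a))"
        using cut_insert_notin[OF A(2,3) that] A(1) by simp
      moreover have "(\<Prod>i\<in>I. (l i - l a + c) / (l i - l a)) * (\<Prod>i\<in>I. l i - l a) = (\<Prod>i\<in>I. l i - l a + c)"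
        unfolding prod.distrib[symmetric] using ne by (intro prod.cong refl) simp
      ultimately have 1: "cut c l A I * (\<Prod>i\<in>I. l i - l a) = cut c l ?A I * (\<Prod>i\<in>I. l i - l a + c)"
        by (simp only: mult.assoc)
      have 2: "prods c l n (A - I) B = (\<Prod>j\<in>B. l a - n j + c) * prods c l n (?A - I) B"
        unfolding AI using A by (subst prods_insert_left) auto
      have 3: "(\<Prod>i\<in>I. l i - l a + c) * (\<Prod>i\<in>A - I. l i + c - l a) = (\<Prod>i\<in>A. l i + c - l a)"
        using prod_split[of A I "\<lambda>i. l i + c - l a"] fin that by (auto simp: algebra_simps)
      have "cI I * ((\<Prod>i\<in>I. l i - l a) * (\<Prod>i\<in>A - I. l i + c - l a)) * (\<Prod>k\<in>B. l a - n k)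
        = t ^ card I * (cut c l A I * (\<Prod>i\<in>I. l i - l a)) * prods 0 l n I B *
           prods c l n (A - I) B * (\<Prod>i\<in>A - I. l i + c - l a) * (\<Prod>k\<in>B. l a - n k)"
        unfolding cI_def by (simp only: mult_ac)
      also have "\<dots> = t ^ card I * cut c l ?A I * prods 0 l n I B * prods c l n (?A - I) B *
           ((\<Prod>i\<in>I. l i - l a + c) * (\<Prod>i\<in>A - I. l i + c - l a)) *  ((\<Prod>j\<in>B. l a - n j + c) * (\<Prod>k\<in>B. l a - n k))"
        unfolding 1 2 by (simp only: mult_ac)
      finally show ?thesis unfolding 3 by (simp add: prod.distrib mult_ac)
    qed
    have z: "(\<Prod>i\<in>insert a I. l i - l a) = 0" if "I \<subseteq> ?A" for I
      using that A(2) by (simp add: finite_subset)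
    have "poly PL (l a) = (\<Sum>I\<in>Pow A. cI I * ((\<Prod>i\<in>I. l i - l a) * (\<Prod>i\<in>A - I. l i + c - l a)) * (\<Prod>k\<in>B. l a - n k))"
      unfolding PL_def by (simp add: poly_sum poly_prod sum_distrib_left algebra_simps)
    also have "\<dots> = (\<Sum>I\<in>Pow ?A. cI I * ((\<Prod>i\<in>I. l i - l a) * (\<Prod>i\<in>A - I. l i + c - l a)) * (\<Prod>k\<in>B. l a - n k))"
      by (subst (1) A(1), subst sum_Pow_insert[OF A(2,3)]) (auto intro!: sum.cong simp: z)
    also have "\<dots> = (\<Sum>I\<in>Pow ?A. t ^ card I * cut c l ?A I * prods 0 l n I B * prods c l n (?A - I) B * ?W)"
      by (intro sum.cong refl *) auto
    finally show ?thesis by (simp add: left_sum_def sum_distrib_right)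
  qed
  have rootL': "poly PL (l a + c) = left_sum c t l n (A - {a}) B * (t * (\<Prod>i\<in>A. l i - l a - c) * (\<Prod>j\<in>B. (l a - n j) * (l a - n j + c)))"
     (is "_ = _ * ?W")
    if "a \<in> A" for a
  proof -
    let ?A = "A - {a}"
    have A: "A = insert a ?A" "finite ?A" "a \<notin> ?A" using that fin by auto
    have *: "cI (insert a I) * ((\<Prod>i\<in>insert a I. l i - l a - c) * (\<Prod>i\<in>A - insert a I. l i - l a)) * (\<Prod>k\<in>B. l a - n k + c)
       = t ^ card I * cut c l ?A I * prods 0 l n I B * prods c l n (?A - I) B * ?W" if "I \<subseteq> ?A" for I
    proof -
      have AI: "A - insert a I = ?A - I" using that A by auto
      have I: "finite I" "a \<notin> I" using that A(2) by (auto intro: finite_subset)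
      have ne: "l a - l i \<noteq> 0" if "i \<in> ?A - I" for i
        using inj(1) that \<open>I \<subseteq> ?A\<close> \<open>a \<in> A\<close> by (auto simp: inj_on_def)
      have "cut c l A (insert a I) = cut c l ?A I * (\<Prod>k\<in>?A - I. (l a - l k + c) / (l a - l k))"
        using cut_insert_in[OF A(2,3) that] A(1) by simp
      moreover have "(\<Prod>k\<in>?A - I. (l a - l k + c) / (l a - l k)) * (\<Prod>i\<in>?A - I. l i - l a) = (\<Prod>i\<in>?A - I. l i - l a - c)"
        unfolding prod.distrib[symmetric]
        by (intro prod.cong refl) (use ne in \<open>auto simp: field_simps\<close>)
      ultimately have 1: "cut c l A (insert a I) * (\<Prod>i\<in>?A - I. l i - l a) = cut c l ?A I * (\<Prod>i\<in>?A - I. l i - l a - c)"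
        by (simp only: mult.assoc)
      have 2: "prods 0 l n (insert a I) B = (\<Prod>j\<in>B. l a - n j) * prods 0 l n I B"
        using I by (simp add: prods_insert_left)
      have 3: "(\<Prod>i\<in>insert a I. l i - l a - c) * (\<Prod>i\<in>?A - I. l i - l a - c) = (\<Prod>i\<in>A. l i - l a - c)"
        using prod_split[of A "insert a I" "\<lambda>i. l i - l a - c"] fin that AI \<open>a \<in> A\<close> by (auto simp: algebra_simps)
      have "cI (insert a I) * ((\<Prod>i\<in>insert a I. l i - l a - c) * (\<Prod>i\<in>A - insert a I. l i - l a)) * (\<Prod>k\<in>B. l a - n k + c)
        = t ^ card (insert a I) * (cut c l A (insert a I) * (\<Prod>i\<in>?A - I. l i - l a)) * prods 0 l n (insert a I) B *
           prods c l n (?A - I) B * (\<Prod>i\<in>insert a I. l i - l a - c) * (\<Prod>k\<in>B. l a - n k + c)"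
        unfolding cI_def AI by (simp only: mult_ac)
      also have "\<dots> = t ^ card (insert a I) * cut c l ?A I * prods 0 l n I B * prods c l n (?A - I) B *
           ((\<Prod>i\<in>insert a I. l i - l a - c) * (\<Prod>i\<in>?A - I. l i - l a - c)) * ((\<Prod>j\<in>B. l a - n j) * (\<Prod>k\<in>B. l a - n k + c))"
        unfolding 1 2 by (simp only: mult_ac)
      also have "\<dots> = t ^ card I * cut c l ?A I * prods 0 l n I B * prods c l n (?A - I) B * ?W"
        unfolding 3 using I by (simp add: prod.distrib)
      finally show ?thesis .
    qed
    have z: "(\<Prod>i\<in>A - I. l i - l a) = 0" if "I \<subseteq> ?A" for I
      using that \<open>a \<in> A\<close> fin by auto
    have "poly PL (l a + c) = (\<Sum>I\<in>Pow A. cI I * ((\<Prod>i\<in>I. l i - l a - c) * (\<Prod>i\<in>A - I. l i - l a)) * (\<Prod>k\<in>B. l a - n k + c))"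
      unfolding PL_def by (simp add: poly_sum poly_prod sum_distrib_left algebra_simps)
    also have "\<dots> = (\<Sum>I\<in>Pow ?A. cI (insert a I) * ((\<Prod>i\<in>insert a I. l i - l a - c) * (\<Prod>i\<in>A - insert a I. l i - l a)) * (\<Prod>k\<in>B. l a - n k + c))"
      by (subst (1) A(1), subst sum_Pow_insert[OF A(2,3)]) (auto intro!: sum.cong simp: z)
    also have "\<dots> = (\<Sum>I\<in>Pow ?A. t ^ card I * cut c l ?A I * prods 0 l n I B * prods c l n (?A - I) B * ?W)"
      by (intro sum.cong refl *) auto
    finally show ?thesis by (simp add: left_sum_def sum_distrib_right)
  qed
  have cJ_eq: "cJ J = t ^ card J * cut (- c) n B J * prods 0 l n (A - {a}) J * prods c l n (A - {a}) (B - J)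
       * ((\<Prod>j\<in>J. l a - n j) * (\<Prod>j\<in>B - J. l a - n j + c))" if "a \<in> A" for a J
  proof -
    have A: "A = insert a (A - {a})" "finite (A - {a})" "a \<notin> A - {a}" using that fin by auto
    have "prods e l n A K = (\<Prod>j\<in>K. l a - n j + e) * prods e l n (A - {a}) K" for e K
      using prods_insert_left[OF A(2,3), of e l n K] A(1) by simp
    then show ?thesis by (simp add: cJ_def)
  qed
  have merge: "((\<Prod>j\<in>J. l a - n j) * (\<Prod>j\<in>B - J. l a - n j + c)) * ((\<Prod>j\<in>J. l a - n j + c) * (\<Prod>k\<in>B - J. l a - n k))
      = (\<Prod>j\<in>B. (l a - n j) * (l a - n j + c))" if "J \<subseteq> B" for a J
    unfolding prod_split[OF fin(2) that, of "\<lambda>j. (l a - n j) * (l a - n j + c)", symmetric]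
    by (simp add: prod.distrib)
  \<comment> \<open>The two summands of \<open>PR\<close> come from the subsets without and with
    \<open>b\<close>. The second vanishes at l a, the first at l a + c, and what remains carries the
    same factor \<open>?W\<close> as on the left.\<close>
  have rootR: "poly PR (l a) = right_sum c t l n (A - {a}) B * ((\<Prod>i\<in>A. l i + c - l a) * (\<Prod>j\<in>B. (l a - n j) * (l a - n j + c)))"
     (is "_ = _ * ?W")
    if "a \<in> A" for a
  proof -
    have z: "(\<Prod>i\<in>A. l i - l a) = 0" using that fin by auto
    have *: "cJ J * ((\<Prod>i\<in>A. l i + c - l a) * ((\<Prod>j\<in>J. l a - n j + c) * (\<Prod>k\<in>B - J. l a - n k)))
      = t ^ card J * cut (- c) n B J * prods 0 l n (A - {a}) J * prods c l n (A - {a}) (B - J) * ?W"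
      if "J \<subseteq> B" for J
    proof -
      show ?thesis unfolding cJ_eq[OF \<open>a \<in> A\<close>] merge[OF that, symmetric] by (simp only: mult_ac)
    qed
    have "poly PR (l a) = (\<Sum>J\<in>Pow B. cJ J * ((\<Prod>i\<in>A. l i + c - l a) * ((\<Prod>j\<in>J. l a - n j + c) * (\<Prod>k\<in>B - J. l a - n k))))"
      unfolding PR_def by (simp add: poly_sum poly_prod z algebra_simps)
    also have "\<dots> = (\<Sum>J\<in>Pow B. t ^ card J * cut (- c) n B J * prods 0 l n (A - {a}) J * prods c l n (A - {a}) (B - J) * ?W)"
      by (intro sum.cong refl *) auto
    finally show ?thesis by (simp add: right_sum_def sum_distrib_right)
  qed
  have rootR': "poly PR (l a + c) = right_sum c t l n (A - {a}) B * (t * (\<Prod>i\<in>A. l i - l a - c) * (\<Prod>j\<in>B. (l a - n j) * (l a - n j + c)))"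
     (is "_ = _ * ?W")
    if "a \<in> A" for a
  proof -
    have z: "(\<Prod>i\<in>A. l i + c - (l a + c)) = 0" using that fin by auto
    have *: "t * cJ J * ((\<Prod>i\<in>A. l i - l a - c) * ((\<Prod>j\<in>J. l a - n j + c) * (\<Prod>k\<in>B - J. l a - n k)))
      = t ^ card J * cut (- c) n B J * prods 0 l n (A - {a}) J * prods c l n (A - {a}) (B - J) * ?W"
      if "J \<subseteq> B" for J
    proof -
      show ?thesis unfolding cJ_eq[OF \<open>a \<in> A\<close>] merge[OF that, symmetric] by (simp only: mult_ac)
    qed
    have "poly PR (l a + c) = (\<Sum>J\<in>Pow B. t * cJ J * ((\<Prod>i\<in>A. l i - l a - c) * ((\<Prod>j\<in>J. l a - n j + c) * (\<Prod>k\<in>B - J. l a - n k))))"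
      unfolding PR_def using z by (simp add: poly_sum poly_prod algebra_simps)
    also have "\<dots> = (\<Sum>J\<in>Pow B. t ^ card J * cut (- c) n B J * prods 0 l n (A - {a}) J * prods c l n (A - {a}) (B - J) * ?W)"
      by (intro sum.cong refl *) auto
    finally show ?thesis by (simp add: right_sum_def sum_distrib_right)
  qed
  have "PL = PR"
  proof (rule poly_eqI_degree)
    let ?S = "l ` A \<union> (\<lambda>a. l a + c) ` A"
    show "poly PL x = poly PR x" if "x \<in> ?S" for x
      using that by (auto simp: rootL rootL' rootR rootR' IH)
    \<comment> \<open>Here the genericity of \<open>c\<close> enters: no difference of two of the
      points equals \<open>c\<close>, so the translated set is disjoint from the original
      one.\<close>
    have "l ` A \<inter> (\<lambda>a. l a + c) ` A = {}" using gen(2) by force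
    moreover have "inj_on (\<lambda>a. l a + c) A" using inj(1) by (auto simp: inj_on_def)
    ultimately have "card ?S = card A + card A"
      using inj(1) fin by (simp add: card_Un_disjoint card_image)
    then show "card ?S > degree PL" "card ?S > degree PR" using degL degR card by auto
  qed
  then have "poly PL (n b) = poly PR (n b)" by simp
  moreover have "poly PL (n b) = left_sum c t l n A (insert b B) * (\<Prod>k\<in>B. n b - n k)"
  proof -
    have "cI I * ((\<Prod>i\<in>I. l i - n b) * (\<Prod>i\<in>A - I. l i + c - n b)) =
      t ^ card I * cut c l A I * prods 0 l n I (insert b B) * prods c l n (A - I) (insert b B)" for I
      unfolding prods_insert_right[OF fin(2) b] cI_def by (simp add: algebra_simps)
    then show ?thesis
      unfolding PL_def left_sum_def by (simp add: poly_sum poly_prod sum_distrib_right algebra_simps)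
  qed
  moreover have "poly PR (n b) = right_sum c t l n A (insert b B) * (\<Prod>k\<in>B. n b - n k)"
  proof -
    have nb: "n b - n k \<noteq> 0" "n k - n b \<noteq> 0" if "k \<in> B" for k using that inj(2) b by (auto simp: inj_on_def)
    define T where "T J = t ^ card J * cut (- c) n (insert b B) J * prods 0 l n A J * prods c l n A (insert b B - J)" for J
    have 1: "T J * (\<Prod>k\<in>B. n b - n k) =
       cJ J * ((\<Prod>i\<in>A. l i + c - n b) * ((\<Prod>j\<in>J. n b - n j + c) * (\<Prod>k\<in>B - J. n b - n k)))" if "J \<subseteq> B" for J
    proof -
      have BJ: "insert b B - J = insert b (B - J)" "finite (B - J)" "b \<notin> B - J" using that b fin by auto
      have "(\<Prod>i\<in>J. (n i - n b + - c) / (n i - n b)) * (\<Prod>k\<in>J. n b - n k) = (\<Prod>j\<in>J. n b - n j + c)"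
        unfolding prod.distrib[symmetric] using that nb
        by (intro prod.cong refl) (auto simp: field_simps subset_iff)
      then show ?thesis
        unfolding T_def cJ_def BJ(1) prods_insert_right[OF BJ(2,3)] cut_insert_notin[OF fin(2) b that]
          prod_split[OF fin(2) that, of "\<lambda>k. n b - n k", symmetric]
        by (simp add: algebra_simps)
    qed
    have 2: "T (insert b J) * (\<Prod>k\<in>B. n b - n k) =
       t * cJ J * ((\<Prod>i\<in>A. l i - n b) * ((\<Prod>j\<in>J. n b - n j) * (\<Prod>k\<in>B - J. n b - n k - c)))" if "J \<subseteq> B" for J
    proof -
      have BJ: "insert b B - insert b J = B - J" "finite J" "b \<notin> J" using that b fin finite_subset by auto
      have "(\<Prod>k\<in>B - J. (n b - n k + - c) / (n b - n k)) * (\<Prod>k\<in>B - J. n b - n k) = (\<Prod>k\<in>B - J. n b - n k - c)"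
        unfolding prod.distrib[symmetric] using that nb
        by (intro prod.cong refl) (auto simp: field_simps subset_iff)
      then show ?thesis
        unfolding T_def cJ_def BJ(1) prods_insert_right[OF BJ(2,3)] cut_insert_in[OF fin(2) b that]
          prod_split[OF fin(2) that, of "\<lambda>k. n b - n k", symmetric]
        using BJ by (simp add: algebra_simps)
    qed
    have "right_sum c t l n A (insert b B) * (\<Prod>k\<in>B. n b - n k) =
       (\<Sum>J\<in>Pow B. T J * (\<Prod>k\<in>B. n b - n k) + T (insert b J) * (\<Prod>k\<in>B. n b - n k))"
      unfolding right_sum_def sum_Pow_insert[OF fin(2) b] T_def
      by (simp add: sum_distrib_right distrib_right)
    also have "\<dots> = poly PR (n b)"
      unfolding PR_def poly_sum by (intro sum.cong refl) (auto simp: 1 2 poly_prod algebra_simps)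
    finally show ?thesis by simp
  qed
  moreover have "(\<Prod>k\<in>B. n b - n k) \<noteq> 0"
    using fin b inj(2) by (auto simp: inj_on_def)
  ultimately show ?thesis by simp
qed

section \<open>Removing the restrictions on the shift and on the sizes of the two sets\<close>

lemma continuous_left_right_sum [continuous_intros]:
  "continuous_on UNIV (\<lambda>c. left_sum c t l n A B)" "continuous_on UNIV (\<lambda>c. right_sum c t l n A B)"
  unfolding left_sum_def right_sum_def cut_def prods_def divide_inverse
  by (intro continuous_intros)+

lemma continuous_zero_cofinite:
  fixes f :: "real \<Rightarrow> real"
  assumes "continuous_on UNIV f" "finite S" "\<And>c. c \<notin> S \<Longrightarrow> f c = 0"
  shows "f c = 0"
proof -
  have "(f \<longlongrightarrow> f c) (at c)"
    using assms(1) by (simp add: continuous_on_eq_continuous_at continuous_at)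
  moreover have "\<forall>\<^sub>F x in at c. f x = 0"
  proof -
    have "open (- (S - {c}))" using assms(2) by (intro open_Compl finite_imp_closed) auto
    then show ?thesis
      unfolding eventually_at_topological using assms(3) by (intro exI[of _ "- (S - {c})"]) auto
  qed
  ultimately show ?thesis
    by (metis tendsto_eventually tendsto_unique trivial_limit_at)
qed

text \<open>The denominators of \<open>cut\<close> do not involve \<open>c\<close>, so both sides
  are continuous in \<open>c\<close>. The induction step applies off a finite set of values of
  \<open>c\<close>, and continuity fills in the rest.\<close>

lemma left_sum_eq_right_sum_same_card:
  fixes l :: "'a \<Rightarrow> real" and n :: "'b \<Rightarrow> real"
  assumes "finite A" "finite B" "card A = card B" "inj_on l A" "inj_on n B"
  shows "left_sum c t l n A B = right_sum c t l n A B"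
  using assms(2,1,3-5)
proof (induction B arbitrary: A c rule: finite_induct)
  case empty
  then show ?case by (simp add: left_sum_def right_sum_def cut_def prods_def)
next
  case (insert b B)
  define S where "S = insert 0 ((\<lambda>(a, a'). l a' - l a) ` (A \<times> A))"
  have "left_sum c t l n A (insert b B) - right_sum c t l n A (insert b B) = 0"
  proof (rule continuous_zero_cofinite[where S = S and c = c and
        f = "\<lambda>c. left_sum c t l n A (insert b B) - right_sum c t l n A (insert b B)"])
    show "continuous_on UNIV (\<lambda>c. left_sum c t l n A (insert b B) - right_sum c t l n A (insert b B))"
      by (intro continuous_intros)
    show "finite S" using insert.prems by (simp add: S_def)
    show "left_sum c t l n A (insert b B) - right_sum c t l n A (insert b B) = 0" if "c \<notin> S" for c
    proof -
      have "left_sum c t l n A (insert b B) = right_sum c t l n A (insert b B)"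
      proof (rule left_right_step)
        show "card A = Suc (card B)" using insert by simp
        show "c \<noteq> 0" using that by (simp add: S_def)
        show "l a' - l a \<noteq> c" if "a \<in> A" "a' \<in> A" for a a'
          using \<open>c \<notin> S\<close> that by (force simp: S_def)
        show "left_sum c t l n (A - {a}) B = right_sum c t l n (A - {a}) B" if "a \<in> A" for a
          using insert.prems that insert.hyps by (intro insert.IH) (auto simp: inj_on_def)
      qed (use insert in auto)
      then show ?thesis by simp
    qed
  qed
  then show ?case by simp
qed

text \<open>A missing point is supplied and sent to infinity. After division by (-X)^card A each
  subset of \<open>B\<close> counts once without the new point, with limiting weight 1, and once
  with it, with limiting weight t. So every missing point costs a factor 1 + t. Indexing
  \<open>n\<close> by natural numbers guarantees a fresh index.\<close>

theorem left_sum_eq_right_sum: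
  fixes l :: "'a \<Rightarrow> real" and n :: "nat \<Rightarrow> real"
  assumes "finite A" "finite B" "card B \<le> card A" "inj_on l A" "inj_on n B"
  shows "left_sum c t l n A B = (1 + t) ^ (card A - card B) * right_sum c t l n A B"
  using assms
proof (induction "card A - card B" arbitrary: B n)
  case 0
  then show ?case by (simp add: left_sum_eq_right_sum_same_card)
next
  case (Suc d)
  obtain b where b: "b \<notin> B" using Suc.prems(2) ex_new_if_finite infinite_UNIV_nat by blast
  have d: "d = card A - Suc (card B)" "Suc (card B) \<le> card A"
    using Suc.hyps(2) by linarith+
  define m where "m X = n(b := X)" for X :: real
  have mB: "m X j = n j" if "j \<in> B" for X j using that b by (auto simp: m_def)
  have mb [simp]: "m X b = X" for X by (simp add: m_def)
  have large: "\<forall>\<^sub>F X in at_top. \<forall>j\<in>B. n j < X" "\<forall>\<^sub>F X in at_top. 0 < (X::real)"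
    using Suc.prems(2) by (auto simp: eventually_ball_finite_distrib eventually_gt_at_top)
  have ev: "\<forall>\<^sub>F X in at_top. left_sum c t l (m X) A (insert b B) / (- X) ^ card A =
      (1 + t) ^ d * right_sum c t l (m X) A (insert b B) / (- X) ^ card A"
    using large(1)
  proof eventually_elim
    case (elim X)
    have "inj_on (m X) (insert b B)"
      using Suc.prems(5) elim b by (auto simp: m_def inj_on_def)
    then show ?case
      using Suc.hyps(1)[of "insert b B" "m X"] Suc.hyps(2) Suc.prems b
      by (simp add: d)
  qed
  have cB: "cut e (m X) B J = cut e n B J" if "J \<subseteq> B" for e X J
    using that mB by (intro cut_cong) auto
  have pB: "prods e l (m X) A' B' = prods e l n A' B'" if "B' \<subseteq> B" for e X A' B'
    using that mB by (intro prods_cong) auto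
  have lim0: "((\<lambda>X. 1 + e / (X - r)) \<longlongrightarrow> 1) at_top" for e r :: real
  proof -
    have "((\<lambda>X. e / (X - r)) \<longlongrightarrow> 0) at_top"
      using filterlim_tendsto_add_at_top[OF tendsto_const filterlim_ident, of "- r"]
      by (intro real_tendsto_divide_at_top[OF tendsto_const]) simp
    then show ?thesis using tendsto_add[OF tendsto_const, of _ 0 at_top 1] by force
  qed
  have lim1: "((\<lambda>X. (p - X) / (- X)) \<longlongrightarrow> 1) at_top" for p :: real
  proof (rule tendsto_cong[THEN iffD1, OF _ lim0[of "- p" 0]])
    show "\<forall>\<^sub>F X in at_top. 1 + - p / (X - 0) = (p - X) / - X"
      using eventually_gt_at_top[of 0] by eventually_elim (simp add: field_simps)
  qed
  have lim2: "((\<lambda>X. (p - X + q) / (p - X)) \<longlongrightarrow> 1) at_top" for p q :: real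
  proof (rule tendsto_cong[THEN iffD1, OF _ lim0[of "- q" p]])
    show "\<forall>\<^sub>F X in at_top. 1 + - q / (X - p) = (p - X + q) / (p - X)"
      using eventually_gt_at_top[of p] by eventually_elim (simp add: divide_simps, simp add: algebra_simps)
  qed
  have lim2': "((\<lambda>X. (X - p + q) / (X - p)) \<longlongrightarrow> 1) at_top" for p q :: real
  proof (rule tendsto_cong[THEN iffD1, OF _ lim0[of q p]])
    show "\<forall>\<^sub>F X in at_top. 1 + q / (X - p) = (X - p + q) / (X - p)"
      using eventually_gt_at_top[of p] by eventually_elim (simp add: divide_simps)
  qed
  have limA: "((\<lambda>X. (\<Prod>i\<in>A. (p i - X) / (- X))) \<longlongrightarrow> 1) at_top" for p :: "'a \<Rightarrow> real"
    using tendsto_prod[of A "\<lambda>i X. (p i - X) / (- X)" "\<lambda>_. 1" at_top] lim1 by simp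
  have lim3: "((\<lambda>X. (\<Prod>i\<in>J. (p i - X + q) / (p i - X))) \<longlongrightarrow> 1) at_top" for p :: "nat \<Rightarrow> real" and q J
    using tendsto_prod[of J "\<lambda>i X. (p i - X + q) / (p i - X)" "\<lambda>_. 1" at_top] lim2 by simp
  have lim4: "((\<lambda>X. (\<Prod>i\<in>J. (X - p i + q) / (X - p i))) \<longlongrightarrow> 1) at_top" for p :: "nat \<Rightarrow> real" and q J
    using tendsto_prod[of J "\<lambda>i X. (X - p i + q) / (X - p i)" "\<lambda>_. 1" at_top] lim2' by simp
  have limL: "((\<lambda>X. left_sum c t l (m X) A (insert b B) / (- X) ^ card A) \<longlongrightarrow> left_sum c t l n A B) at_top"
  proof -
    have eq: "left_sum c t l (m X) A (insert b B) / (- X) ^ card A =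
      (\<Sum>I\<in>Pow A. t ^ card I * cut c l A I * prods 0 l n I B * prods c l n (A - I) B *
         (\<Prod>i\<in>A. ((if i \<in> I then l i else l i + c) - X) / (- X)))" for X
    proof -
      have "t ^ card I * cut c l A I * prods 0 l (m X) I (insert b B) * prods c l (m X) (A - I) (insert b B) / (- X) ^ card A
        = t ^ card I * cut c l A I * prods 0 l n I B * prods c l n (A - I) B *
         (\<Prod>i\<in>A. ((if i \<in> I then l i else l i + c) - X) / (- X))" if "I \<subseteq> A" for I
      proof -
        have e: "(\<Prod>i\<in>I. l i - X) * (\<Prod>i\<in>A - I. l i - X + c) / (- X) ^ card A =
           (\<Prod>i\<in>A. ((if i \<in> I then l i else l i + c) - X) / (- X))"
          unfolding prod_dividef prod_constant
          by (subst prod_split[OF Suc.prems(1) that, symmetric]) (auto intro!: arg_cong2[of _ _ _ _ "\<lambda>u v. u * v / _"] prod.cong)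
        show ?thesis
          unfolding prods_insert_right[OF Suc.prems(2) b] pB[OF subset_refl] e[symmetric] mb
          by (simp add: mult_ac)
      qed
      then show ?thesis unfolding left_sum_def sum_divide_distrib by (intro sum.cong) auto
    qed
    have "((\<lambda>X. \<Sum>I\<in>Pow A. t ^ card I * cut c l A I * prods 0 l n I B * prods c l n (A - I) B *
         (\<Prod>i\<in>A. ((if i \<in> I then l i else l i + c) - X) / (- X))) \<longlongrightarrow>
      (\<Sum>I\<in>Pow A. t ^ card I * cut c l A I * prods 0 l n I B * prods c l n (A - I) B * 1)) at_top"
      by (intro tendsto_intros limA)
    then show ?thesis unfolding eq by (simp add: left_sum_def)
  qed
  have limR: "((\<lambda>X. (1 + t) ^ d * right_sum c t l (m X) A (insert b B) / (- X) ^ card A) \<longlongrightarrow>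
     (1 + t) ^ d * (\<Sum>J\<in>Pow B. t ^ card J * cut (- c) n B J * prods 0 l n A J * prods c l n A (B - J) * (1 * 1 + t * (1 * 1)))) at_top"
  proof -
    have eq: "(1 + t) ^ d * right_sum c t l (m X) A (insert b B) / (- X) ^ card A =
      (1 + t) ^ d * (\<Sum>J\<in>Pow B. t ^ card J * cut (- c) n B J * prods 0 l n A J * prods c l n A (B - J) *
         ((\<Prod>i\<in>A. (l i + c - X) / (- X)) * (\<Prod>j\<in>J. (n j - X + - c) / (n j - X)) +
          t * ((\<Prod>i\<in>A. (l i - X) / (- X)) * (\<Prod>k\<in>B - J. (X - n k + - c) / (X - n k)))))" for X
    proof -
      have "(t ^ card J * cut (- c) (m X) (insert b B) J * prods 0 l (m X) A J * prods c l (m X) A (insert b B - J)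
        + t ^ card (insert b J) * cut (- c) (m X) (insert b B) (insert b J) * prods 0 l (m X) A (insert b J)
            * prods c l (m X) A (insert b B - insert b J)) / (- X) ^ card A
        = t ^ card J * cut (- c) n B J * prods 0 l n A J * prods c l n A (B - J) *
         ((\<Prod>i\<in>A. (l i + c - X) / (- X)) * (\<Prod>j\<in>J. (n j - X + - c) / (n j - X)) +
          t * ((\<Prod>i\<in>A. (l i - X) / (- X)) * (\<Prod>k\<in>B - J. (X - n k + - c) / (X - n k))))"
        if "J \<subseteq> B" for J
      proof -
        have BJ: "insert b B - J = insert b (B - J)" "insert b B - insert b J = B - J" "finite (B - J)" "b \<notin> B - J"
          "b \<notin> J" "finite J"
          using that b Suc.prems(2) by (auto intro: finite_subset)
        have 1: "(\<Prod>j\<in>J. (m X j - X + - c) / (m X j - X)) = (\<Prod>j\<in>J. (n j - X + - c) / (n j - X))"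
          using that mB by (intro prod.cong refl) (auto simp: subset_iff)
        have 2: "(\<Prod>j\<in>B - J. (X - m X j + - c) / (X - m X j)) = (\<Prod>j\<in>B - J. (X - n j + - c) / (X - n j))"
          using that mB by (intro prod.cong refl) (auto simp: subset_iff)
        have 4: "(\<Prod>i\<in>A. l i - X + c) = (\<Prod>i\<in>A. l i + c - X)" "(\<Prod>i\<in>A. l i - X + 0) = (\<Prod>i\<in>A. l i - X)"
          by (simp_all add: algebra_simps)
        have alg: "(T * (K * F) * P * (U * P') + t * T * (K * F') * (U' * P) * P') / D =
          T * K * P * P' * (U / D * F + t * (U' / D * F'))" for T K F P U P' F' U' D :: real
          by (simp add: add_divide_distrib algebra_simps)
        have 3: "(\<Prod>i\<in>A. (p i - X) / (- X)) = (\<Prod>i\<in>A. p i - X) / (- X) ^ card A" for p :: "'a \<Rightarrow> real"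
          unfolding prod_dividef by simp
        show ?thesis
          unfolding BJ(1,2) prods_insert_right[OF BJ(3,4)] prods_insert_right[OF BJ(6,5)]
            cut_insert_notin[OF Suc.prems(2) b that] cut_insert_in[OF Suc.prems(2) b that]
            cB[OF that] pB[OF that] pB[OF Diff_subset] mb 1 2 3 4 card_insert_disjoint[OF BJ(6,5)] power_Suc
          by (rule alg)
      qed
      then show ?thesis
        unfolding right_sum_def sum_Pow_insert[OF Suc.prems(2) b] times_divide_eq_right[symmetric]
          sum_divide_distrib
        by (intro arg_cong[of _ _ "(*) _"] sum.cong) auto
    qed
    show ?thesis unfolding eq
      by (intro tendsto_intros limA lim3 lim4)
  qed
  have R: "(\<Sum>J\<in>Pow B. t ^ card J * cut (- c) n B J * prods 0 l n A J * prods c l n A (B - J) * (1 * 1 + t * (1 * 1)))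
     = (1 + t) * right_sum c t l n A B"
    by (simp add: right_sum_def sum_distrib_left mult_ac)
  have "left_sum c t l n A B = (1 + t) ^ d * ((1 + t) * right_sum c t l n A B)"
    unfolding R[symmetric]
    by (rule tendsto_unique[OF trivial_limit_at_top_linorder limL tendsto_cong[OF ev, THEN iffD2, OF limR]])
  also have "\<dots> = (1 + t) ^ (card A - card B) * right_sum c t l n A B"
    unfolding Suc.hyps(2)[symmetric] by simp
  finally show ?case .
qed

section \<open>The branching coefficients in closed form\<close>

definition spart :: "real \<Rightarrow> int list \<Rightarrow> nat \<Rightarrow> real" where
  "spart \<theta> lam i = real_of_int (lam ! i) + \<theta> * (real (length lam) - 1 - real i)"

definition bump :: "int \<Rightarrow> nat set \<Rightarrow> int list \<Rightarrow> int list" where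
  "bump e I lam = map (\<lambda>i. lam ! i + (if i \<in> I then e else 0)) [0..<length lam]"

text \<open>
  This is \<open>J\<^sub>\<lambda>(1^N)\<close> up to a factor depending on \<open>N\<close> and \<open>\<theta>\<close> only. It serves as a normalisation that makes
  the Pieri coefficients rational in \<open>spart\<close>; the evaluation itself is not needed.
\<close>

definition at_ones :: "real \<Rightarrow> int list \<Rightarrow> real" where
  "at_ones \<theta> lam = (\<Prod>k<length lam. \<Prod>i<k.
     Gamma (spart \<theta> lam i - spart \<theta> lam k + \<theta>) / Gamma (spart \<theta> lam i - spart \<theta> lam k))"

definition branch :: "real \<Rightarrow> int list \<Rightarrow> int list \<Rightarrow> real" where
  "branch \<theta> lam \<mu> = jack_psi \<theta> lam \<mu> * at_ones \<theta> \<mu> / at_ones \<theta> lam"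

lemma length_bump [simp]: "length (bump e I lam) = length lam"
  by (simp add: bump_def)

lemma nth_bump [simp]: "i < length lam \<Longrightarrow> bump e I lam ! i = lam ! i + (if i \<in> I then e else 0)"
  by (simp add: bump_def)

lemma bump_inverse [simp]: "bump (- e) I (bump e I lam) = lam" "bump e I (bump (- e) I lam) = lam"
  by (auto intro!: nth_equalityI)

lemma sum_list_bump:
  assumes "I \<subseteq> {..<length lam}"
  shows "sum_list (bump e I lam) = sum_list lam + e * int (card I)"
proof -
  have "sum_list (bump e I lam) = (\<Sum>i<length lam. lam ! i + (if i \<in> I then e else 0))"
    by (simp add: sum_list_sum_nth atLeast0LessThan)
  also have "\<dots> = sum_list lam + (\<Sum>i<length lam. if i \<in> I then e else 0)"
    by (simp add: sum.distrib sum_list_sum_nth atLeast0LessThan)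
  also have "(\<Sum>i<length lam. if i \<in> I then e else 0) = e * int (card I)"
    using assms by (simp add: sum.If_cases Int_absorb1)
  finally show ?thesis .
qed

lemma spart_bump:
  "i < length lam \<Longrightarrow> spart \<theta> (bump e I lam) i = spart \<theta> lam i + (if i \<in> I then real_of_int e else 0)"
  by (simp add: spart_def)

lemma GT_iff: "lam \<in> GT N \<longleftrightarrow> length lam = N \<and> (\<forall>i. Suc i < N \<longrightarrow> lam ! Suc i \<le> lam ! i)"
  by (auto simp: GT_def sorted_wrt_iff_nth_Suc_transp transp_def)

lemma GT_length: "lam \<in> GT N \<Longrightarrow> length lam = N"
  by (simp add: GT_def)

lemma GT_antimono: "lam \<in> GT N \<Longrightarrow> i \<le> k \<Longrightarrow> k < N \<Longrightarrow> lam ! k \<le> lam ! i"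
  by (cases "i = k") (auto simp: GT_def sorted_wrt_iff_nth_less)

lemma spart_diff:
  "spart \<theta> lam i - spart \<theta> lam k = real_of_int (lam ! i - lam ! k) + \<theta> * (real k - real i)"
  by (simp add: spart_def algebra_simps)

lemma spart_diff_ge:
  assumes "lam \<in> GT N" "i < k" "k < N" "\<theta> > 0"
  shows "spart \<theta> lam i - spart \<theta> lam k \<ge> \<theta>"
proof -
  have "real k - real i \<ge> 1" using assms(2) by simp
  then have "\<theta> * (real k - real i) \<ge> \<theta>" using assms(4) by simp
  moreover have "lam ! k \<le> lam ! i" using GT_antimono[OF assms(1)] assms by simp
  ultimately show ?thesis unfolding spart_diff by simp
qed

lemma inj_spart:
  assumes "lam \<in> GT N" "\<theta> > 0"
  shows "inj_on (spart \<theta> lam) {..<N}"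
proof (rule inj_onI)
  fix i k assume *: "i \<in> {..<N}" "k \<in> {..<N}" "spart \<theta> lam i = spart \<theta> lam k"
  show "i = k"
    using spart_diff_ge[OF assms(1), of i k \<theta>] spart_diff_ge[OF assms(1), of k i \<theta>] * assms(2)
    by (cases i k rule: linorder_cases) auto
qed

lemma at_ones_pos:
  assumes "lam \<in> GT N" "\<theta> > 0"
  shows "at_ones \<theta> lam > 0"
  unfolding at_ones_def
proof (intro prod_pos divide_pos_pos Gamma_real_pos ballI)
  fix k i assume "k \<in> {..<length lam}" "i \<in> {..<k}"
  then have "spart \<theta> lam i - spart \<theta> lam k \<ge> \<theta>"
    using spart_diff_ge[OF assms(1), of i k \<theta>] assms GT_length by auto
  then show "spart \<theta> lam i - spart \<theta> lam k + \<theta> > 0" "spart \<theta> lam i - spart \<theta> lam k > 0"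
    using assms(2) by linarith+
qed

section \<open>Interlacing signatures and Gamma weights\<close>

lemma interlaces_nth:
  assumes "\<mu> \<prec>\<^sub>G\<^sub>T lam" "i < length \<mu>"
  shows "lam ! Suc i \<le> \<mu> ! i" "\<mu> ! i \<le> lam ! i"
  using assms by (auto simp: interlaces_def)

lemma interlaces_GT:
  assumes "\<mu> \<prec>\<^sub>G\<^sub>T lam" "length \<mu> = N"
  shows "lam \<in> GT (Suc N)" "\<mu> \<in> GT N"
proof -
  have len: "length lam = Suc N" and ge: "\<And>i. i < N \<Longrightarrow> lam ! Suc i \<le> \<mu> ! i" "\<And>i. i < N \<Longrightarrow> \<mu> ! i \<le> lam ! i"
    using assms by (auto simp: interlaces_def)
  have "lam ! Suc i \<le> lam ! i" if "i < N" for i using ge[OF that] by linarith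
  then show "lam \<in> GT (Suc N)" using len by (simp add: GT_iff)
  have "\<mu> ! Suc i \<le> \<mu> ! i" if "Suc i < N" for i
    using ge(2)[OF that] ge(1)[of i] that by linarith
  then show "\<mu> \<in> GT N" using assms(2) by (simp add: GT_iff)
qed

text \<open>By the reflection formula the quotient of the two cases has period 1 in d, so both obey
  the same recursion under d -> d + 1. The split keeps the Gamma arguments positive for interlacing
  signatures: the difference d of row k of \<lambda> and row i of \<mu> is at least \<theta> for k
  \<le> i and at most 0 for i < k.\<close>

definition pair_weight :: "real \<Rightarrow> nat \<Rightarrow> nat \<Rightarrow> real \<Rightarrow> real" where
  "pair_weight \<theta> k i d =
     (if k \<le> i then Gamma d / Gamma (d + 1 - \<theta>) else Gamma (\<theta> - d) / Gamma (1 - d))"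

definition vdm :: "nat \<Rightarrow> (nat \<Rightarrow> real) \<Rightarrow> real" where
  "vdm N m = (\<Prod>k<N. \<Prod>i<k. m i - m k)"

definition top_weight :: "real \<Rightarrow> nat \<Rightarrow> (nat \<Rightarrow> real) \<Rightarrow> real" where
  "top_weight \<theta> N l = (\<Prod>k<N. \<Prod>i<k. Gamma (l i - l k + 1 - \<theta>) / Gamma (l i - l k + \<theta>))"

text \<open>Each resulting Gamma quotient depends on a single difference of shifted parts: with
  \<open>m\<close> and \<open>l\<close> those of \<mu> and \<lambda>, P = m i - m j, R = l i - m j,
  P + n = m i - l (Suc j) and R + n = l i - l (Suc j). \<open>R\<close> absorbs a \<theta> because
  \<open>spart\<close> depends on the length, which differs by one between the two
  signatures.\<close>

lemma psi_factor:
  fixes P R \<theta> :: real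
  assumes "\<theta> > 0" "P \<ge> 0" "R \<ge> \<theta>"
  shows "pochhammer (P + \<theta>) n / pochhammer (P + 1) n * (pochhammer (R - \<theta> + 1) n / pochhammer R n) =
    (Gamma (P + real n + \<theta>) / Gamma (P + real n + 1)) * (Gamma R / Gamma (R + 1 - \<theta>)) *
    (Gamma (P + 1) / Gamma (P + \<theta>)) * (Gamma (R + real n + 1 - \<theta>) / Gamma (R + real n))"
proof -
  have *: "pochhammer z n = Gamma (z + real n) / Gamma z" if "z > 0" for z :: real
    using that by (intro pochhammer_Gamma) (auto dest: nonpos_Ints_nonpos)
  have 1: "pochhammer (P + \<theta>) n = Gamma (P + real n + \<theta>) / Gamma (P + \<theta>)"
    using *[of "P + \<theta>"] assms by (simp add: add_ac)
  have 2: "pochhammer (P + 1) n = Gamma (P + real n + 1) / Gamma (P + 1)"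
    using *[of "P + 1"] assms by (simp add: add_ac)
  have 3: "pochhammer (R - \<theta> + 1) n = Gamma (R + real n + 1 - \<theta>) / Gamma (R + 1 - \<theta>)"
    using *[of "R - \<theta> + 1"] assms by (simp add: algebra_simps)
  have 4: "pochhammer R n = Gamma (R + real n) / Gamma R"
    using *[of R] assms by simp
  show ?thesis unfolding 1 2 3 4 by (simp add: divide_simps)
qed

text \<open>A pair with i < k has the form (Suc j, i) with i \<le> j, and a pair with k \<le> i has
  the form (i', j) with i' \<le> j. This turns the triangular range of \<open>jack_psi\<close> into
  the rectangle of all pairs of a row of \<lambda> and a row of \<mu>.\<close>

lemma prod_pair_split:
  fixes g :: "nat \<Rightarrow> nat \<Rightarrow> real"
  shows "(\<Prod>k<Suc N. \<Prod>i<N. g k i) = (\<Prod>j<N. \<Prod>i\<le>j. g (Suc j) i * g i j)"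
proof (induction N)
  case (Suc N)
  have "(\<Prod>k<Suc (Suc N). \<Prod>i<Suc N. g k i) =
     ((\<Prod>k<Suc N. \<Prod>i<N. g k i) * (\<Prod>k<Suc N. g k N)) * (\<Prod>i<Suc N. g (Suc N) i)"
    by (simp add: prod.distrib)
  also have "\<dots> = (\<Prod>j<N. \<Prod>i\<le>j. g (Suc j) i * g i j) * (\<Prod>i<Suc N. g (Suc N) i * g i N)"
    unfolding Suc.IH prod.distrib[of _ _ "{..<Suc N}"] by simp
  also have "\<dots> = (\<Prod>j<Suc N. \<Prod>i\<le>j. g (Suc j) i * g i j)"
    by (subst (2) prod.lessThan_Suc) (simp only: lessThan_Suc_atMost)
  finally show ?case .
qed simp

text \<open>A discrete form of the Dixon-Anderson density. The normalisation cancels Gamma factors: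
  those of \<mu> collapse to \<Gamma>(d + 1)/\<Gamma>(d) = d, hence the Vandermonde product, and the
  diagonal i = j leaves one 1/\<Gamma>(\<theta>) per row; those of \<lambda> collapse to
  \<open>top_weight\<close>.\<close>

lemma branch_closed_form:
  assumes "\<mu> \<prec>\<^sub>G\<^sub>T lam" "length \<mu> = N" "\<theta> > 0"
  shows "branch \<theta> lam \<mu> = (1 / Gamma \<theta>) ^ N * vdm N (spart \<theta> \<mu>) *
    (\<Prod>k<Suc N. \<Prod>i<N. pair_weight \<theta> k i (spart \<theta> lam k - spart \<theta> \<mu> i)) * top_weight \<theta> (Suc N) (spart \<theta> lam)"
proof -
  define l where "l = spart \<theta> lam"
  define m where "m = spart \<theta> \<mu>"
  have GT: "lam \<in> GT (Suc N)" "\<mu> \<in> GT N" using interlaces_GT[OF assms(1,2)] by auto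
  have len: "length lam = Suc N" using GT(1) by (rule GT_length)
  have ml: "m i - l k = real_of_int (\<mu> ! i - lam ! k) + \<theta> * (real k - 1 - real i)" for i k
    using assms(2) len by (simp add: m_def l_def spart_def algebra_simps)
  have mm: "m i - m j = real_of_int (\<mu> ! i - \<mu> ! j) + \<theta> * (real j - real i)" for i j
    by (simp add: m_def spart_diff)
  have ll: "l i - l j = real_of_int (lam ! i - lam ! j) + \<theta> * (real j - real i)" for i j
    by (simp add: l_def spart_diff)
  have "jack_psi \<theta> lam \<mu> = (\<Prod>j<N. \<Prod>i\<le>j.
      (pair_weight \<theta> (Suc j) i (l (Suc j) - m i) * pair_weight \<theta> i j (l i - m j)) *
      ((Gamma (m i - m j + 1) / Gamma (m i - m j + \<theta>)) * (Gamma (l i - l (Suc j) + 1 - \<theta>) / Gamma (l i - l (Suc j)))))"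
    unfolding jack_psi_def assms(2) Let_def
  proof (intro prod.cong refl)
    fix j i assume ji: "j \<in> {..<N}" "i \<in> {..j}"
    define n where "n = nat (\<mu> ! j - lam ! Suc j)"
    have n: "real n = real_of_int (\<mu> ! j - lam ! Suc j)"
      using interlaces_nth[OF assms(1), of j] ji assms(2) by (simp add: n_def)
    have P: "m i - m j \<ge> 0" using GT_antimono[OF GT(2), of i j] ji assms(3) by (simp add: mm)
    have R: "l i - m j \<ge> \<theta>"
    proof -
      have "\<mu> ! j \<le> lam ! i"
        using interlaces_nth[OF assms(1), of j] GT_antimono[OF GT(1), of i j] ji assms(2) by auto
      moreover have "\<theta> * (real j - real i) \<ge> 0" using ji assms(3) by simp
      moreover have "l i - m j = real_of_int (lam ! i - \<mu> ! j) + \<theta> * (real j - real i) + \<theta>"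
        using ml[of j i] by (simp add: algebra_simps)
      ultimately show ?thesis by simp
    qed
    have eq: "real_of_int (\<mu> ! i - \<mu> ! j) + \<theta> * (real j - real i) = m i - m j"
      "real_of_int (lam ! i - \<mu> ! j) + \<theta> * (real j - real i) + 1 = l i - m j - \<theta> + 1"
      "real_of_int (lam ! i - \<mu> ! j) + \<theta> * (real j - real i) + \<theta> = l i - m j"
      using ml[of j i] by (simp_all add: mm algebra_simps)
    have sums: "\<theta> - (l (Suc j) - m i) = m i - m j + real n + \<theta>" "1 - (l (Suc j) - m i) = m i - m j + real n + 1"
      "l i - l (Suc j) = l i - m j + real n"
      using ml[of i "Suc j"] mm[of i j] ml[of j i] ll[of i "Suc j"] n by (simp_all add: algebra_simps)
    show "pochhammer (real_of_int (\<mu> ! i - \<mu> ! j) + \<theta> * (real j - real i) + \<theta>) (nat (\<mu> ! j - lam ! Suc j)) /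
       pochhammer (real_of_int (\<mu> ! i - \<mu> ! j) + \<theta> * (real j - real i) + 1) (nat (\<mu> ! j - lam ! Suc j)) *
       (pochhammer (real_of_int (lam ! i - \<mu> ! j) + \<theta> * (real j - real i) + 1) (nat (\<mu> ! j - lam ! Suc j)) /
        pochhammer (real_of_int (lam ! i - \<mu> ! j) + \<theta> * (real j - real i) + \<theta>) (nat (\<mu> ! j - lam ! Suc j))) =
      (pair_weight \<theta> (Suc j) i (l (Suc j) - m i) * pair_weight \<theta> i j (l i - m j)) *
      ((Gamma (m i - m j + 1) / Gamma (m i - m j + \<theta>)) * (Gamma (l i - l (Suc j) + 1 - \<theta>) / Gamma (l i - l (Suc j))))"
      unfolding eq n_def[symmetric] psi_factor[OF assms(3) P R]
      unfolding pair_weight_def sums using ji by simp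
  qed
  also have "\<dots> = (\<Prod>k<Suc N. \<Prod>i<N. pair_weight \<theta> k i (l k - m i)) *
      ((\<Prod>j<N. \<Prod>i\<le>j. Gamma (m i - m j + 1) / Gamma (m i - m j + \<theta>)) *
       (\<Prod>j<N. \<Prod>i\<le>j. Gamma (l i - l (Suc j) + 1 - \<theta>) / Gamma (l i - l (Suc j))))"
    unfolding prod_pair_split prod.distrib ..
  also have "(\<Prod>j<N. \<Prod>i\<le>j. Gamma (l i - l (Suc j) + 1 - \<theta>) / Gamma (l i - l (Suc j))) =
     (\<Prod>k<Suc N. \<Prod>i<k. Gamma (l i - l k + 1 - \<theta>) / Gamma (l i - l k))"
    by (subst prod.lessThan_Suc_shift) (simp add: lessThan_Suc_atMost)
  also have "\<dots> = top_weight \<theta> (Suc N) l * at_ones \<theta> lam"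
    unfolding top_weight_def at_ones_def len l_def[symmetric] prod.distrib[symmetric]
  proof (intro prod.cong refl)
    fix k i assume "k \<in> {..<Suc N}" "i \<in> {..<k}"
    then have "l i - l k \<ge> \<theta>" unfolding l_def using spart_diff_ge[OF GT(1), of i k \<theta>] assms(3) by simp
    then have "Gamma (l i - l k + \<theta>) \<noteq> 0" using assms(3) Gamma_real_pos[of "l i - l k + \<theta>"] by linarith
    then show "Gamma (l i - l k + 1 - \<theta>) / Gamma (l i - l k) =
      Gamma (l i - l k + 1 - \<theta>) / Gamma (l i - l k + \<theta>) * (Gamma (l i - l k + \<theta>) / Gamma (l i - l k))" by simp
  qed
  finally have psi: "jack_psi \<theta> lam \<mu> = (\<Prod>k<Suc N. \<Prod>i<N. pair_weight \<theta> k i (l k - m i)) *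
      ((\<Prod>j<N. \<Prod>i\<le>j. Gamma (m i - m j + 1) / Gamma (m i - m j + \<theta>)) * (top_weight \<theta> (Suc N) l * at_ones \<theta> lam))" .
  have "(\<Prod>j<N. \<Prod>i\<le>j. Gamma (m i - m j + 1) / Gamma (m i - m j + \<theta>)) * at_ones \<theta> \<mu> =
     (\<Prod>j<N. 1 / Gamma \<theta> * (\<Prod>i<j. m i - m j))"
    unfolding at_ones_def assms(2) m_def[symmetric] prod.distrib[symmetric]
  proof (intro prod.cong refl)
    fix j assume j: "j \<in> {..<N}"
    have "(\<Prod>i<j. Gamma (m i - m j + 1) / Gamma (m i - m j + \<theta>)) * (\<Prod>i<j. Gamma (m i - m j + \<theta>) / Gamma (m i - m j)) =
       (\<Prod>i<j. m i - m j)"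
      unfolding prod.distrib[symmetric]
    proof (intro prod.cong refl)
      fix i assume "i \<in> {..<j}"
      then have "m i - m j \<ge> \<theta>" unfolding m_def using spart_diff_ge[OF GT(2), of i j \<theta>] assms(3) j by simp
      then have d: "m i - m j > 0" using assms(3) by simp
      then have "Gamma (m i - m j + 1) = (m i - m j) * Gamma (m i - m j)"
        by (intro Gamma_plus1) (auto dest: nonpos_Ints_nonpos)
      moreover have "Gamma (m i - m j) > 0" "Gamma (m i - m j + \<theta>) > 0" using d assms(3) by (auto intro!: Gamma_real_pos)
      ultimately show "Gamma (m i - m j + 1) / Gamma (m i - m j + \<theta>) * (Gamma (m i - m j + \<theta>) / Gamma (m i - m j)) = m i - m j"
        by simp
    qed
    then show "(\<Prod>i\<le>j. Gamma (m i - m j + 1) / Gamma (m i - m j + \<theta>)) * (\<Prod>i<j. Gamma (m i - m j + \<theta>) / Gamma (m i - m j)) =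
      1 / Gamma \<theta> * (\<Prod>i<j. m i - m j)"
      unfolding lessThan_Suc_atMost[symmetric] by simp
  qed
  also have "\<dots> = (1 / Gamma \<theta>) ^ N * vdm N m"
    by (simp only: prod.distrib vdm_def prod_constant card_lessThan)
  finally have E: "(\<Prod>j<N. \<Prod>i\<le>j. Gamma (m i - m j + 1) / Gamma (m i - m j + \<theta>)) * at_ones \<theta> \<mu> = (1 / Gamma \<theta>) ^ N * vdm N m" .
  have "at_ones \<theta> lam > 0" using at_ones_pos[OF GT(1) assms(3)] .
  then have "branch \<theta> lam \<mu> = (\<Prod>k<Suc N. \<Prod>i<N. pair_weight \<theta> k i (l k - m i)) *
      ((\<Prod>j<N. \<Prod>i\<le>j. Gamma (m i - m j + 1) / Gamma (m i - m j + \<theta>)) * at_ones \<theta> \<mu>) * top_weight \<theta> (Suc N) l"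
    unfolding branch_def psi by simp
  then show ?thesis unfolding E by (simp only: l_def m_def mult_ac)
qed

section \<open>Branching intertwines the Pieri operators\<close>

text \<open>Adding a constant on the rows in \<open>I\<close> changes only differences between
  \<open>I\<close> and its complement. The quotient of two products over i < k thus becomes a
  product of the shape used in \<open>cut\<close>; the last hypothesis covers the pairs met in
  reversed order.\<close>

lemma prod_cut_pairs:
  fixes \<rho> \<sigma> :: "nat \<Rightarrow> nat \<Rightarrow> real"
  assumes "I \<subseteq> {..<N}"
    and "\<And>i k. i < k \<Longrightarrow> k < N \<Longrightarrow> i \<in> I \<longleftrightarrow> k \<in> I \<Longrightarrow> \<rho> i k = 1"
    and "\<And>i k. i < k \<Longrightarrow> k < N \<Longrightarrow> i \<in> I \<Longrightarrow> k \<notin> I \<Longrightarrow> \<rho> i k = \<sigma> i k"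
    and "\<And>i k. i < k \<Longrightarrow> k < N \<Longrightarrow> i \<notin> I \<Longrightarrow> k \<in> I \<Longrightarrow> \<rho> i k = \<sigma> k i"
  shows "(\<Prod>k<N. \<Prod>i<k. \<rho> i k) = (\<Prod>i\<in>I. \<Prod>k\<in>{..<N} - I. \<sigma> i k)"
  using assms
proof (induction N arbitrary: I)
  case (Suc N)
  let ?I = "I - {N}"
  have I: "?I \<subseteq> {..<N}" "finite ?I" using Suc.prems(1) by (auto intro: finite_subset)
  have "(\<Prod>k<N. \<Prod>i<k. \<rho> i k) = (\<Prod>i\<in>?I. \<Prod>k\<in>{..<N} - ?I. \<sigma> i k)"
    using Suc.prems by (intro Suc.IH) auto
  then have IH: "(\<Prod>k<Suc N. \<Prod>i<k. \<rho> i k) = (\<Prod>i\<in>?I. \<Prod>k\<in>{..<N} - ?I. \<sigma> i k) * (\<Prod>i<N. \<rho> i N)"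
    by simp
  have split: "(\<Prod>i<N. \<rho> i N) = (\<Prod>i\<in>?I. \<rho> i N) * (\<Prod>i\<in>{..<N} - ?I. \<rho> i N)"
    using prod_split[of "{..<N}" ?I "\<lambda>i. \<rho> i N"] I by simp
  show ?case
  proof (cases "N \<in> I")
    case True
    have 1: "(\<Prod>i\<in>?I. \<rho> i N) = 1" using Suc.prems True I by (intro prod.neutral) auto
    have 2: "(\<Prod>i\<in>{..<N} - ?I. \<rho> i N) = (\<Prod>k\<in>{..<N} - ?I. \<sigma> N k)"
      using Suc.prems(4) True by (intro prod.cong) auto
    have 3: "{..<Suc N} - I = {..<N} - ?I" "I = insert N ?I" using True by (auto simp: less_Suc_eq)
    have "(\<Prod>k<Suc N. \<Prod>i<k. \<rho> i k) = (\<Prod>k\<in>{..<N} - ?I. \<sigma> N k) * (\<Prod>i\<in>?I. \<Prod>k\<in>{..<N} - ?I. \<sigma> i k)"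
      unfolding IH split 1 2 by simp
    also have "\<dots> = (\<Prod>i\<in>insert N ?I. \<Prod>k\<in>{..<N} - ?I. \<sigma> i k)"
      using I(2) by (subst prod.insert) auto
    finally show ?thesis unfolding 3(1) using 3(2) by simp
  next
    case False
    have 1: "(\<Prod>i\<in>{..<N} - ?I. \<rho> i N) = 1" using Suc.prems False by (intro prod.neutral) auto
    have 2: "(\<Prod>i\<in>?I. \<rho> i N) = (\<Prod>i\<in>?I. \<sigma> i N)"
      using Suc.prems False I by (intro prod.cong) auto
    have 3: "{..<Suc N} - I = insert N ({..<N} - ?I)" "?I = I" using False by (auto simp: less_Suc_eq)
    have 4: "(\<Prod>k\<in>insert N ({..<N} - I). \<sigma> i k) = \<sigma> i N * (\<Prod>k\<in>{..<N} - I. \<sigma> i k)" for i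
      by (subst prod.insert) auto
    have "(\<Prod>k<Suc N. \<Prod>i<k. \<rho> i k) = (\<Prod>i\<in>?I. \<Prod>k\<in>{..<N} - ?I. \<sigma> i k) * (\<Prod>i\<in>?I. \<sigma> i N)"
      unfolding IH split 1 2 by simp
    also have "\<dots> = (\<Prod>i\<in>I. \<Prod>k\<in>{..<Suc N} - I. \<sigma> i k)"
      unfolding 3 4 prod.distrib by (simp only: mult.commute)
    finally show ?thesis .
  qed
qed simp

text \<open>The part of a pair weight that is common to the shifted and the unshifted case. What
  remains is d with the shift and d + 1 - \<theta> without it, and this is the origin of the value c
  = 1 - \<theta> in the rational identity.\<close>

definition pair_base :: "real \<Rightarrow> nat \<Rightarrow> nat \<Rightarrow> real \<Rightarrow> real" where
  "pair_base \<theta> k i d =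
     (if k \<le> i then Gamma d / Gamma (d + 2 - \<theta>) else - Gamma (\<theta> - d - 1) / Gamma (1 - d))"

lemma pair_weight_step:
  assumes "k \<le> i \<Longrightarrow> d \<notin> \<int>\<^sub>\<le>\<^sub>0" "k \<le> i \<Longrightarrow> \<not> b \<Longrightarrow> d + 1 - \<theta> > 0"
    and "i < k \<Longrightarrow> b \<Longrightarrow> d < 0" "i < k \<Longrightarrow> \<theta> - d - 1 \<notin> \<int>\<^sub>\<le>\<^sub>0"
  shows "pair_weight \<theta> k i (d + (if b then 1 else 0)) = pair_base \<theta> k i d * (if b then d else d + (1 - \<theta>))"
proof (cases "k \<le> i"; cases b)
  assume *: "k \<le> i" b
  have "Gamma (d + 1) = d * Gamma d" using assms(1)[OF *(1)] by (rule Gamma_plus1)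
  moreover have e: "d + 1 + 1 - \<theta> = d + 2 - \<theta>" by simp
  ultimately show ?thesis using * unfolding pair_weight_def pair_base_def by (simp only: e if_True) simp
next
  assume *: "k \<le> i" "\<not> b"
  have pos: "d + 1 - \<theta> > 0" using assms(2)[OF *] .
  then have "Gamma (d + 1 - \<theta> + 1) = (d + 1 - \<theta>) * Gamma (d + 1 - \<theta>)"
    by (intro Gamma_plus1) (auto dest: nonpos_Ints_nonpos)
  moreover have "d + 1 - \<theta> + 1 = d + 2 - \<theta>" by simp
  ultimately show ?thesis using * pos by (simp add: pair_weight_def pair_base_def add_diff_eq)
next
  assume *: "\<not> k \<le> i" b
  have neg: "- d > 0" using assms(3) * by simp
  then have "Gamma (- d + 1) = - d * Gamma (- d)"
    by (intro Gamma_plus1) (auto dest: nonpos_Ints_nonpos)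
  then have "Gamma (1 - d) = - d * Gamma (- d)" by simp
  moreover have e: "\<theta> - (d + 1) = \<theta> - d - 1" "1 - (d + 1) = - d" by simp_all
  ultimately show ?thesis using * neg unfolding pair_weight_def pair_base_def by (simp only: e if_True) simp
next
  assume *: "\<not> k \<le> i" "\<not> b"
  define u where "u = d + (1 - \<theta>)"
  have e: "\<theta> - d - 1 = - u" "\<theta> - d = - u + 1" by (simp_all add: u_def)
  have "Gamma (\<theta> - d) = - u * Gamma (\<theta> - d - 1)"
    using Gamma_plus1[of "- u"] assms(4) * unfolding e by simp
  then show ?thesis using * unfolding pair_weight_def pair_base_def u_def[symmetric] by simp
qed

lemma irrational_shift:
  assumes "\<theta> \<notin> \<rat>" "k \<noteq> (0::int)"
  shows "real_of_int a + \<theta> * real_of_int k \<notin> \<int>"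
proof
  assume "real_of_int a + \<theta> * real_of_int k \<in> \<int>"
  then have "(real_of_int a + \<theta> * real_of_int k - real_of_int a) / real_of_int k \<in> \<rat>"
    using Ints_subset_Rats by (intro Rats_divide Rats_diff) auto
  moreover have "(real_of_int a + \<theta> * real_of_int k - real_of_int a) / real_of_int k = \<theta>"
    using assms(2) by simp
  ultimately show False using assms(1) by simp
qed

lemma prods_if:
  assumes "finite A" "I \<subseteq> A"
  shows "(\<Prod>k\<in>A. \<Prod>i\<in>B. if k \<in> I then l k - n i else l k - n i + c) = prods 0 l n I B * prods c l n (A - I) B"
  unfolding prod_split[OF assms, symmetric] prods_def by (auto intro!: arg_cong2[of _ _ _ _ "(*)"] prod.cong)

lemma prods_if':
  assumes "finite B" "J \<subseteq> B"
  shows "(\<Prod>k\<in>A. \<Prod>i\<in>B. if i \<in> J then l k - n i else l k - n i + c) = prods 0 l n A J * prods c l n A (B - J)"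
  unfolding prod_split[OF assms, symmetric] prods_def prod.distrib[symmetric]
  by (auto intro!: arg_cong2[of _ _ _ _ "(*)"] prod.cong)

text \<open>
  For rational \<open>\<theta>\<close> the common factor \<open>const\<close> of all terms can be infinite while the terms are finite; this
  case is recovered by continuity in \<open>\<theta>\<close>.
\<close>

context
  fixes \<theta> :: real and lam \<nu> :: "int list" and N :: nat
  assumes \<theta>: "\<theta> > 0" "\<theta> \<notin> \<rat>" and lam: "lam \<in> GT (Suc N)" and \<nu>: "\<nu> \<in> GT N"
begin

private abbreviation "l \<equiv> spart \<theta> lam"
private abbreviation "n \<equiv> spart \<theta> \<nu>"
private abbreviation "const \<equiv> (1 / Gamma \<theta>) ^ N * vdm N n * top_weight \<theta> (Suc N) l *
  (\<Prod>k<Suc N. \<Prod>i<N. pair_base \<theta> k i (l k - n i))"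

private lemma lens: "length lam = Suc N" "length \<nu> = N"
  using lam \<nu> by (auto dest: GT_length)

private lemma ln: "l k - n i = real_of_int (lam ! k - \<nu> ! i) + \<theta> * real_of_int (int i - int k + 1)"
  using lens by (simp add: spart_def algebra_simps)

private lemma ln_irrational:
  "k \<le> i \<Longrightarrow> l k - n i \<notin> \<int>" "i < k \<Longrightarrow> \<theta> - (l k - n i) - 1 \<notin> \<int>"
proof -
  assume "k \<le> i"
  then show "l k - n i \<notin> \<int>" unfolding ln by (intro irrational_shift \<theta>) auto
next
  assume "i < k"
  then have "real_of_int (\<nu> ! i - lam ! k - 1) + \<theta> * real_of_int (int k - int i) \<notin> \<int>"
    by (intro irrational_shift \<theta>) auto
  then show "\<theta> - (l k - n i) - 1 \<notin> \<int>" unfolding ln by (simp add: algebra_simps)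
qed

text \<open>Raising the rows in \<open>I\<close> splits off \<open>prods\<close> from the pair
  weights, and the change of \<open>top_weight\<close> turns the Pieri coefficient with shift
  \<theta> into a \<open>cut\<close> with shift 1 - \<theta>. The rest does not depend on
  \<open>I\<close>.\<close>

lemma left_term:
  assumes I: "I \<subseteq> {..<Suc N}" and adm: "\<nu> \<prec>\<^sub>G\<^sub>T bump 1 I lam"
  shows "cut \<theta> l {..<Suc N} I * branch \<theta> (bump 1 I lam) \<nu> =
    const * (cut (1 - \<theta>) l {..<Suc N} I * prods 0 l n I {..<N} * prods (1 - \<theta>) l n ({..<Suc N} - I) {..<N})"
proof -
  let ?b = "bump 1 I lam"
  have b: "spart \<theta> ?b k = l k + (if k \<in> I then 1 else 0)" if "k < Suc N" for k
    using that lens by (simp add: spart_bump)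
  have bl: "?b ! k = lam ! k + (if k \<in> I then 1 else 0)" if "k < Suc N" for k
    using that lens by simp
  have bGT: "?b \<in> GT (Suc N)" using interlaces_GT[OF adm] lens by simp
  have *: "pair_weight \<theta> k i (spart \<theta> ?b k - n i) =
      pair_base \<theta> k i (l k - n i) * (if k \<in> I then l k - n i else l k - n i + (1 - \<theta>))"
    if ki: "k < Suc N" "i < N" for k i
  proof -
    have "pair_weight \<theta> k i (l k - n i + (if k \<in> I then 1 else 0)) =
      pair_base \<theta> k i (l k - n i) * (if k \<in> I then l k - n i else l k - n i + (1 - \<theta>))"
    proof (rule pair_weight_step)
      show "l k - n i \<notin> \<int>\<^sub>\<le>\<^sub>0" if "k \<le> i" using ln_irrational(1)[OF that] nonpos_Ints_Int by blast
      show "\<theta> - (l k - n i) - 1 \<notin> \<int>\<^sub>\<le>\<^sub>0" if "i < k" using ln_irrational(2)[OF that] nonpos_Ints_Int by blast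
      show "l k - n i + 1 - \<theta> > 0" if "k \<le> i" "k \<notin> I"
      proof -
        have "\<nu> ! i \<le> ?b ! k"
          using interlaces_nth(2)[OF adm, of i] GT_antimono[OF bGT, of k i] ki that lens by auto
        then have "real_of_int (lam ! k - \<nu> ! i) \<ge> 0" using bl[OF ki(1)] that(2) by simp
        moreover have "l k - n i + 1 - \<theta> = real_of_int (lam ! k - \<nu> ! i) + 1 + \<theta> * real (i - k)"
          using ln that(1) by (simp add: algebra_simps of_nat_diff)
        moreover have "\<theta> * real (i - k) \<ge> 0" using \<theta> by simp
        ultimately show ?thesis by linarith
      qed
      show "l k - n i < 0" if "i < k" "k \<in> I"
      proof -
        have "?b ! k \<le> \<nu> ! i"
          using interlaces_nth(1)[OF adm, of i] GT_antimono[OF bGT, of "Suc i" k] ki that lens by auto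
        then have "real_of_int (lam ! k - \<nu> ! i) \<le> -1" using bl[OF ki(1)] that(2) by simp
        moreover have "l k - n i = real_of_int (lam ! k - \<nu> ! i) - \<theta> * real (k - i - 1)"
          using ln that(1) by (simp add: algebra_simps of_nat_diff)
        moreover have "\<theta> * real (k - i - 1) \<ge> 0" using \<theta> by simp
        ultimately show ?thesis by linarith
      qed
    qed
    moreover have "spart \<theta> ?b k - n i = l k - n i + (if k \<in> I then 1 else 0)" using b[OF ki(1)] by simp
    ultimately show ?thesis by (simp only:)
  qed
  have W: "(\<Prod>k<Suc N. \<Prod>i<N. pair_weight \<theta> k i (spart \<theta> ?b k - n i)) =
     (\<Prod>k<Suc N. \<Prod>i<N. pair_base \<theta> k i (l k - n i)) *
       (prods 0 l n I {..<N} * prods (1 - \<theta>) l n ({..<Suc N} - I) {..<N})"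
  proof -
    have "(\<Prod>k<Suc N. \<Prod>i<N. pair_weight \<theta> k i (spart \<theta> ?b k - n i)) =
      (\<Prod>k<Suc N. \<Prod>i<N. pair_base \<theta> k i (l k - n i) * (if k \<in> I then l k - n i else l k - n i + (1 - \<theta>)))"
      using * by (intro prod.cong refl) auto
    then show ?thesis unfolding prod.distrib using prods_if[OF _ I, of l n "1 - \<theta>" "{..<N}"] by simp
  qed
  define c where "c d = Gamma (d + 1 - \<theta>) / Gamma (d + \<theta>)" for d
  have pos: "d \<ge> \<theta> \<Longrightarrow> c d > 0" for d using \<theta> by (auto simp: c_def intro!: divide_pos_pos Gamma_real_pos)
  have C: "cut \<theta> l {..<Suc N} I * top_weight \<theta> (Suc N) (spart \<theta> ?b) = cut (1 - \<theta>) l {..<Suc N} I * top_weight \<theta> (Suc N) l"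
  proof -
    define \<sigma> where "\<sigma> i k = (l i - l k + (1 - \<theta>)) / (l i - l k + \<theta>)" for i k
    define \<rho> where "\<rho> i k = c (spart \<theta> ?b i - spart \<theta> ?b k) / c (l i - l k)" for i k
    have up: "c (d + 1) / c d = (d + (1 - \<theta>)) / (d + \<theta>)" if "d \<ge> \<theta>" for d
    proof -
      have "Gamma (d + 1 - \<theta> + 1) = (d + 1 - \<theta>) * Gamma (d + 1 - \<theta>)" "Gamma (d + \<theta> + 1) = (d + \<theta>) * Gamma (d + \<theta>)"
        using that \<theta> by (intro Gamma_plus1; auto dest: nonpos_Ints_nonpos)+
      moreover have e: "d + 1 + 1 - \<theta> = d + 1 - \<theta> + 1" "d + 1 + \<theta> = d + \<theta> + 1" by simp_all
      moreover have "Gamma (d + 1 - \<theta>) > 0" "Gamma (d + \<theta>) > 0" using that \<theta> by (auto intro!: Gamma_real_pos)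
      ultimately have "c (d + 1) / c d = (d + 1 - \<theta>) / (d + \<theta>)" unfolding c_def e by simp
      then show ?thesis by (simp add: add_diff_eq)
    qed
    have "(\<Prod>k<Suc N. \<Prod>i<k. \<rho> i k) = (\<Prod>i\<in>I. \<Prod>k\<in>{..<Suc N} - I. \<sigma> i k)"
    proof (rule prod_cut_pairs[OF I])
      fix i k assume ik: "i < k" "k < Suc N"
      have d: "l i - l k \<ge> \<theta>" using spart_diff_ge[OF lam ik \<theta>(1)] .
      show "\<rho> i k = 1" if "i \<in> I \<longleftrightarrow> k \<in> I"
      proof -
        have "spart \<theta> ?b i - spart \<theta> ?b k = l i - l k" using that b[of i] b[of k] ik by auto
        then show ?thesis using pos[OF d] by (simp add: \<rho>_def)
      qed
      show "\<rho> i k = \<sigma> i k" if "i \<in> I" "k \<notin> I"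
      proof -
        have "spart \<theta> ?b i - spart \<theta> ?b k = l i - l k + 1" using that b[of i] b[of k] ik by auto
        then show ?thesis using up[OF d] by (simp add: \<rho>_def \<sigma>_def)
      qed
      show "\<rho> i k = \<sigma> k i" if "i \<notin> I" "k \<in> I"
      proof -
        have e: "spart \<theta> ?b i - spart \<theta> ?b k = l i - l k - 1" using that b[of i] b[of k] ik by auto
        have g: "l i - l k - 1 \<ge> \<theta>" using spart_diff_ge[OF bGT ik \<theta>(1)] e by simp
        have "\<rho> i k = inverse (c (l i - l k - 1 + 1) / c (l i - l k - 1))"
          unfolding \<rho>_def e by simp
        also have "\<dots> = (l i - l k - 1 + \<theta>) / (l i - l k - 1 + (1 - \<theta>))"
          unfolding up[OF g] by simp
        also have "\<dots> = (- (l k - l i + (1 - \<theta>))) / (- (l k - l i + \<theta>))"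
          by (intro arg_cong2[of _ _ _ _ "(/)"]) simp_all
        also have "\<dots> = \<sigma> k i" unfolding \<sigma>_def by (rule minus_divide_divide)
        finally show ?thesis .
      qed
    qed
    then have t1: "top_weight \<theta> (Suc N) (spart \<theta> ?b) = top_weight \<theta> (Suc N) l * (\<Prod>i\<in>I. \<Prod>k\<in>{..<Suc N} - I. \<sigma> i k)"
    proof -
      have "top_weight \<theta> (Suc N) (spart \<theta> ?b) = (\<Prod>k<Suc N. \<Prod>i<k. c (l i - l k) * \<rho> i k)"
        unfolding top_weight_def c_def[symmetric] \<rho>_def
      proof (intro prod.cong refl)
        fix k i assume "k \<in> {..<Suc N}" "i \<in> {..<k}"
        then have "c (l i - l k) \<noteq> 0" using pos[OF spart_diff_ge[OF lam _ _ \<theta>(1)], of i k] by simp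
        then show "c (spart \<theta> ?b i - spart \<theta> ?b k) = c (l i - l k) * (c (spart \<theta> ?b i - spart \<theta> ?b k) / c (l i - l k))"
          by simp
      qed
      also have "\<dots> = top_weight \<theta> (Suc N) l * (\<Prod>k<Suc N. \<Prod>i<k. \<rho> i k)"
        unfolding prod.distrib top_weight_def c_def[symmetric] ..
      finally show ?thesis using \<open>(\<Prod>k<Suc N. \<Prod>i<k. \<rho> i k) = _\<close> by (simp only:)
    qed
    have t2: "cut \<theta> l {..<Suc N} I * (\<Prod>i\<in>I. \<Prod>k\<in>{..<Suc N} - I. \<sigma> i k) = cut (1 - \<theta>) l {..<Suc N} I"
      unfolding cut_def prod.distrib[symmetric]
    proof (intro prod.cong refl)
      fix i k assume *: "i \<in> I" "k \<in> {..<Suc N} - I"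
      have "l i - l k + \<theta> \<noteq> 0"
      proof (cases "i < k")
        case True
        then show ?thesis using spart_diff_ge[OF lam, of i k \<theta>] * \<theta> by auto
      next
        case False
        then have "k < i" using * by (metis DiffD2 linorder_neqE_nat)
        then have "spart \<theta> ?b k - spart \<theta> ?b i \<ge> \<theta>" using * I \<theta> by (intro spart_diff_ge[OF bGT]) auto
        then show ?thesis using b[of i] b[of k] * I by auto
      qed
      then show "(l i - l k + \<theta>) / (l i - l k) * \<sigma> i k = (l i - l k + (1 - \<theta>)) / (l i - l k)"
        by (simp add: \<sigma>_def)
    qed
    show ?thesis unfolding t1 t2[symmetric] by (simp only: mult_ac)
  qed
  have "cut \<theta> l {..<Suc N} I * branch \<theta> ?b \<nu> = (1 / Gamma \<theta>) ^ N * vdm N n *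
      (\<Prod>k<Suc N. \<Prod>i<N. pair_weight \<theta> k i (spart \<theta> ?b k - n i)) * (cut \<theta> l {..<Suc N} I * top_weight \<theta> (Suc N) (spart \<theta> ?b))"
    unfolding branch_closed_form[OF adm lens(2) \<theta>(1)] by (simp only: mult_ac)
  then show ?thesis unfolding W C by (simp only: mult_ac)
qed

text \<open>Here \<nu> is fixed and reached from a lower signature, so the Pieri coefficient is
  taken at the lowered one. The change of the Vandermonde product moves it back to \<nu> and
  replaces the shift \<theta> by -(1 - \<theta>).\<close>

lemma right_term:
  assumes J: "J \<subseteq> {..<N}" and adm: "bump (-1) J \<nu> \<prec>\<^sub>G\<^sub>T lam"
  shows "cut \<theta> (spart \<theta> (bump (-1) J \<nu>)) {..<N} J * branch \<theta> lam (bump (-1) J \<nu>) =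
    const * (cut (- (1 - \<theta>)) n {..<N} J * prods 0 l n {..<Suc N} J * prods (1 - \<theta>) l n {..<Suc N} ({..<N} - J))"
proof -
  let ?b = "bump (-1) J \<nu>"
  let ?m = "spart \<theta> ?b"
  have b: "?m k = n k - (if k \<in> J then 1 else 0)" if "k < N" for k
    using that lens by (simp add: spart_bump)
  have bl: "?b ! k = \<nu> ! k - (if k \<in> J then 1 else 0)" if "k < N" for k
    using that lens by simp
  have bGT: "?b \<in> GT N" using interlaces_GT[OF adm] lens by simp
  have *: "pair_weight \<theta> k i (l k - ?m i) =
      pair_base \<theta> k i (l k - n i) * (if i \<in> J then l k - n i else l k - n i + (1 - \<theta>))"
    if ki: "k < Suc N" "i < N" for k i
  proof -
    have "pair_weight \<theta> k i (l k - n i + (if i \<in> J then 1 else 0)) =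
      pair_base \<theta> k i (l k - n i) * (if i \<in> J then l k - n i else l k - n i + (1 - \<theta>))"
    proof (rule pair_weight_step)
      show "l k - n i \<notin> \<int>\<^sub>\<le>\<^sub>0" if "k \<le> i" using ln_irrational(1)[OF that] nonpos_Ints_Int by blast
      show "\<theta> - (l k - n i) - 1 \<notin> \<int>\<^sub>\<le>\<^sub>0" if "i < k" using ln_irrational(2)[OF that] nonpos_Ints_Int by blast
      show "l k - n i + 1 - \<theta> > 0" if "k \<le> i" "i \<notin> J"
      proof -
        have "?b ! i \<le> lam ! k"
          using interlaces_nth(2)[OF adm, of i] GT_antimono[OF lam, of k i] ki that lens by auto
        then have "real_of_int (lam ! k - \<nu> ! i) \<ge> 0" using bl[OF ki(2)] that(2) by simp
        moreover have "l k - n i + 1 - \<theta> = real_of_int (lam ! k - \<nu> ! i) + 1 + \<theta> * real (i - k)"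
          using ln that(1) by (simp add: algebra_simps of_nat_diff)
        moreover have "\<theta> * real (i - k) \<ge> 0" using \<theta> by simp
        ultimately show ?thesis by linarith
      qed
      show "l k - n i < 0" if "i < k" "i \<in> J"
      proof -
        have "lam ! k \<le> ?b ! i"
          using interlaces_nth(1)[OF adm, of i] GT_antimono[OF lam, of "Suc i" k] ki that lens by auto
        then have "real_of_int (lam ! k - \<nu> ! i) \<le> -1" using bl[OF ki(2)] that(2) by simp
        moreover have "l k - n i = real_of_int (lam ! k - \<nu> ! i) - \<theta> * real (k - i - 1)"
          using ln that(1) by (simp add: algebra_simps of_nat_diff)
        moreover have "\<theta> * real (k - i - 1) \<ge> 0" using \<theta> by simp
        ultimately show ?thesis by linarith
      qed
    qed
    moreover have "l k - ?m i = l k - n i + (if i \<in> J then 1 else 0)" using b[OF ki(2)] by simp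
    ultimately show ?thesis by (simp only:)
  qed
  have W: "(\<Prod>k<Suc N. \<Prod>i<N. pair_weight \<theta> k i (l k - ?m i)) =
     (\<Prod>k<Suc N. \<Prod>i<N. pair_base \<theta> k i (l k - n i)) *
       (prods 0 l n {..<Suc N} J * prods (1 - \<theta>) l n {..<Suc N} ({..<N} - J))"
  proof -
    have "(\<Prod>k<Suc N. \<Prod>i<N. pair_weight \<theta> k i (l k - ?m i)) =
      (\<Prod>k<Suc N. \<Prod>i<N. pair_base \<theta> k i (l k - n i) * (if i \<in> J then l k - n i else l k - n i + (1 - \<theta>)))"
      using * by (intro prod.cong refl) auto
    then show ?thesis unfolding prod.distrib using prods_if'[OF _ J, of l n "1 - \<theta>" "{..<Suc N}"] by simp
  qed
  have V: "cut \<theta> ?m {..<N} J * vdm N ?m = cut (- (1 - \<theta>)) n {..<N} J * vdm N n"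
  proof -
    define \<sigma> where "\<sigma> i k = (n i - n k - 1) / (n i - n k)" for i k
    define \<rho> where "\<rho> i k = (?m i - ?m k) / (n i - n k)" for i k
    have t0: "(\<Prod>k<N. \<Prod>i<k. \<rho> i k) = (\<Prod>i\<in>J. \<Prod>k\<in>{..<N} - J. \<sigma> i k)"
    proof (rule prod_cut_pairs[OF J])
      fix i k assume ik: "i < k" "k < N"
      have d: "n i - n k > 0" using spart_diff_ge[OF \<nu> ik \<theta>(1)] \<theta>(1) by simp
      show "\<rho> i k = 1" if "i \<in> J \<longleftrightarrow> k \<in> J" using d that b[of i] b[of k] ik by (auto simp: \<rho>_def)
      show "\<rho> i k = \<sigma> i k" if "i \<in> J" "k \<notin> J" using that b[of i] b[of k] ik by (auto simp: \<rho>_def \<sigma>_def)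
      show "\<rho> i k = \<sigma> k i" if "i \<notin> J" "k \<in> J" using d that b[of i] b[of k] ik
        by (simp add: \<rho>_def \<sigma>_def divide_simps) (simp add: algebra_simps)
    qed
    have t1: "vdm N ?m = vdm N n * (\<Prod>i\<in>J. \<Prod>k\<in>{..<N} - J. \<sigma> i k)"
      unfolding t0[symmetric] vdm_def prod.distrib[symmetric] \<rho>_def
    proof (intro prod.cong refl)
      fix k i assume "k \<in> {..<N}" "i \<in> {..<k}"
      then have "n i - n k \<noteq> 0" using spart_diff_ge[OF \<nu> _ _ \<theta>(1), of i k] \<theta>(1) by simp
      then show "?m i - ?m k = (n i - n k) * ((?m i - ?m k) / (n i - n k))" by simp
    qed
    have t2: "cut \<theta> ?m {..<N} J * (\<Prod>i\<in>J. \<Prod>k\<in>{..<N} - J. \<sigma> i k) = cut (- (1 - \<theta>)) n {..<N} J"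
      unfolding cut_def prod.distrib[symmetric]
    proof (intro prod.cong refl)
      fix i k assume *: "i \<in> J" "k \<in> {..<N} - J"
      have e: "?m i - ?m k = n i - n k - 1" using b[of i] b[of k] * J by auto
      have "?m i \<noteq> ?m k" using inj_onD[OF inj_spart[OF bGT \<theta>(1)], of i k] * J by auto
      then show "(?m i - ?m k + \<theta>) / (?m i - ?m k) * \<sigma> i k = (n i - n k + - (1 - \<theta>)) / (n i - n k)"
        unfolding e \<sigma>_def using e by simp
    qed
    show ?thesis unfolding t1 t2[symmetric] by (simp only: mult_ac)
  qed
  have "cut \<theta> ?m {..<N} J * branch \<theta> lam ?b = (1 / Gamma \<theta>) ^ N * (cut \<theta> ?m {..<N} J * vdm N ?m) *
      (\<Prod>k<Suc N. \<Prod>i<N. pair_weight \<theta> k i (l k - ?m i)) * top_weight \<theta> (Suc N) l"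
    using branch_closed_form[OF adm _ \<theta>(1), of N] lens by (simp only: length_bump mult_ac)
  then show ?thesis unfolding W V by (simp only: mult_ac)
qed

lemma intertwine_irrational:
  "(\<Sum>I | I \<subseteq> {..<Suc N} \<and> \<nu> \<prec>\<^sub>G\<^sub>T bump 1 I lam. t ^ card I * (cut \<theta> l {..<Suc N} I * branch \<theta> (bump 1 I lam) \<nu>))
   = (1 + t) * (\<Sum>J | J \<subseteq> {..<N} \<and> bump (-1) J \<nu> \<prec>\<^sub>G\<^sub>T lam.
       t ^ card J * (cut \<theta> (spart \<theta> (bump (-1) J \<nu>)) {..<N} J * branch \<theta> lam (bump (-1) J \<nu>)))"
  (is "?L = _ * ?R")
\<comment> \<open>Both kinds of interlacing imply this condition, so both sums are empty where it
  fails. Where it holds, every inadmissible subset has a vanishing term, and the sums extend to all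
  subsets.\<close>
proof (cases "\<forall>i<N. lam ! Suc i \<le> \<nu> ! i \<and> \<nu> ! i \<le> lam ! i + 1")
  case False
  have "\<not> \<nu> \<prec>\<^sub>G\<^sub>T bump 1 I lam" for I
  proof
    assume adm: "\<nu> \<prec>\<^sub>G\<^sub>T bump 1 I lam"
    have "lam ! Suc i \<le> \<nu> ! i \<and> \<nu> ! i \<le> lam ! i + 1" if "i < N" for i
      using interlaces_nth[OF adm, of i] that lens by (auto split: if_splits)
    then show False using False by blast
  qed
  moreover have "\<not> bump (-1) J \<nu> \<prec>\<^sub>G\<^sub>T lam" for J
  proof
    assume adm: "bump (-1) J \<nu> \<prec>\<^sub>G\<^sub>T lam"
    have "lam ! Suc i \<le> \<nu> ! i \<and> \<nu> ! i \<le> lam ! i + 1" if "i < N" for i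
      using interlaces_nth[OF adm, of i] that lens by (auto split: if_splits)
    then show False using False by blast
  qed
  ultimately show ?thesis by simp
next
  case True
  let ?g = "\<lambda>I. t ^ card I * (const * (cut (1 - \<theta>) l {..<Suc N} I * prods 0 l n I {..<N} *
      prods (1 - \<theta>) l n ({..<Suc N} - I) {..<N}))"
  let ?h = "\<lambda>J. t ^ card J * (const * (cut (- (1 - \<theta>)) n {..<N} J * prods 0 l n {..<Suc N} J *
      prods (1 - \<theta>) l n {..<Suc N} ({..<N} - J)))"
  have "?L = (\<Sum>I\<in>Pow {..<Suc N}. ?g I)"
  proof (rule sum.mono_neutral_cong_left)
    show "\<forall>I\<in>Pow {..<Suc N} - {I. I \<subseteq> {..<Suc N} \<and> \<nu> \<prec>\<^sub>G\<^sub>T bump 1 I lam}.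
       ?g I = 0"
    proof
      fix I assume "I \<in> Pow {..<Suc N} - {I. I \<subseteq> {..<Suc N} \<and> \<nu> \<prec>\<^sub>G\<^sub>T bump 1 I lam}"
      then have I: "I \<subseteq> {..<Suc N}" "finite I" "\<not> \<nu> \<prec>\<^sub>G\<^sub>T bump 1 I lam" by (auto intro: finite_subset)
      then obtain i where i: "i < N" "\<not> (bump 1 I lam ! Suc i \<le> \<nu> ! i \<and> \<nu> ! i \<le> bump 1 I lam ! i)"
        using lens by (auto simp: interlaces_def simp del: nth_bump)
      \<comment> \<open>Within the bounds of this case interlacing can fail only at an equality. The
        first alternative produces the zero factor l (Suc i) - n i, the second the zero factor l i -
        n i + (1 - \<theta>).\<close>
      then have "Suc i \<in> I \<and> \<nu> ! i = lam ! Suc i \<or> i \<notin> I \<and> \<nu> ! i = lam ! i + 1"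
        using True lens by (auto split: if_splits)
      then show "?g I = 0"
      proof
        assume *: "Suc i \<in> I \<and> \<nu> ! i = lam ! Suc i"
        then have "l (Suc i) - n i + 0 = 0" by (simp add: ln)
        then have "prods 0 l n I {..<N} = 0"
          unfolding prods_def using * i(1) I(2) by (intro prod_zero bexI[of _ "Suc i"] bexI[of _ i]) auto
        then show ?thesis by simp
      next
        assume *: "i \<notin> I \<and> \<nu> ! i = lam ! i + 1"
        then have "l i - n i + (1 - \<theta>) = 0" by (simp add: ln)
        then have "prods (1 - \<theta>) l n ({..<Suc N} - I) {..<N} = 0"
          unfolding prods_def using * i(1) by (intro prod_zero bexI[of _ i]) auto
        then show ?thesis by simp
      qed
    qed
  qed (auto simp: left_term)
  also have "\<dots> = const * left_sum (1 - \<theta>) t l n {..<Suc N} {..<N}"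
    unfolding left_sum_def sum_distrib_left by (intro sum.cong refl) (simp only: mult_ac)
  \<comment> \<open>The two index sets differ in size by one, hence the single factor 1 + t.\<close>
  also have "\<dots> = (1 + t) * (const * right_sum (1 - \<theta>) t l n {..<Suc N} {..<N})"
    using left_sum_eq_right_sum[of "{..<Suc N}" "{..<N}" l n "1 - \<theta>" t] inj_spart[OF lam \<theta>(1)] inj_spart[OF \<nu> \<theta>(1)]
    by simp
  also have "const * right_sum (1 - \<theta>) t l n {..<Suc N} {..<N} =
    (\<Sum>J\<in>Pow {..<N}. ?h J)"
    unfolding right_sum_def sum_distrib_left by (intro sum.cong refl) (simp only: mult_ac)
  also have "\<dots> = ?R"
  proof (rule sum.mono_neutral_cong_right)
    show "\<forall>J\<in>Pow {..<N} - {J. J \<subseteq> {..<N} \<and> bump (-1) J \<nu> \<prec>\<^sub>G\<^sub>T lam}.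
       ?h J = 0"
    proof
      fix J assume "J \<in> Pow {..<N} - {J. J \<subseteq> {..<N} \<and> bump (-1) J \<nu> \<prec>\<^sub>G\<^sub>T lam}"
      then have J: "J \<subseteq> {..<N}" "finite J" "\<not> bump (-1) J \<nu> \<prec>\<^sub>G\<^sub>T lam" by (auto intro: finite_subset)
      then obtain i where i: "i < N" "\<not> (lam ! Suc i \<le> bump (-1) J \<nu> ! i \<and> bump (-1) J \<nu> ! i \<le> lam ! i)"
        using lens by (auto simp: interlaces_def simp del: nth_bump)
      then have "i \<in> J \<and> \<nu> ! i = lam ! Suc i \<or> i \<notin> J \<and> \<nu> ! i = lam ! i + 1"
        using True lens by (auto split: if_splits)
      then show "?h J = 0"
      proof
        assume *: "i \<in> J \<and> \<nu> ! i = lam ! Suc i"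
        then have "l (Suc i) - n i + 0 = 0" by (simp add: ln)
        then have "prods 0 l n {..<Suc N} J = 0"
          unfolding prods_def using * i(1) J(2) by (intro prod_zero bexI[of _ "Suc i"] bexI[of _ i]) auto
        then show ?thesis by simp
      next
        assume *: "i \<notin> J \<and> \<nu> ! i = lam ! i + 1"
        then have "l i - n i + (1 - \<theta>) = 0" by (simp add: ln)
        then have "prods (1 - \<theta>) l n {..<Suc N} ({..<N} - J) = 0"
          unfolding prods_def using * i(1) by (intro prod_zero bexI[of _ i]) auto
        then show ?thesis by simp
      qed
    qed
  qed (auto simp: right_term)
  finally show ?thesis .
qed

end

section \<open>Passage from irrational to arbitrary positive \<theta>\<close>

lemma continuous_cut:
  assumes "lam \<in> GT N" "I \<subseteq> {..<N}"
  shows "continuous_on {0<..} (\<lambda>\<theta>. cut \<theta> (spart \<theta> lam) {..<N} I)"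
  unfolding cut_def
proof (intro continuous_on_prod continuous_on_divide)
  fix i k assume "i \<in> I" "k \<in> {..<N} - I"
  then have "spart \<theta> lam i \<noteq> spart \<theta> lam k" if "\<theta> > 0" for \<theta>
    using inj_onD[OF inj_spart[OF assms(1) that], of i k] assms(2) by auto
  then show "\<forall>\<theta>\<in>{0<..}. spart \<theta> lam i - spart \<theta> lam k \<noteq> 0" by auto
qed (auto simp: spart_def intro!: continuous_intros)

lemma continuous_Gamma:
  fixes f :: "real \<Rightarrow> real"
  assumes "continuous_on S f" "\<And>x. x \<in> S \<Longrightarrow> f x > 0"
  shows "continuous_on S (\<lambda>x. Gamma (f x))"
proof (rule continuous_on_compose2[OF _ assms(1)])
  show "continuous_on {0<..} (Gamma :: real \<Rightarrow> real)"
    by (intro continuous_on_Gamma) (auto dest: nonpos_Ints_nonpos)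
qed (use assms(2) in auto)

lemma continuous_at_ones:
  assumes "lam \<in> GT N"
  shows "continuous_on {0<..} (\<lambda>\<theta>. at_ones \<theta> lam)"
  unfolding at_ones_def GT_length[OF assms]
proof (intro continuous_on_prod continuous_on_divide continuous_Gamma)
  fix k i assume ki: "k \<in> {..<N}" "i \<in> {..<k}"
  have d: "spart \<theta> lam i - spart \<theta> lam k \<ge> \<theta>" if "\<theta> > 0" for \<theta>
    using spart_diff_ge[OF assms, of i k \<theta>] ki that by simp
  show "spart \<theta> lam i - spart \<theta> lam k + \<theta> > 0" "spart \<theta> lam i - spart \<theta> lam k > 0"
    if "\<theta> \<in> {0<..}" for \<theta>
    using d[of \<theta>] that by auto
  have "Gamma (spart \<theta> lam i - spart \<theta> lam k) > 0" if "\<theta> > 0" for \<theta>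
    using d[OF that] that by (intro Gamma_real_pos) linarith
  then show "\<forall>\<theta>\<in>{0<..}. Gamma (spart \<theta> lam i - spart \<theta> lam k) \<noteq> 0" by force
qed (auto simp: spart_def intro!: continuous_intros)

lemma continuous_jack_psi:
  assumes "\<mu> \<prec>\<^sub>G\<^sub>T lam"
  shows "continuous_on {0<..} (\<lambda>\<theta>. jack_psi \<theta> lam \<mu>)"
  unfolding jack_psi_def Let_def
proof (intro continuous_on_prod continuous_on_mult continuous_on_divide continuous_on_pochhammer')
  define N where "N = length \<mu>"
  have GT: "lam \<in> GT (Suc N)" "\<mu> \<in> GT N" using interlaces_GT[OF assms] by (auto simp: N_def)
  fix j i assume ji: "j \<in> {..<length \<mu>}" "i \<in> {..j}"
  have a: "real_of_int (\<mu> ! i - \<mu> ! j) \<ge> 0" using GT_antimono[OF GT(2), of i j] ji by (simp add: N_def)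
  have b: "real_of_int (lam ! i - \<mu> ! j) \<ge> 0"
    using interlaces_nth(2)[OF assms, of j] GT_antimono[OF GT(1), of i j] ji by (simp add: N_def)
  have c: "\<theta> * (real j - real i) \<ge> 0" if "\<theta> > 0" for \<theta> using that ji by simp
  show "\<forall>\<theta>\<in>{0<..}. pochhammer (real_of_int (\<mu> ! i - \<mu> ! j) + \<theta> * (real j - real i) + 1) (nat (\<mu> ! j - lam ! Suc j)) \<noteq> 0"
  proof
    fix \<theta> :: real assume "\<theta> \<in> {0<..}"
    then have "pochhammer (real_of_int (\<mu> ! i - \<mu> ! j) + \<theta> * (real j - real i) + 1) (nat (\<mu> ! j - lam ! Suc j)) > 0"
      using a c[of \<theta>] by (intro pochhammer_pos) auto
    then show "pochhammer (real_of_int (\<mu> ! i - \<mu> ! j) + \<theta> * (real j - real i) + 1) (nat (\<mu> ! j - lam ! Suc j)) \<noteq> 0"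
      by simp
  qed
  show "\<forall>\<theta>\<in>{0<..}. pochhammer (real_of_int (lam ! i - \<mu> ! j) + \<theta> * (real j - real i) + \<theta>) (nat (\<mu> ! j - lam ! Suc j)) \<noteq> 0"
  proof
    fix \<theta> :: real assume "\<theta> \<in> {0<..}"
    then have "pochhammer (real_of_int (lam ! i - \<mu> ! j) + \<theta> * (real j - real i) + \<theta>) (nat (\<mu> ! j - lam ! Suc j)) > 0"
      using b c[of \<theta>] by (intro pochhammer_pos) auto
    then show "pochhammer (real_of_int (lam ! i - \<mu> ! j) + \<theta> * (real j - real i) + \<theta>) (nat (\<mu> ! j - lam ! Suc j)) \<noteq> 0"
      by simp
  qed
qed (intro continuous_intros)+

lemma continuous_branch:
  assumes "\<mu> \<prec>\<^sub>G\<^sub>T lam"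
  shows "continuous_on {0<..} (\<lambda>\<theta>. branch \<theta> lam \<mu>)"
  unfolding branch_def
  using interlaces_GT[OF assms refl]
  by (intro continuous_on_divide continuous_on_mult continuous_jack_psi[OF assms] continuous_at_ones)
     (auto dest!: at_ones_pos)

lemma continuous_zero_irrational:
  fixes f :: "real \<Rightarrow> real"
  assumes "continuous_on {0<..} f" "\<And>\<theta>. \<theta> > 0 \<Longrightarrow> \<theta> \<notin> \<rat> \<Longrightarrow> f \<theta> = 0" "\<theta> > 0"
  shows "f \<theta> = 0"
proof (rule ccontr)
  assume "f \<theta> \<noteq> 0"
  define S where "S = {0<..} \<inter> f -` (- {0})"
  have "open S"
    using assms(1) unfolding S_def by (intro continuous_open_preimage) auto
  moreover have "\<theta> \<in> S" using assms(3) \<open>f \<theta> \<noteq> 0\<close> by (simp add: S_def)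
  ultimately obtain \<theta>' where "\<theta>' \<in> S" "\<theta>' \<notin> \<rat>"
    using open_minus_countable[OF countable_rat, of S] by blast
  then show False using assms(2) by (auto simp: S_def)
qed

lemma intertwine:
  assumes "\<theta> > 0" "lam \<in> GT (Suc N)" "\<nu> \<in> GT N"
  shows "(\<Sum>I | I \<subseteq> {..<Suc N} \<and> \<nu> \<prec>\<^sub>G\<^sub>T bump 1 I lam.
       t ^ card I * (cut \<theta> (spart \<theta> lam) {..<Suc N} I * branch \<theta> (bump 1 I lam) \<nu>))
   = (1 + t) * (\<Sum>J | J \<subseteq> {..<N} \<and> bump (-1) J \<nu> \<prec>\<^sub>G\<^sub>T lam.
       t ^ card J * (cut \<theta> (spart \<theta> (bump (-1) J \<nu>)) {..<N} J * branch \<theta> lam (bump (-1) J \<nu>)))"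
    (is "?L \<theta> = _ * ?R \<theta>")
proof -
  have "continuous_on {0<..} (\<lambda>\<theta>. ?L \<theta> - (1 + t) * ?R \<theta>)"
    using assms(2,3)
    by (intro continuous_on_diff continuous_on_sum continuous_on_mult continuous_on_const continuous_branch continuous_cut)
       (auto intro!: interlaces_GT(2) simp: GT_length[OF assms(3)])
  then have "?L \<theta> - (1 + t) * ?R \<theta> = 0"
  proof (rule continuous_zero_irrational[where f = "\<lambda>\<theta>. ?L \<theta> - (1 + t) * ?R \<theta>", OF _ _ assms(1)])
    show "?L \<theta> - (1 + t) * ?R \<theta> = 0" if "\<theta> > 0" "\<theta> \<notin> \<rat>" for \<theta>
      using intertwine_irrational[OF that assms(2,3), of t] by simp
  qed
  then show ?thesis by simp
qed

section \<open>The Pieri rule\<close>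

definition njack :: "real \<Rightarrow> int list \<Rightarrow> real list \<Rightarrow> real" where
  "njack \<theta> lam x = jack_plus (length lam) \<theta> lam x / at_ones \<theta> lam"

lemma GT_plus_iff: "lam \<in> GT_plus N \<longleftrightarrow> lam \<in> GT N \<and> (\<forall>i<N. 0 \<le> lam ! i)"
  by (auto simp: GT_plus_def all_set_conv_all_nth GT_length)

text \<open>Monotonicity breaks only if, of two equal neighbouring parts, just the lower one is
  raised. Their shifted parts differ by exactly \<theta>, so a numerator of \<open>cut\<close> is
  zero. Pieri sums over all subsets are therefore sums over signatures.\<close>

lemma cut_bump_not_GT:
  assumes "lam \<in> GT N" "I \<subseteq> {..<N}" "bump 1 I lam \<notin> GT N"
  shows "cut \<theta> (spart \<theta> lam) {..<N} I = 0"
proof -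
  have len: "length lam = N" using assms(1) by (rule GT_length)
  obtain i where i: "Suc i < N" "\<not> bump 1 I lam ! Suc i \<le> bump 1 I lam ! i"
    using assms(3) len by (auto simp: GT_iff)
  moreover have "lam ! Suc i \<le> lam ! i" using assms(1) i(1) by (simp add: GT_iff)
  ultimately have *: "Suc i \<in> I" "i \<notin> I" "lam ! Suc i = lam ! i"
    using len by (auto split: if_splits)
  have "spart \<theta> lam (Suc i) - spart \<theta> lam i + \<theta> = 0"
    unfolding spart_diff *(3) by (simp add: algebra_simps)
  then show ?thesis
    unfolding cut_def using * i(1) finite_subset[OF assms(2)]
    by (intro prod_zero bexI[of _ "Suc i"] bexI[of _ i]) auto
qed

lemma bump_GT_plus: "lam \<in> GT_plus N \<Longrightarrow> bump 1 I lam \<in> GT N \<Longrightarrow> bump 1 I lam \<in> GT_plus N"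
  by (auto simp: GT_plus_iff GT_length)

lemma finite_bounded_GT: "finite {\<mu> \<in> GT_plus N. \<forall>i<N. \<mu> ! i \<le> b}"
proof (rule finite_subset)
  show "{\<mu> \<in> GT_plus N. \<forall>i<N. \<mu> ! i \<le> b} \<subseteq> {xs. set xs \<subseteq> {0..b} \<and> length xs = N}"
    by (auto simp: GT_plus_iff GT_length in_set_conv_nth)
qed (simp add: finite_lists_length_eq)

lemma interlaces_bounded:
  assumes "\<mu> \<prec>\<^sub>G\<^sub>T lam" "length \<mu> = N" "i < N"
  shows "\<mu> ! i \<le> lam ! 0"
  using interlaces_nth(2)[OF assms(1), of i] GT_antimono[OF interlaces_GT(1)[OF assms(1,2)], of 0 i] assms
  by simp

lemma interlaces_sum_le:
  assumes "\<mu> \<prec>\<^sub>G\<^sub>T lam" "lam \<in> GT_plus (Suc N)" "length \<mu> = N"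
  shows "sum_list \<mu> \<le> sum_list lam"
proof -
  have len: "length lam = Suc N" using assms(2) by (simp add: GT_plus_iff GT_length)
  have "sum_list \<mu> = (\<Sum>i<N. \<mu> ! i)" using assms(3) by (simp add: sum_list_sum_nth atLeast0LessThan)
  also have "\<dots> \<le> (\<Sum>i<N. lam ! i)" using interlaces_nth(2)[OF assms(1)] assms(3) by (intro sum_mono) auto
  also have "\<dots> \<le> (\<Sum>i<N. lam ! i) + lam ! N" using assms(2) by (simp add: GT_plus_iff)
  also have "\<dots> = sum_list lam" using len by (simp add: sum_list_sum_nth atLeast0LessThan)
  finally show ?thesis .
qed

lemma njack_rec:
  assumes "lam \<in> GT_plus (Suc (Suc n))" "\<theta> > 0" and X: "x ! Suc n > 0"
  shows "njack \<theta> lam x = (\<Sum>\<mu> | \<mu> \<in> GT_plus (Suc n) \<and> \<mu> \<prec>\<^sub>G\<^sub>T lam.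
     branch \<theta> lam \<mu> * (x ! Suc n) powi (sum_list lam - sum_list \<mu>) * njack \<theta> \<mu> x)"
proof -
  have len: "length lam = Suc (Suc n)" using assms(1) by (simp add: GT_plus_iff GT_length)
  show ?thesis
    unfolding njack_def[of \<theta> lam] len jack_plus.simps sum_divide_distrib
  proof (rule sum.cong)
    fix \<mu> assume "\<mu> \<in> {\<mu> \<in> GT_plus (Suc n). \<mu> \<prec>\<^sub>G\<^sub>T lam}"
    then have \<mu>: "\<mu> \<in> GT (Suc n)" "\<mu> \<prec>\<^sub>G\<^sub>T lam" "length \<mu> = Suc n" by (auto simp: GT_plus_iff GT_length)
    have "(x ! Suc n) powi (sum_list lam - sum_list \<mu>) = (x ! Suc n) ^ nat (sum_list lam - sum_list \<mu>)"
      using interlaces_sum_le[OF \<mu>(2) assms(1) \<mu>(3)] by (simp add: power_int_def)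
    moreover have "at_ones \<theta> \<mu> > 0" using at_ones_pos[OF \<mu>(1) assms(2)] .
    ultimately show "jack_psi \<theta> lam \<mu> * (x ! Suc n) ^ nat (sum_list lam - sum_list \<mu>) * jack_plus (Suc n) \<theta> \<mu> x / at_ones \<theta> lam =
      branch \<theta> lam \<mu> * (x ! Suc n) powi (sum_list lam - sum_list \<mu>) * njack \<theta> \<mu> x"
      by (simp add: branch_def njack_def \<mu>(3))
  qed simp
qed

theorem pieri:
  assumes "lam \<in> GT_plus (Suc n)" "\<theta> > 0" "\<And>i. i < Suc n \<Longrightarrow> x ! i > 0"
  shows "(\<Sum>I\<in>Pow {..<Suc n}. t ^ card I * cut \<theta> (spart \<theta> lam) {..<Suc n} I * njack \<theta> (bump 1 I lam) x)
     = (\<Prod>i<Suc n. 1 + t * x ! i) * njack \<theta> lam x"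
  using assms
proof (induction n arbitrary: lam)
  case 0
  then have len: "length lam = Suc 0" "lam ! 0 \<ge> 0" by (auto simp: GT_plus_iff GT_length)
  then have l: "lam = [lam ! 0]" by (metis length_0_conv length_Suc_conv nth_Cons_0)
  have one: "at_ones \<theta> \<mu> = 1" if "length \<mu> = Suc 0" for \<mu> using that by (simp add: at_ones_def)
  have P: "Pow {..<Suc 0} = {{}, {0}}" by auto
  have "nat (lam ! 0 + 1) = Suc (nat (lam ! 0))" using len(2) by simp
  then show ?case
    unfolding P using len by (simp add: njack_def one cut_def algebra_simps)
next
  case (Suc n)
  let ?A = "{..<Suc (Suc n)}" and ?B = "{..<Suc n}" and ?X = "x ! Suc n"
  have X: "?X > 0" using Suc.prems(3) by simp
  have lam: "lam \<in> GT (Suc (Suc n))" and len: "length lam = Suc (Suc n)" and nonneg: "\<And>i. i < Suc (Suc n) \<Longrightarrow> 0 \<le> lam ! i"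
    using Suc.prems(1) by (auto simp: GT_plus_iff GT_length)
  define U where "U = {\<nu> \<in> GT_plus (Suc n). \<forall>i<Suc n. \<nu> ! i \<le> lam ! 0 + 1}"
  define M where "M = {\<mu> \<in> GT_plus (Suc n). \<mu> \<prec>\<^sub>G\<^sub>T lam}"
  \<comment> \<open>\<open>d \<nu>\<close> may be negative on \<open>U\<close>, whose members need
    not interlace with \<open>lam\<close>. Integer powers of the positive last variable keep the
    exponents uniform.\<close>
  define d where "d \<nu> = sum_list lam - sum_list \<nu>" for \<nu>
  have finU: "finite U" unfolding U_def by (rule finite_bounded_GT)
  have lenU: "length \<nu> = Suc n" if "\<nu> \<in> U" for \<nu> using that by (simp add: U_def GT_plus_iff GT_length)
  have lenM: "length \<mu> = Suc n" if "\<mu> \<in> M" for \<mu> using that by (simp add: M_def GT_plus_iff GT_length)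
  have MU: "M \<subseteq> U"
  proof
    fix \<mu> assume \<mu>: "\<mu> \<in> M"
    have "\<mu> ! i \<le> lam ! 0 + 1" if "i < Suc n" for i
      using interlaces_bounded[of \<mu> lam "Suc n" i] lenM[OF \<mu>] \<mu> that by (simp add: M_def)
    then show "\<mu> \<in> U" using \<mu> by (simp add: M_def U_def)
  qed
  then have finM: "finite M" using finU by (rule finite_subset)
  have pw: "?X powi (z + int k) = ?X powi z * ?X ^ k" for z k
    using X by (simp add: power_int_add)
  have left: "t ^ card I * cut \<theta> (spart \<theta> lam) ?A I * njack \<theta> (bump 1 I lam) x =
     (\<Sum>\<nu>\<in>U. ?X powi d \<nu> * njack \<theta> \<nu> x * (if \<nu> \<prec>\<^sub>G\<^sub>T bump 1 I lam then
        (t * ?X) ^ card I * (cut \<theta> (spart \<theta> lam) ?A I * branch \<theta> (bump 1 I lam) \<nu>) else 0))"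
    if I: "I \<in> Pow ?A" for I
  proof (cases "bump 1 I lam \<in> GT (Suc (Suc n))")
    case False
    then have "cut \<theta> (spart \<theta> lam) ?A I = 0" using cut_bump_not_GT[OF lam _ False] I by simp
    then show ?thesis by (simp cong: if_cong)
  next
    case True
    then have b: "bump 1 I lam \<in> GT_plus (Suc (Suc n))" using bump_GT_plus[OF Suc.prems(1)] by simp
    \<comment> \<open>The exponent of the last variable grows by card I, so t^card I becomes (t *
      ?X)^card I. The intertwining relation is therefore used at t * ?X, and its factor 1 + t * ?X
      is the one belonging to the new variable.\<close>
    have sum: "sum_list (bump 1 I lam) - sum_list \<nu> = d \<nu> + int (card I)" for \<nu>
      using sum_list_bump[of I lam 1] I len by (simp add: d_def)
    have sub: "{\<mu>. \<mu> \<in> GT_plus (Suc n) \<and> \<mu> \<prec>\<^sub>G\<^sub>T bump 1 I lam} = {\<nu> \<in> U. \<nu> \<prec>\<^sub>G\<^sub>T bump 1 I lam}"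
    proof (intro equalityI subsetI)
      fix \<mu> assume \<mu>: "\<mu> \<in> {\<mu>. \<mu> \<in> GT_plus (Suc n) \<and> \<mu> \<prec>\<^sub>G\<^sub>T bump 1 I lam}"
      then have "length \<mu> = Suc n" by (simp add: GT_plus_iff GT_length)
      then have "\<mu> ! i \<le> lam ! 0 + 1" if "i < Suc n" for i
        using interlaces_bounded[of \<mu> "bump 1 I lam" "Suc n" i] \<mu> that len by (auto split: if_splits)
      then show "\<mu> \<in> {\<nu> \<in> U. \<nu> \<prec>\<^sub>G\<^sub>T bump 1 I lam}" using \<mu> by (simp add: U_def)
    qed (simp add: U_def)
    show ?thesis
      unfolding njack_rec[where x = x, OF b Suc.prems(2) X] sub sum pw sum_distrib_left sum.inter_filter[OF finU]
      by (intro sum.cong refl) (simp add: power_mult_distrib mult_ac)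
  qed
  have inner: "(\<Sum>I\<in>Pow ?A. if \<nu> \<prec>\<^sub>G\<^sub>T bump 1 I lam then
        (t * ?X) ^ card I * (cut \<theta> (spart \<theta> lam) ?A I * branch \<theta> (bump 1 I lam) \<nu>) else 0) =
     (1 + t * ?X) * (\<Sum>J\<in>Pow ?B. if bump (-1) J \<nu> \<prec>\<^sub>G\<^sub>T lam then
       (t * ?X) ^ card J * (cut \<theta> (spart \<theta> (bump (-1) J \<nu>)) ?B J * branch \<theta> lam (bump (-1) J \<nu>)) else 0)"
    if "\<nu> \<in> U" for \<nu>
  proof -
    have "\<nu> \<in> GT (Suc n)" using that by (simp add: U_def GT_plus_iff)
    from intertwine[OF Suc.prems(2) lam this, of "t * ?X"] show ?thesis
      by (simp add: sum.inter_filter[symmetric] Pow_def conj_commute)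
  qed
  let ?h = "\<lambda>\<mu> J. branch \<theta> lam \<mu> * ?X powi d \<mu> *
    (t ^ card J * cut \<theta> (spart \<theta> \<mu>) ?B J * njack \<theta> (bump 1 J \<mu>) x)"
  have right: "(\<Sum>\<mu>\<in>M. ?h \<mu> J) =
      (\<Sum>\<nu>\<in>U. ?X powi d \<nu> * njack \<theta> \<nu> x * (if bump (-1) J \<nu> \<prec>\<^sub>G\<^sub>T lam then
       (t * ?X) ^ card J * (cut \<theta> (spart \<theta> (bump (-1) J \<nu>)) ?B J * branch \<theta> lam (bump (-1) J \<nu>)) else 0))"
    if J: "J \<in> Pow ?B" for J
  proof -
    have "(\<Sum>\<mu>\<in>M. ?h \<mu> J) =
      (\<Sum>\<mu> | \<mu> \<in> M \<and> bump 1 J \<mu> \<in> GT (Suc n). ?h \<mu> J)"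
    proof (rule sum.mono_neutral_right[OF finM])
      show "\<forall>\<mu>\<in>M - {\<mu> \<in> M. bump 1 J \<mu> \<in> GT (Suc n)}. ?h \<mu> J = 0"
      proof
        fix \<mu> assume "\<mu> \<in> M - {\<mu> \<in> M. bump 1 J \<mu> \<in> GT (Suc n)}"
        then have "cut \<theta> (spart \<theta> \<mu>) ?B J = 0" using J by (intro cut_bump_not_GT) (auto simp: M_def GT_plus_iff)
        then show "?h \<mu> J = 0"
          by simp
      qed
    qed auto
    also have "\<dots> = (\<Sum>\<nu> | \<nu> \<in> U \<and> bump (-1) J \<nu> \<prec>\<^sub>G\<^sub>T lam. ?X powi d \<nu> * njack \<theta> \<nu> x *
       ((t * ?X) ^ card J * (cut \<theta> (spart \<theta> (bump (-1) J \<nu>)) ?B J * branch \<theta> lam (bump (-1) J \<nu>))))"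
    proof (rule sum.reindex_bij_witness[of _ "bump (-1) J" "bump 1 J"])
      fix \<mu> assume \<mu>: "\<mu> \<in> {\<mu>. \<mu> \<in> M \<and> bump 1 J \<mu> \<in> GT (Suc n)}"
      then have len\<mu>: "length \<mu> = Suc n" using lenM by simp
      show "bump (- 1) J (bump 1 J \<mu>) = \<mu>" by (rule bump_inverse)
      have "bump 1 J \<mu> ! i \<le> lam ! 0 + 1" if "i < Suc n" for i
        using interlaces_bounded[of \<mu> lam "Suc n" i] \<mu> that len\<mu> by (simp add: M_def)
      moreover have "bump 1 J \<mu> \<in> GT_plus (Suc n)" using \<mu> by (intro bump_GT_plus) (auto simp: M_def)
      ultimately show "bump 1 J \<mu> \<in> {\<nu>. \<nu> \<in> U \<and> bump (-1) J \<nu> \<prec>\<^sub>G\<^sub>T lam}"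
        using \<mu> bump_inverse(1)[of 1 J \<mu>] by (simp add: U_def M_def)
      have "d \<mu> = d (bump 1 J \<mu>) + int (card J)"
        using sum_list_bump[of J \<mu> 1] J len\<mu> by (simp add: d_def)
      then have "?X powi d \<mu> = ?X powi d (bump 1 J \<mu>) * ?X ^ card J" by (simp only: pw)
      then show "?X powi d (bump 1 J \<mu>) * njack \<theta> (bump 1 J \<mu>) x *
         ((t * ?X) ^ card J * (cut \<theta> (spart \<theta> (bump (-1) J (bump 1 J \<mu>))) ?B J * branch \<theta> lam (bump (-1) J (bump 1 J \<mu>)))) =
        ?h \<mu> J"
        using bump_inverse(1)[of 1 J \<mu>] by (simp add: power_mult_distrib mult_ac)
    next
      fix \<nu> assume \<nu>: "\<nu> \<in> {\<nu>. \<nu> \<in> U \<and> bump (-1) J \<nu> \<prec>\<^sub>G\<^sub>T lam}"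
      then have len\<nu>: "length \<nu> = Suc n" using lenU by simp
      show inv: "bump 1 J (bump (-1) J \<nu>) = \<nu>" by (rule bump_inverse)
      have adm: "bump (-1) J \<nu> \<prec>\<^sub>G\<^sub>T lam" using \<nu> by simp
      have "bump (-1) J \<nu> \<in> GT (Suc n)" using interlaces_GT(2)[OF adm] len\<nu> by simp
      \<comment> \<open>Interlacing bounds part i of the lowered signature below by part i + 1 of
        \<open>lam\<close>, so lowering stays within the nonnegative signatures.\<close>
      moreover have "0 \<le> bump (-1) J \<nu> ! i" if "i < Suc n" for i
        using interlaces_nth(1)[OF adm, of i] nonneg[of "Suc i"] that len\<nu> by simp
      ultimately have "bump (-1) J \<nu> \<in> GT_plus (Suc n)" by (auto simp: GT_plus_iff simp del: nth_bump)
      then show "bump (-1) J \<nu> \<in> {\<mu>. \<mu> \<in> M \<and> bump 1 J \<mu> \<in> GT (Suc n)}"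
        using \<nu> by (simp add: M_def inv U_def GT_plus_iff)
    qed
    finally show ?thesis by (simp add: sum.inter_filter[OF finU] if_distrib[of "(*) _"] cong: if_cong)
  qed
  have "(\<Sum>I\<in>Pow ?A. t ^ card I * cut \<theta> (spart \<theta> lam) ?A I * njack \<theta> (bump 1 I lam) x) =
     (\<Sum>\<nu>\<in>U. ?X powi d \<nu> * njack \<theta> \<nu> x * (\<Sum>I\<in>Pow ?A. if \<nu> \<prec>\<^sub>G\<^sub>T bump 1 I lam then
        (t * ?X) ^ card I * (cut \<theta> (spart \<theta> lam) ?A I * branch \<theta> (bump 1 I lam) \<nu>) else 0))"
    by (simp only: left sum_distrib_left cong: sum.cong) (rule sum.swap)
  also have "\<dots> = (\<Sum>\<nu>\<in>U. ?X powi d \<nu> * njack \<theta> \<nu> x * ((1 + t * ?X) * (\<Sum>J\<in>Pow ?B. if bump (-1) J \<nu> \<prec>\<^sub>G\<^sub>T lam then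
       (t * ?X) ^ card J * (cut \<theta> (spart \<theta> (bump (-1) J \<nu>)) ?B J * branch \<theta> lam (bump (-1) J \<nu>)) else 0)))"
    by (intro sum.cong refl) (simp only: inner)
  also have "\<dots> = (1 + t * ?X) * (\<Sum>\<nu>\<in>U. \<Sum>J\<in>Pow ?B. ?X powi d \<nu> * njack \<theta> \<nu> x * (if bump (-1) J \<nu> \<prec>\<^sub>G\<^sub>T lam then
       (t * ?X) ^ card J * (cut \<theta> (spart \<theta> (bump (-1) J \<nu>)) ?B J * branch \<theta> lam (bump (-1) J \<nu>)) else 0))"
    by (simp only: sum_distrib_left mult_ac)
  also have "\<dots> = (1 + t * ?X) * (\<Sum>J\<in>Pow ?B. \<Sum>\<mu>\<in>M. ?h \<mu> J)"
    by (subst sum.swap) (simp only: right cong: sum.cong)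
  also have "\<dots> = (1 + t * ?X) * (\<Sum>\<mu>\<in>M. branch \<theta> lam \<mu> * ?X powi d \<mu> *
        (\<Sum>J\<in>Pow ?B. t ^ card J * cut \<theta> (spart \<theta> \<mu>) ?B J * njack \<theta> (bump 1 J \<mu>) x))"
    by (subst sum.swap) (simp only: sum_distrib_left)
  also have "\<dots> = (1 + t * ?X) * (\<Sum>\<mu>\<in>M. branch \<theta> lam \<mu> * ?X powi d \<mu> * ((\<Prod>i<Suc n. 1 + t * x ! i) * njack \<theta> \<mu> x))"
  proof -
    have "(\<Sum>J\<in>Pow ?B. t ^ card J * cut \<theta> (spart \<theta> \<mu>) ?B J * njack \<theta> (bump 1 J \<mu>) x) = (\<Prod>i<Suc n. 1 + t * x ! i) * njack \<theta> \<mu> x"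
      if "\<mu> \<in> M" for \<mu>
      using that Suc.prems by (intro Suc.IH) (auto simp: M_def)
    then show ?thesis by (simp only: cong: sum.cong)
  qed
  also have "\<dots> = (\<Prod>i<Suc (Suc n). 1 + t * x ! i) * njack \<theta> lam x"
    unfolding njack_rec[where x = x, OF Suc.prems(1,2) X] M_def d_def
    by (simp add: sum_distrib_left mult_ac)
  finally show ?case .
qed

section \<open>Moments of Beta averages of symmetric polynomials\<close>

locale beta_pair =
  fixes \<theta> \<kappa> :: real
  assumes \<theta>_pos: "\<theta> > 0" and \<kappa>_pos: "\<kappa> > 0"
begin

text \<open>The Beta integral of x^(s-1) (1 - x)^(\<theta> + \<kappa> - 1), up to the constant
  \<Gamma>(\<theta> + \<kappa>).\<close>

definition mellin :: "real \<Rightarrow> real" where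
  "mellin s = Gamma s / Gamma (s + (\<theta> + \<kappa>))"

definition moment :: "nat \<Rightarrow> real" where
  "moment k = pochhammer \<theta> k / pochhammer (\<theta> + \<kappa>) k"

definition weight :: "real \<Rightarrow> real" where
  "weight B = B powr (\<theta> - 1) * (1 - B) powr (\<kappa> - 1)"

definition expect :: "(real \<Rightarrow> real) \<Rightarrow> real" where
  "expect h = integral {0..1} (\<lambda>B. h B * weight B) / Beta \<theta> \<kappa>"

text \<open>Multiplication of the integrand by (1 - x) (1 - y), expressed on moments.\<close>

definition diag :: "(real \<Rightarrow> real \<Rightarrow> nat \<Rightarrow> real) \<Rightarrow> real \<Rightarrow> real \<Rightarrow> nat \<Rightarrow> real" where
  "diag m s r k = m s r k - m (s + 1) r k - m s (r + 1) k + m (s + 1) (r + 1) k"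

text \<open>
  Up to constant factors, \<open>sym_moments f m\<close> says that \<open>m s r k\<close> is the integral of
  \<open>B^k f(x + y + B (1 - x) (1 - y), x y)\<close> against \<open>x^(s-1) y^(r-1) ((1 - x) (1 - y))^(\<theta> + \<kappa> - 1)\<close> and the Beta
  density of \<open>B\<close>, and \<open>xy_moments h m\<close> that \<open>m s r\<close> is the integral of \<open>h\<close> against the same weight in \<open>x, y\<close>.
\<close>

inductive sym_moments :: "(real \<Rightarrow> real \<Rightarrow> real) \<Rightarrow> (real \<Rightarrow> real \<Rightarrow> nat \<Rightarrow> real) \<Rightarrow> bool" where
  one: "sym_moments (\<lambda>z p. 1) (\<lambda>s r k. mellin s * mellin r * moment k)"
| times_sum: "sym_moments f m \<Longrightarrow>
    sym_moments (\<lambda>z p. z * f z p) (\<lambda>s r k. m (s + 1) r k + m s (r + 1) k + diag m s r (Suc k))"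
| times_prod: "sym_moments f m \<Longrightarrow> sym_moments (\<lambda>z p. p * f z p) (\<lambda>s r k. m (s + 1) (r + 1) k)"
| add: "sym_moments f m \<Longrightarrow> sym_moments f' m' \<Longrightarrow>
    sym_moments (\<lambda>z p. f z p + f' z p) (\<lambda>s r k. m s r k + m' s r k)"
| scale: "sym_moments f m \<Longrightarrow> sym_moments (\<lambda>z p. a * f z p) (\<lambda>s r k. a * m s r k)"

inductive xy_moments :: "(real \<Rightarrow> real \<Rightarrow> real) \<Rightarrow> (real \<Rightarrow> real \<Rightarrow> real) \<Rightarrow> bool" where
  xy_one: "xy_moments (\<lambda>x y. 1) (\<lambda>s r. mellin s * mellin r)"
| xy_left: "xy_moments h m \<Longrightarrow> xy_moments (\<lambda>x y. x * h x y) (\<lambda>s r. m (s + 1) r)"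
| xy_right: "xy_moments h m \<Longrightarrow> xy_moments (\<lambda>x y. y * h x y) (\<lambda>s r. m s (r + 1))"
| xy_add: "xy_moments h m \<Longrightarrow> xy_moments h' m' \<Longrightarrow>
    xy_moments (\<lambda>x y. h x y + h' x y) (\<lambda>s r. m s r + m' s r)"
| xy_scale: "xy_moments h m \<Longrightarrow> xy_moments (\<lambda>x y. a * h x y) (\<lambda>s r. a * m s r)"

lemma mellin_Suc:
  assumes "s > 0"
  shows "(s + (\<theta> + \<kappa>)) * mellin (s + 1) = s * mellin s"
proof -
  define u where "u = s + (\<theta> + \<kappa>)"
  have u: "u > 0" using assms \<theta>_pos \<kappa>_pos by (simp add: u_def)
  have "Gamma (s + 1) = s * Gamma s" "Gamma (u + 1) = u * Gamma u"
    using assms u by (auto intro!: Gamma_plus1 dest: nonpos_Ints_nonpos)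
  moreover have eq: "s + 1 + (\<theta> + \<kappa>) = u + 1" by (simp add: u_def)
  ultimately show ?thesis using u unfolding mellin_def eq u_def[symmetric] by simp
qed

lemma moment_Suc: "(\<theta> + \<kappa> + real k) * moment (Suc k) = (\<theta> + real k) * moment k"
proof -
  have "\<theta> + \<kappa> + real k > 0" using \<theta>_pos \<kappa>_pos by simp
  then show ?thesis by (simp add: moment_def pochhammer_Suc)
qed

text \<open>The integration by parts for the constant polynomial. \<open>L\<close>,
  \<open>L1\<close> are the values of \<open>mellin\<close> at s, s + 1, \<open>R\<close>,
  \<open>R1\<close> those at r, r + 1, and \<open>M\<close>, \<open>M1\<close> are consecutive
  moments of \<open>B\<close>; \<open>T\<close> is \<theta> and \<open>b\<close> is \<theta> +
  \<kappa>.\<close>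

lemma key_algebra:
  fixes s r b T k L L1 R R1 M M1 :: real
  assumes "s > 0" "r > 0" "b > 0"
    and "(s + b) * L1 = s * L" "(r + b) * R1 = r * R" "(b + k) * M1 = (T + k) * M"
  shows "(s - r) * ((L - L1) * (R - R1) * M1) =
    (T + k) * ((L1 * R - L * R1) * M) - k * ((L1 * R - L * R1) * M1)"
proof -
  have 1: "(s + b) * (L - L1) = b * L" "(r + b) * (R - R1) = b * R"
    using assms(4,5) by (simp_all add: algebra_simps)
  have "(s + b) * (r + b) * ((s - r) * ((L - L1) * (R - R1) * M1)) = (s - r) * ((b * L) * (b * R) * M1)"
    unfolding 1[symmetric] by (simp only: mult_ac)
  also have "\<dots> = ((s * L) * (r + b) * R - (s + b) * L * (r * R)) * (b * M1)"
    by algebra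
  also have "\<dots> = (s + b) * (r + b) * ((L1 * R - L * R1) * (b * M1))"
    unfolding assms(4,5)[symmetric] by algebra
  finally have "(s - r) * ((L - L1) * (R - R1) * M1) = (L1 * R - L * R1) * (b * M1)"
    using assms(1-3) by simp
  also have "b * M1 = (T + k) * M - k * M1" using assms(6) by (simp add: algebra_simps)
  finally show ?thesis by (simp add: algebra_simps)
qed

text \<open>
  With \<open>Z = x + y + B (1 - x) (1 - y)\<close>, integration by parts in \<open>x\<close>, \<open>y\<close> and \<open>B\<close> shows that
  \<open>(s - r) (1 - x) (1 - y) B^(k+1) f(Z, x y)\<close> and
  \<open>(x - y) (\<theta> B^k + k (1 - B) B^k) f(Z, x y)\<close> have the same integral.
\<close>

lemma diag_Suc:
  assumes "sym_moments f m" "s > 0" "r > 0"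
  shows "(s - r) * diag m s r (Suc k) = (\<theta> + real k) * (m (s + 1) r k - m s (r + 1) k)
    - real k * (m (s + 1) r (Suc k) - m s (r + 1) (Suc k))"
  using assms
proof (induction arbitrary: s r k)
  case one
  then show ?case
    using key_algebra[OF one _ mellin_Suc[OF one(1)] mellin_Suc[OF one(2)] moment_Suc[of k]] \<theta>_pos \<kappa>_pos
    by (simp add: diag_def algebra_simps)
next
  case (times_sum f m)
  note pos = times_sum.prems
  have 1: "(s - r) * diag m s r (Suc k) = (\<theta> + real k) * (m (s + 1) r k - m s (r + 1) k)
    - real k * (m (s + 1) r (Suc k) - m s (r + 1) (Suc k))" if "s > 0" "r > 0" for s r k
    using that by (rule times_sum.IH)
  have pos1: "s + 1 > 0" "r + 1 > 0" using pos by simp_all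
  note 2 = 1[OF pos1(1) pos(2)] 1[OF pos(1) pos1(2)] 1[OF pos] 1[OF pos1]
  let ?D = "diag m (s + 1) r (Suc k) + diag m s (r + 1) (Suc k) + (diag m s r (Suc (Suc k)) - diag m (s + 1) r (Suc (Suc k))
      - diag m s (r + 1) (Suc (Suc k)) + diag m (s + 1) (r + 1) (Suc (Suc k)))"
  have e: "diag (\<lambda>s r k. m (s + 1) r k + m s (r + 1) k + diag m s r (Suc k)) s r (Suc k) =
    ?D"
    by (simp add: diag_def)
  \<comment> \<open>The induction hypothesis needs each shifted \<open>diag\<close> multiplied by
    the difference of its own arguments; the last line compensates for replacing s - r by those
    differences.\<close>
  have "(s - r) * (?D) =
    ((s + 1 - r) * diag m (s + 1) r (Suc k) + (s - (r + 1)) * diag m s (r + 1) (Suc k) + ((s - r) * diag m s r (Suc (Suc k))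
      - (s + 1 - r) * diag m (s + 1) r (Suc (Suc k)) - (s - (r + 1)) * diag m s (r + 1) (Suc (Suc k))
      + (s + 1 - (r + 1)) * diag m (s + 1) (r + 1) (Suc (Suc k))))
    - diag m (s + 1) r (Suc k) + diag m s (r + 1) (Suc k) + diag m (s + 1) r (Suc (Suc k)) - diag m s (r + 1) (Suc (Suc k))"
    by (simp add: algebra_simps)
  then show ?case unfolding e 2 by (simp add: diag_def algebra_simps)
next
  case (times_prod f m)
  show ?case using times_prod.IH[of "s + 1" "r + 1" k] times_prod.prems by (simp add: diag_def)
next
  case (add f m f' m')
  show ?case using add.IH(1)[OF add.prems, of k] add.IH(2)[OF add.prems, of k]
    by (simp add: diag_def algebra_simps)
next
  case (scale f m a)
  have "(s - r) * diag (\<lambda>s r k. a * m s r k) s r (Suc k) = a * ((s - r) * diag m s r (Suc k))"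
    by (simp add: diag_def algebra_simps)
  then show ?case unfolding scale.IH[OF scale.prems] by (simp add: algebra_simps)
qed

text \<open>At k = 0 the term with factor k drops out, so the moment with one power of
  \<open>B\<close> inside \<open>diag\<close> is expressed through moments without \<open>B\<close>.
  This is what makes the recursion close at k = 0.\<close>

lemma times_sum_moment:
  assumes "sym_moments f m" "s > 0" "r > 0"
  shows "(s - r) * (m (s + 1) r 0 + m s (r + 1) 0 + diag m s r (Suc 0)) =
    (s - r + \<theta>) * m (s + 1) r 0 + (s - r - \<theta>) * m s (r + 1) 0"
  using diag_Suc[OF assms, of 0] by (simp add: algebra_simps)

lemma sym_moments_continuous: "sym_moments f m \<Longrightarrow> continuous_on UNIV (\<lambda>z. f z p)"
  by (induction rule: sym_moments.induct) (auto intro!: continuous_intros)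

section \<open>Averages over the Beta density\<close>

lemma weight_has_integral: "(weight has_integral Beta \<theta> \<kappa>) {0..1}"
  using has_integral_Beta_real[OF \<theta>_pos \<kappa>_pos] by (simp add: weight_def[abs_def])

lemma continuous_times_weight:
  assumes "continuous_on {0..1} h"
  shows "(\<lambda>B. h B * weight B) absolutely_integrable_on {0..1}"
proof (rule absolutely_integrable_bounded_measurable_product_real)
  show "weight absolutely_integrable_on {0..1}"
    using weight_has_integral by (intro nonnegative_absolutely_integrable_1) (auto simp: weight_def)
  show "h \<in> borel_measurable (lebesgue_on {0..1})"
    using assms by (intro continuous_imp_measurable_on_sets_lebesgue) auto
  show "bounded (h ` {0..1})"
    using assms by (intro compact_imp_bounded compact_continuous_image) auto
qed simp

lemma expect_has_integral:
  assumes "continuous_on {0..1} h"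
  shows "((\<lambda>B. h B * weight B) has_integral expect h * Beta \<theta> \<kappa>) {0..1}"
proof -
  have "Beta \<theta> \<kappa> > 0" using \<theta>_pos \<kappa>_pos by (simp add: Beta_def)
  then show ?thesis
    using continuous_times_weight[OF assms]
    by (simp add: expect_def absolutely_integrable_on_def integrable_integral)
qed

lemma expect_add:
  assumes "continuous_on {0..1} h" "continuous_on {0..1} h'"
  shows "expect (\<lambda>B. h B + h' B) = expect h + expect h'"
  using continuous_times_weight[OF assms(1)] continuous_times_weight[OF assms(2)]
  by (simp add: expect_def distrib_right absolutely_integrable_on_def integral_add add_divide_distrib)

lemma expect_cmult: "expect (\<lambda>B. a * h B) = a * expect h"
  by (simp add: expect_def mult.assoc)

lemma expect_power: "expect (\<lambda>B. B ^ k) = moment k"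
proof -
  have "((\<lambda>B. B powr (\<theta> + real k - 1) * (1 - B) powr (\<kappa> - 1)) has_integral Beta (\<theta> + real k) \<kappa>) {0..1}"
    using \<theta>_pos \<kappa>_pos by (intro has_integral_Beta_real) auto
  also have "?this \<longleftrightarrow> ((\<lambda>B. B ^ k * weight B) has_integral Beta (\<theta> + real k) \<kappa>) {0..1}"
  proof (intro has_integral_cong)
    fix B :: real assume "B \<in> {0..1}"
    then show "B powr (\<theta> + real k - 1) * (1 - B) powr (\<kappa> - 1) = B ^ k * weight B"
      by (cases "B = 0") (auto simp: weight_def powr_add powr_diff powr_realpow)
  qed
  finally have "expect (\<lambda>B. B ^ k) = Beta (\<theta> + real k) \<kappa> / Beta \<theta> \<kappa>"
    by (simp add: expect_def integral_unique)
  moreover have "\<theta> \<notin> \<int>\<^sub>\<le>\<^sub>0" "\<theta> + \<kappa> \<notin> \<int>\<^sub>\<le>\<^sub>0" using \<theta>_pos \<kappa>_pos by (auto dest: nonpos_Ints_nonpos)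
  moreover have "Gamma \<theta> > 0" "Gamma \<kappa> > 0" "Gamma (\<theta> + \<kappa>) > 0" "Gamma (\<theta> + \<kappa> + real k) > 0"
    using \<theta>_pos \<kappa>_pos by (auto intro!: Gamma_real_pos)
  ultimately show ?thesis
    by (simp add: moment_def Beta_def pochhammer_Gamma field_simps add_ac)
qed

text \<open>The bridge from formal moments to actual averages: each closure rule for
  \<open>sym_moments\<close> becomes, after expanding x + y + B (1 - x) (1 - y) and averaging, a
  combination of rules for \<open>xy_moments\<close>. All powers of \<open>B\<close> are carried
  along because multiplication by the sum raises them.\<close>

lemma sym_moments_xy:
  assumes "sym_moments f m"
  shows "xy_moments (\<lambda>x y. expect (\<lambda>B. B ^ k * f (x + y + B * ((1 - x) * (1 - y))) (x * y))) (\<lambda>s r. m s r k)"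
  using assms
proof (induction arbitrary: k rule: sym_moments.induct)
  case one
  show ?case using xy_scale[OF xy_one, of "moment k"] by (simp add: expect_power mult_ac)
next
  case (times_sum f m)
  have cont: "continuous_on {0..1} (\<lambda>B. B ^ j * f (x + y + B * ((1 - x) * (1 - y))) (x * y))" for j x y
    by (intro continuous_intros continuous_on_compose2[OF sym_moments_continuous[OF times_sum.hyps]]) auto
  let ?h = "\<lambda>k x y. expect (\<lambda>B. B ^ k * f (x + y + B * ((1 - x) * (1 - y))) (x * y))"
  have "expect (\<lambda>B. B ^ k * ((x + y + B * ((1 - x) * (1 - y))) * f (x + y + B * ((1 - x) * (1 - y))) (x * y)))
     = (x * ?h k x y + y * ?h k x y) +
       (?h (Suc k) x y + (- 1) * (x * ?h (Suc k) x y) + ((- 1) * (y * ?h (Suc k) x y) + x * (y * ?h (Suc k) x y)))" for x y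
  proof -
    have "expect (\<lambda>B. B ^ k * ((x + y + B * ((1 - x) * (1 - y))) * f (x + y + B * ((1 - x) * (1 - y))) (x * y)))
      = expect (\<lambda>B. (x + y) * (B ^ k * f (x + y + B * ((1 - x) * (1 - y))) (x * y)) +
          (1 - x) * (1 - y) * (B ^ Suc k * f (x + y + B * ((1 - x) * (1 - y))) (x * y)))"
      by (intro arg_cong[of _ _ expect]) (auto simp: algebra_simps)
    also have "\<dots> = (x + y) * ?h k x y + (1 - x) * (1 - y) * ?h (Suc k) x y"
      by (subst expect_add) (intro continuous_on_mult[OF continuous_on_const cont] | simp only: expect_cmult)+
    finally show ?thesis by (simp add: algebra_simps)
  qed
  moreover have "xy_moments (\<lambda>x y. (x * ?h k x y + y * ?h k x y) +
       (?h (Suc k) x y + (- 1) * (x * ?h (Suc k) x y) + ((- 1) * (y * ?h (Suc k) x y) + x * (y * ?h (Suc k) x y))))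
     (\<lambda>s r. (m (s + 1) r k + m s (r + 1) k) +
       (m s r (Suc k) + (- 1) * m (s + 1) r (Suc k) + ((- 1) * m s (r + 1) (Suc k) + m (s + 1) (r + 1) (Suc k))))"
    by (intro xy_add xy_scale xy_left[OF times_sum.IH] xy_right[OF times_sum.IH] times_sum.IH
         xy_left[OF xy_right[OF times_sum.IH]])
  moreover have "(\<lambda>s r. m (s + 1) r k + m s (r + 1) k + diag m s r (Suc k)) =
    (\<lambda>s r. (m (s + 1) r k + m s (r + 1) k) +
       (m s r (Suc k) + (- 1) * m (s + 1) r (Suc k) + ((- 1) * m s (r + 1) (Suc k) + m (s + 1) (r + 1) (Suc k))))"
    by (simp add: diag_def fun_eq_iff)
  ultimately show ?case by (simp only:)
next
  case (times_prod f m)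
  have "xy_moments (\<lambda>x y. x * (y * expect (\<lambda>B. B ^ k * f (x + y + B * ((1 - x) * (1 - y))) (x * y))))
    (\<lambda>s r. m (s + 1) (r + 1) k)"
    by (intro xy_left[OF xy_right[OF times_prod.IH]])
  moreover have "x * (y * expect (\<lambda>B. B ^ k * f (x + y + B * ((1 - x) * (1 - y))) (x * y))) =
    expect (\<lambda>B. B ^ k * (x * y * f (x + y + B * ((1 - x) * (1 - y))) (x * y)))" for x y
    unfolding expect_cmult[symmetric] by (intro arg_cong[of _ _ expect]) (auto simp: mult_ac)
  ultimately show ?case by simp
next
  case (add f m f' m')
  have "continuous_on {0..1} (\<lambda>B. B ^ k * g (x + y + B * ((1 - x) * (1 - y))) (x * y))"
    if "sym_moments g m" for x y g m
    by (intro continuous_intros continuous_on_compose2[OF sym_moments_continuous[OF that]]) auto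
  note cont = this[OF add.hyps(1)] this[OF add.hyps(2)]
  show ?case using xy_add[OF add.IH] by (simp add: distrib_left expect_add[OF cont])
next
  case (scale f m a)
  have "(\<lambda>x y. expect (\<lambda>B. B ^ k * (a * f (x + y + B * ((1 - x) * (1 - y))) (x * y)))) =
    (\<lambda>x y. a * expect (\<lambda>B. B ^ k * f (x + y + B * ((1 - x) * (1 - y))) (x * y)))"
    unfolding expect_cmult[symmetric] by (simp add: mult_ac)
  then show ?case using xy_scale[OF scale.IH, of a k] by (simp only:)
qed

section \<open>Factored moments force a factored polynomial\<close>

lemma mellin_independent:
  fixes a :: "nat \<Rightarrow> real"
  assumes "infinite S" "\<And>s. s \<in> S \<Longrightarrow> s > 0" "\<And>s. s \<in> S \<Longrightarrow> (\<Sum>i<n. a i * mellin (s + real i)) = 0" "k < n"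
  shows "a k = 0"
proof -
  define b where "b = \<theta> + \<kappa>"
  have b: "b > 0" using \<theta>_pos \<kappa>_pos by (simp add: b_def)
  \<comment> \<open>Multiplication by \<Gamma>(s + b) (s + b) ... (s + b + n - 1) / \<Gamma>(s)
    removes all Gamma functions from the relation and leaves this polynomial in \<open>s\<close>,
    which vanishes on the infinite set \<open>S\<close>.\<close>
  define P where "P = (\<Sum>i<n. smult (a i) ((\<Prod>j<i. [:real j, 1:]) * (\<Prod>j\<in>{i..<n}. [:b + real j, 1:])))"
  have evalP: "poly P s = (\<Sum>i<n. a i * ((\<Prod>j<i. s + real j) * (\<Prod>j\<in>{i..<n}. s + (b + real j))))" for s
    by (simp add: P_def poly_sum poly_prod add.commute)
  have "poly P s = 0" if "s \<in> S" for s
  proof -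
    have s: "s > 0" using assms(2) that .
    have *: "mellin (s + real i) * (Gamma (s + b) * (\<Prod>j<n. s + (b + real j)) / Gamma s) =
       (\<Prod>j<i. s + real j) * (\<Prod>j\<in>{i..<n}. s + (b + real j))" if "i < n" for i
    proof -
      have pos: "Gamma s > 0" "Gamma (s + b) > 0" "Gamma (s + real i) > 0" "Gamma (s + b + real i) > 0"
        using s b by (auto intro!: Gamma_real_pos)
      have n: "s \<notin> \<int>\<^sub>\<le>\<^sub>0" "s + b \<notin> \<int>\<^sub>\<le>\<^sub>0" using s b by (auto dest: nonpos_Ints_nonpos)
      have 1: "Gamma (s + real i) = Gamma s * (\<Prod>j<i. s + real j)"
        using pos pochhammer_Gamma[OF n(1), of i] by (simp add: pochhammer_prod atLeast0LessThan field_simps)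
      have 2: "Gamma (s + b + real i) = Gamma (s + b) * (\<Prod>j<i. s + (b + real j))"
        using pos pochhammer_Gamma[OF n(2), of i] by (simp add: pochhammer_prod atLeast0LessThan field_simps)
      have 3: "(\<Prod>j<n. s + (b + real j)) = (\<Prod>j<i. s + (b + real j)) * (\<Prod>j\<in>{i..<n}. s + (b + real j))"
        using prod.atLeastLessThan_concat[of 0 i n "\<lambda>j. s + (b + real j)"] that by (simp add: atLeast0LessThan)
      have 4: "(\<Prod>j<i. s + (b + real j)) > 0" using s b by (intro prod_pos) auto
      have 5: "s + real i + (\<theta> + \<kappa>) = s + b + real i" by (simp add: b_def)
      show ?thesis
        unfolding mellin_def 5 2 1 3 using pos 4 by (simp del: prod_zero_iff)
    qed
    have "poly P s = (\<Sum>i<n. a i * mellin (s + real i)) * (Gamma (s + b) * (\<Prod>j<n. s + (b + real j)) / Gamma s)"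
      unfolding evalP sum_distrib_right by (intro sum.cong refl) (simp add: *[symmetric])
    then show ?thesis using assms(3)[OF that] by simp
  qed
  then have "P = 0" using assms(1) poly_roots_finite[of P] by (metis (mono_tags, lifting) finite_subset mem_Collect_eq subsetI)
  then have zero: "(\<Sum>i<n. a i * ((\<Prod>j<i. s + real j) * (\<Prod>j\<in>{i..<n}. s + (b + real j)))) = 0" for s
    using evalP[of s] by simp
  show ?thesis using assms(4)
  proof (induction k rule: less_induct)
    case (less k)
    \<comment> \<open>At s = -k the terms with i > k contain the zero factor j = k, and those with i
      < k have zero coefficient by induction. The products left at i = k are nonzero because b >
      0.\<close>
    have *: "a i * ((\<Prod>j<i. - real k + real j) * (\<Prod>j\<in>{i..<n}. - real k + (b + real j))) = 0" if "i < n" "i \<noteq> k" for i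
      using that less by (cases "i < k") auto
    have "(\<Sum>i<n. a i * ((\<Prod>j<i. - real k + real j) * (\<Prod>j\<in>{i..<n}. - real k + (b + real j))))
      = a k * ((\<Prod>j<k. - real k + real j) * (\<Prod>j\<in>{k..<n}. - real k + (b + real j)))"
    proof (subst sum.remove[of _ k])
      have "(\<Sum>i\<in>{..<n} - {k}. a i * ((\<Prod>j<i. - real k + real j) * (\<Prod>j\<in>{i..<n}. - real k + (b + real j)))) = 0"
        using * by (intro sum.neutral) blast
      then show "a k * ((\<Prod>j<k. - real k + real j) * (\<Prod>j\<in>{k..<n}. - real k + (b + real j))) +
        (\<Sum>i\<in>{..<n} - {k}. a i * ((\<Prod>j<i. - real k + real j) * (\<Prod>j\<in>{i..<n}. - real k + (b + real j)))) =
        a k * ((\<Prod>j<k. - real k + real j) * (\<Prod>j\<in>{k..<n}. - real k + (b + real j)))" by simp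
    qed (use less.prems in auto)
    moreover have "(\<Prod>j<k. - real k + real j) \<noteq> 0" by auto
    moreover have "(\<Prod>j\<in>{k..<n}. - real k + (b + real j)) \<noteq> 0" using b by auto
    ultimately show ?case using zero[of "- real k"] by simp
  qed
qed

text \<open>One coefficient matrix describes the polynomial and its moments, so that relations
  between moments can be read back as relations between coefficients.\<close>

lemma xy_moments_coeffs:
  assumes "xy_moments h m"
  shows "\<exists>n c. (\<forall>x y. h x y = (\<Sum>i<n. \<Sum>j<n. c i j * (x ^ i * y ^ j))) \<and>
    (\<forall>s r. m s r = (\<Sum>i<n. \<Sum>j<n. c i j * (mellin (s + real i) * mellin (r + real j))))"
proof -
  have pad: "(\<Sum>i<n. \<Sum>j<n. (if i < n' \<and> j < n' then c i j else 0) * g i j) = (\<Sum>i<n'. \<Sum>j<n'. c i j * g i j)"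
    if "n' \<le> n" for n n' :: nat and c g :: "nat \<Rightarrow> nat \<Rightarrow> real"
  proof -
    have "(\<Sum>i<n'. \<Sum>j<n'. c i j * g i j) = (\<Sum>i<n. \<Sum>j<n'. (if i < n' \<and> j < n' then c i j else 0) * g i j)"
      using that by (intro sum.mono_neutral_cong_left) auto
    also have "\<dots> = (\<Sum>i<n. \<Sum>j<n. (if i < n' \<and> j < n' then c i j else 0) * g i j)"
      using that by (intro sum.cong refl sum.mono_neutral_left) auto
    finally show ?thesis by simp
  qed
  have shift1: "(\<Sum>i<Suc n. \<Sum>j<Suc n. (if i > 0 \<and> j < n then c (i - 1) j else 0) * g i j) = (\<Sum>i<n. \<Sum>j<n. c i j * g (Suc i) j)"
    for n and c g :: "nat \<Rightarrow> nat \<Rightarrow> real"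
    by (subst sum.lessThan_Suc_shift) auto
  have shift2: "(\<Sum>i<Suc n. \<Sum>j<Suc n. (if j > 0 \<and> i < n then c i (j - 1) else 0) * g i j) = (\<Sum>i<n. \<Sum>j<n. c i j * g i (Suc j))"
    for n and c g :: "nat \<Rightarrow> nat \<Rightarrow> real"
  proof -
    have "(\<Sum>j<Suc n. (if j > 0 \<and> i < n then c i (j - 1) else 0) * g i j) =
      (if i < n then \<Sum>j<n. c i j * g i (Suc j) else 0)" for i
      by (subst sum.lessThan_Suc_shift) auto
    then show ?thesis by simp
  qed
  show ?thesis using assms
  proof (induction rule: xy_moments.induct)
    case xy_one
    show ?case by (intro exI[of _ 1] exI[of _ "\<lambda>i j. 1"]) auto
  next
    case (xy_left h m)
    then obtain n c where *: "\<And>x y. h x y = (\<Sum>i<n. \<Sum>j<n. c i j * (x ^ i * y ^ j))"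
      "\<And>s r. m s r = (\<Sum>i<n. \<Sum>j<n. c i j * (mellin (s + real i) * mellin (r + real j)))" by auto
    show ?case
      by (intro exI[of _ "Suc n"] exI[of _ "\<lambda>i j. if i > 0 \<and> j < n then c (i - 1) j else 0"] conjI allI)
         (simp_all only: shift1[where c = c] *, simp_all add: sum_distrib_left algebra_simps)
  next
    case (xy_right h m)
    then obtain n c where *: "\<And>x y. h x y = (\<Sum>i<n. \<Sum>j<n. c i j * (x ^ i * y ^ j))"
      "\<And>s r. m s r = (\<Sum>i<n. \<Sum>j<n. c i j * (mellin (s + real i) * mellin (r + real j)))" by auto
    show ?case
      by (intro exI[of _ "Suc n"] exI[of _ "\<lambda>i j. if j > 0 \<and> i < n then c i (j - 1) else 0"] conjI allI)
         (simp_all only: shift2[where c = c] *, simp_all add: sum_distrib_left algebra_simps)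
  next
    case (xy_add h m h' m')
    then obtain n c n' c' where *: "\<And>x y. h x y = (\<Sum>i<n. \<Sum>j<n. c i j * (x ^ i * y ^ j))"
      "\<And>s r. m s r = (\<Sum>i<n. \<Sum>j<n. c i j * (mellin (s + real i) * mellin (r + real j)))"
      "\<And>x y. h' x y = (\<Sum>i<n'. \<Sum>j<n'. c' i j * (x ^ i * y ^ j))"
      "\<And>s r. m' s r = (\<Sum>i<n'. \<Sum>j<n'. c' i j * (mellin (s + real i) * mellin (r + real j)))"
      by blast
    show ?case
      by (intro exI[of _ "max n n'"] exI[of _ "\<lambda>i j. (if i < n \<and> j < n then c i j else 0) +
           (if i < n' \<and> j < n' then c' i j else 0)"] conjI allI)
         (simp_all only: distrib_right sum.distrib pad[OF max.cobounded1] pad[OF max.cobounded2] *)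
  next
    case (xy_scale h m a)
    then obtain n c where *: "\<And>x y. h x y = (\<Sum>i<n. \<Sum>j<n. c i j * (x ^ i * y ^ j))"
      "\<And>s r. m s r = (\<Sum>i<n. \<Sum>j<n. c i j * (mellin (s + real i) * mellin (r + real j)))" by auto
    show ?case
      by (intro exI[of _ n] exI[of _ "\<lambda>i j. a * c i j"]) (auto simp: * sum_distrib_left mult.assoc)
  qed
qed

text \<open>Independence, used in \<open>r\<close> and then in \<open>s\<close>, shows that the
  coefficient matrix has rank one. Separate sample sets for \<open>s\<close> and \<open>r\<close>
  are allowed since the moments will be known only where s - r is not an integer.\<close>

lemma xy_moments_factor:
  assumes "xy_moments h m" "infinite S" "infinite R"
    and pos: "\<And>s. s \<in> S \<Longrightarrow> s > 0" "\<And>r. r \<in> R \<Longrightarrow> r > 0"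
    and m: "\<And>s r. s \<in> S \<Longrightarrow> r \<in> R \<Longrightarrow> m s r = \<alpha> s * \<beta> r"
    and nz: "\<And>s. s \<in> S \<Longrightarrow> \<alpha> s \<noteq> 0" "\<And>r. r \<in> R \<Longrightarrow> \<beta> r \<noteq> 0"
  shows "\<exists>P Q. \<forall>x y. h x y = P x * Q y"
proof -
  obtain n c where h: "\<And>x y. h x y = (\<Sum>i<n. \<Sum>j<n. c i j * (x ^ i * y ^ j))"
    and mc: "\<And>s r. m s r = (\<Sum>i<n. \<Sum>j<n. c i j * (mellin (s + real i) * mellin (r + real j)))"
    using xy_moments_coeffs[OF assms(1)] by blast
  obtain s0 r0 where s0: "s0 \<in> S" and r0: "r0 \<in> R" using assms(2,3) by (metis finite.emptyI ex_in_conv)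
  define C where "C s j = (\<Sum>i<n. c i j * mellin (s + real i))" for s j
  have mC: "m s r = (\<Sum>j<n. C s j * mellin (r + real j))" for s r
    unfolding mc C_def sum_distrib_right by (subst sum.swap) (simp add: mult_ac)
  have C: "\<alpha> s0 * C s j = \<alpha> s * C s0 j" if "s \<in> S" "j < n" for s j
  proof -
    have "(\<Sum>j<n. (\<alpha> s0 * C s j - \<alpha> s * C s0 j) * mellin (r + real j)) = 0" if "r \<in> R" for r
    proof -
      have "(\<Sum>j<n. (\<alpha> s0 * C s j - \<alpha> s * C s0 j) * mellin (r + real j)) = \<alpha> s0 * m s r - \<alpha> s * m s0 r"
        unfolding mC by (simp add: left_diff_distrib sum_subtractf sum_distrib_left mult.assoc)
      then show ?thesis using m[OF \<open>s \<in> S\<close> that] m[OF s0 that] by simp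
    qed
    from mellin_independent[OF assms(3) pos(2) this that(2)] show ?thesis by simp
  qed
  have cc: "c i j * C s0 j' = c i j' * C s0 j" if "i < n" "j < n" "j' < n" for i j j'
  proof -
    have "(\<Sum>i<n. (c i j * C s0 j' - c i j' * C s0 j) * mellin (s + real i)) = 0" if s: "s \<in> S" for s
    proof -
      have "(\<Sum>i<n. (c i j * D - c i j' * E) * mellin (s + real i)) = C s j * D - C s j' * E" for D E
        unfolding C_def by (simp add: left_diff_distrib right_diff_distrib sum_subtractf sum_distrib_left mult_ac)
      then have "(\<Sum>i<n. (c i j * C s0 j' - c i j' * C s0 j) * mellin (s + real i)) = C s j * C s0 j' - C s j' * C s0 j" .
      also have "\<alpha> s0 * \<dots> = 0"
        using C[OF s \<open>j < n\<close>] C[OF s \<open>j' < n\<close>] by (simp add: right_diff_distrib mult.assoc[symmetric])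
      finally show ?thesis using nz(1)[OF s0] by simp
    qed
    from mellin_independent[OF assms(2) pos(1) this that(1)] show ?thesis by simp
  qed
  have "(\<Sum>j<n. C s0 j * mellin (r0 + real j)) \<noteq> 0"
    using mC[of s0 r0] m[OF s0 r0] nz(1)[OF s0] nz(2)[OF r0] by (metis mult_eq_0_iff)
  \<comment> \<open>A pivot: every column of the coefficient matrix is a multiple of column
    \<open>j'\<close>.\<close>
  then obtain j' where j': "j' < n" "C s0 j' \<noteq> 0" by (metis (no_types, lifting) lessThan_iff mult_eq_0_iff sum.neutral)
  have "h x y = (\<Sum>i<n. c i j' / C s0 j' * x ^ i) * (\<Sum>j<n. C s0 j * y ^ j)" for x y
    unfolding h sum_product
  proof (intro sum.cong refl)
    fix i j assume "i \<in> {..<n}" "j \<in> {..<n}"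
    then have "c i j = c i j' / C s0 j' * C s0 j" using cc[of i j j'] j' by (simp add: field_simps)
    then show "c i j * (x ^ i * y ^ j) = c i j' / C s0 j' * x ^ i * (C s0 j * y ^ j)" by (simp add: mult_ac)
  qed
  then show ?thesis
    by (intro exI[of _ "\<lambda>x. \<Sum>i<n. c i j' / C s0 j' * x ^ i"] exI[of _ "\<lambda>y. \<Sum>j<n. C s0 j * y ^ j"]) blast
qed

end

section \<open>The kernel as a Beta density\<close>

context beta_pair begin

definition kernel :: "real \<Rightarrow> real \<Rightarrow> real \<Rightarrow> real" where
  "kernel x y w = (1 - x * w\<^sup>2 / y) * (1 - x * w / y) powr (\<theta> - 1) * (1 / w - 1) powr (\<theta> - 1)
     * (((1 - x * w) * (1 - y / w)) / ((1 - x) * (1 - y))) powr (\<kappa> - 1) * (1 / w\<^sup>2)"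

lemma kernel_integral:
  assumes "0 < x" "x < y" "y < 1" "continuous_on UNIV h"
  defines "F \<equiv> \<lambda>w. h (x * w + y / w) * kernel x y w"
  shows "set_integrable lborel {y<..<1} F"
    and "(LBINT w:{y<..<1}. F w) =
      expect (\<lambda>B. h (x + y + B * ((1 - x) * (1 - y)))) * Beta \<theta> \<kappa> * ((1 - x) * (1 - y)) powr \<theta> / y powr \<theta>"
proof -
  define q where "q = (1 - x) * (1 - y)"
  have q: "q > 0" using assms by (simp add: q_def)
  \<comment> \<open>\<open>g\<close> solves u + v = x + y + B (1 - x) (1 - y) for B along u = x w, v
    = y / w. It decreases from 1 at w = y to 0 at w = 1.\<close>
  define g where "g w = (x * w + y / w - x - y) / q" for w
  define g' where "g' w = (x - y / w\<^sup>2) / q" for w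
  define H where "H B = h (x + y + B * q)" for B
  let ?S = "{y<..<1}"
  have contH: "continuous_on T H" for T
    unfolding H_def by (intro continuous_on_compose2[OF assms(4)] continuous_intros) auto
  have xw: "x * w < y" "x * w\<^sup>2 < y" if "w \<in> ?S" for w
  proof -
    have "w \<le> 1" "w\<^sup>2 \<le> 1" using that assms by (auto intro: power_le_one)
    then have "x * w \<le> x" "x * w\<^sup>2 \<le> x" using assms by (simp_all add: mult_left_le)
    then show "x * w < y" "x * w\<^sup>2 < y" using assms(2) by linarith+
  qed
  have der: "(g has_field_derivative g' w) (at w within ?S)" if "w \<in> ?S" for w
    unfolding g_def g'_def using that assms q
    by (auto intro!: derivative_eq_intros simp: power2_eq_square)
  have neg: "g' w < 0" if "w \<in> ?S" for w
    using xw(2)[OF that] that assms q by (simp add: g'_def field_simps)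
  \<comment> \<open>The numerator of \<open>g\<close> vanishes at w = 1 and w = y / x; that of 1 - g
    factors because (x w) (y / w) = x y. These factors are the bases of the powers in
    \<open>kernel\<close>.\<close>
  have g_eq: "g w = y / q * ((1 - x * w / y) * (1 / w - 1))"
    and g1_eq: "1 - g w = ((1 - x * w) * (1 - y / w)) / q" if "w \<in> ?S" for w
    using that assms q by (simp_all add: g_def field_simps) (simp_all add: q_def algebra_simps)
  have bounds: "g w \<in> {0<..<1}" if "w \<in> ?S" for w
  proof -
    have "g w > 0" unfolding g_eq[OF that]
      using that assms q xw[OF that] by (intro mult_pos_pos divide_pos_pos) auto
    moreover have "1 - g w > 0" unfolding g1_eq[OF that]
      using that assms q xw[OF that] by (intro mult_pos_pos divide_pos_pos) auto
    ultimately show ?thesis by simp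
  qed
  have contg: "continuous_on {y..1} g"
    unfolding g_def using assms q by (intro continuous_intros) auto
  have mono: "g b < g a" if "y \<le> a" "a < b" "b \<le> 1" for a b
  proof (rule DERIV_neg_imp_decreasing_open[OF that(2)])
    show "\<exists>D. (g has_real_derivative D) (at w) \<and> D < 0" if "a < w" "w < b" for w
      using der[of w] neg[of w] that \<open>y \<le> a\<close> \<open>b \<le> 1\<close> by (intro exI[of _ "g' w"]) (auto simp: at_within_open[of w ?S])
    show "continuous_on {a..b} g" using contg by (rule continuous_on_subset) (use that in auto)
  qed
  have inj: "inj_on g ?S"
    by (rule inj_onI) (metis greaterThanLessThan_iff less_eq_real_def linorder_neqE_linordered_idom mono less_irrefl)
  have img: "g ` ?S = {0<..<1}"
  proof (intro equalityI subsetI)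
    fix B assume "B \<in> g ` ?S" then show "B \<in> {0<..<1}" using bounds by auto
  next
    fix B :: real assume B: "B \<in> {0<..<1}"
    have "g y = 1" "g 1 = 0" using assms q by (simp_all add: g_def field_simps) (simp add: q_def algebra_simps)
    moreover have "\<exists>w. y \<le> w \<and> w \<le> 1 \<and> g w = B"
      using contg assms B calculation by (intro IVT2') auto
    ultimately obtain w where "y \<le> w" "w \<le> 1" "g w = B" by auto
    moreover have "w \<noteq> y" "w \<noteq> 1" using \<open>g y = 1\<close> \<open>g 1 = 0\<close> \<open>g w = B\<close> B by auto
    ultimately show "B \<in> g ` ?S" by force
  qed
  have powr3: "(a * (b * c)) powr e = a powr e * (b powr e * c powr e)" if "a > 0" "b > 0" "c > 0" for a b c e :: real
    using that by (simp add: powr_mult)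
  have F_eq: "F w = q powr \<theta> / y powr \<theta> * (\<bar>g' w\<bar> * (H (g w) * weight (g w)))" if w: "w \<in> ?S" for w
  proof -
    have "x + y + g w * q = x * w + y / w" using q by (simp add: g_def)
    then have 1: "H (g w) = h (x * w + y / w)" by (simp add: H_def)
    have 2: "\<bar>g' w\<bar> = y / q * ((1 - x * w\<^sup>2 / y) * (1 / w\<^sup>2))"
      using neg[OF w] w assms q by (simp add: g'_def field_simps)
    have a: "g w powr (\<theta> - 1) = (y / q) powr (\<theta> - 1) * ((1 - x * w / y) powr (\<theta> - 1) * (1 / w - 1) powr (\<theta> - 1))"
      unfolding g_eq[OF w] by (rule powr3) (use w assms q xw[OF w] in auto)
    \<comment> \<open>One power of y / q comes from the Jacobian and \<theta> - 1 of them from the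
      density; together they cancel the prefactor of \<open>F_eq\<close>.\<close>
    have b: "(y / q) powr (\<theta> - 1) * (y / q) = (y / q) powr \<theta>"
      using assms q by (simp add: powr_diff)
    have c: "(y / q) powr \<theta> * (q powr \<theta> / y powr \<theta>) = 1"
      using assms q by (simp add: powr_divide)
    have "q powr \<theta> / y powr \<theta> * (y / q) * g w powr (\<theta> - 1) =
        ((y / q) powr (\<theta> - 1) * (y / q)) * (q powr \<theta> / y powr \<theta>) *
        ((1 - x * w / y) powr (\<theta> - 1) * (1 / w - 1) powr (\<theta> - 1))"
      unfolding a by (simp only: mult_ac)
    then have 3: "q powr \<theta> / y powr \<theta> * (y / q) * g w powr (\<theta> - 1) =
        (1 - x * w / y) powr (\<theta> - 1) * (1 / w - 1) powr (\<theta> - 1)"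
      unfolding b c by simp
    have "q powr \<theta> / y powr \<theta> * (\<bar>g' w\<bar> * (H (g w) * weight (g w))) =
      (q powr \<theta> / y powr \<theta> * (y / q) * g w powr (\<theta> - 1)) *
        (h (x * w + y / w) * ((1 - x * w\<^sup>2 / y) * (1 / w\<^sup>2)) * (1 - g w) powr (\<kappa> - 1))"
      unfolding 1 2 weight_def by (simp only: mult_ac)
    also have "\<dots> = F w"
      unfolding 3 g1_eq[OF w] F_def kernel_def q_def[symmetric] by (simp only: mult_ac)
    finally show ?thesis by simp
  qed
  have int: "(\<lambda>B. H B * weight B) absolutely_integrable_on {0<..<1}"
    "integral {0<..<1} (\<lambda>B. H B * weight B) = expect H * Beta \<theta> \<kappa>"
  proof -
    show "(\<lambda>B. H B * weight B) absolutely_integrable_on {0<..<1}"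
      using continuous_times_weight[OF contH] by (rule set_integrable_subset) auto
    show "integral {0<..<1} (\<lambda>B. H B * weight B) = expect H * Beta \<theta> \<kappa>"
      using expect_has_integral[OF contH] by (simp add: integral_unique has_integral_interior flip: integral_open_interval_real)
  qed
  have "(\<lambda>w. \<bar>g' w\<bar> * (H (g w) * weight (g w))) absolutely_integrable_on ?S \<and>
     integral ?S (\<lambda>w. \<bar>g' w\<bar> * (H (g w) * weight (g w))) = expect H * Beta \<theta> \<kappa>"
    by (subst has_absolute_integral_change_of_variables_1'[OF _ der inj]) (use img int in auto)
  then have abs: "(\<lambda>w. q powr \<theta> / y powr \<theta> * (\<bar>g' w\<bar> * (H (g w) * weight (g w)))) absolutely_integrable_on ?S"
    and val: "integral ?S (\<lambda>w. q powr \<theta> / y powr \<theta> * (\<bar>g' w\<bar> * (H (g w) * weight (g w)))) =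
      q powr \<theta> / y powr \<theta> * (expect H * Beta \<theta> \<kappa>)"
    by (auto intro: set_integrable_mult_right simp del: times_divide_eq_left)
  have absF: "F absolutely_integrable_on ?S"
    using abs by (subst set_integrable_cong[OF refl refl F_eq]) auto
  have valF: "integral ?S F = q powr \<theta> / y powr \<theta> * (expect H * Beta \<theta> \<kappa>)"
    unfolding val[symmetric] by (rule integral_cong[OF F_eq])
  have [measurable]: "h \<in> borel_measurable borel"
    using assms(4) by (rule borel_measurable_continuous_onI)
  \<comment> \<open>The change of variables lives on the completed Lebesgue measure. Borel
    measurability of the integrand carries integrability and the value over to
    \<open>lborel\<close>.\<close>
  have meas: "(\<lambda>w. indicator ?S w *\<^sub>R F w) \<in> borel_measurable lborel"
    unfolding F_def kernel_def by measurable
  show "set_integrable lborel ?S F"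
    using absF meas unfolding set_integrable_def by (simp add: integrable_completion)
  have "(LBINT w:?S. F w) = (LINT w:?S|lebesgue. F w)"
    using meas unfolding set_lebesgue_integral_def by (simp add: integral_completion)
  also have "\<dots> = integral ?S F" using absF by (rule set_lebesgue_integral_eq_integral)
  finally show "(LBINT w:?S. F w) =
      expect (\<lambda>B. h (x + y + B * ((1 - x) * (1 - y)))) * Beta \<theta> \<kappa> * ((1 - x) * (1 - y)) powr \<theta> / y powr \<theta>"
    unfolding valF H_def[abs_def] q_def by simp
qed

end

section \<open>The Pieri rule for products of Gamma quotients\<close>

definition phi :: "real \<Rightarrow> real \<Rightarrow> int list \<Rightarrow> real" where
  "phi \<theta> s lam = (\<Prod>i<length lam. Gamma (spart \<theta> lam i + s) / Gamma (spart \<theta> lam i + s + \<theta>))"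

lemma spart_nonneg:
  assumes "lam \<in> GT_plus N" "\<theta> > 0" "i < N"
  shows "spart \<theta> lam i \<ge> 0"
proof -
  have "real N - 1 - real i \<ge> 0" using assms(3) by simp
  moreover have "length lam = N" "0 \<le> lam ! i" using assms by (auto simp: GT_plus_iff GT_length)
  ultimately show ?thesis using assms(2) by (simp add: spart_def)
qed

lemma phi_pos:
  assumes "lam \<in> GT_plus N" "\<theta> > 0" "s > 0"
  shows "phi \<theta> s lam > 0"
  unfolding phi_def
proof (intro prod_pos divide_pos_pos Gamma_real_pos ballI)
  fix i assume "i \<in> {..<length lam}"
  then have "spart \<theta> lam i \<ge> 0" using assms by (intro spart_nonneg[of lam N]) (auto simp: GT_plus_iff GT_length)
  then show "spart \<theta> lam i + s > 0" "spart \<theta> lam i + s + \<theta> > 0" using assms by auto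
qed

lemma Gamma_ratio_step:
  fixes z \<theta> :: real
  assumes "z > 0" "\<theta> > 0"
  shows "Gamma (z + 1) / Gamma (z + 1 + \<theta>) = Gamma z / Gamma (z + \<theta>) * (z / (z + \<theta>))"
proof -
  have "Gamma (z + 1) = z * Gamma z" "Gamma (z + \<theta> + 1) = (z + \<theta>) * Gamma (z + \<theta>)"
    using assms by (intro Gamma_plus1; auto dest: nonpos_Ints_nonpos)+
  moreover have e: "z + 1 + \<theta> = z + \<theta> + 1" by simp
  ultimately show ?thesis unfolding e by (simp add: mult.commute)
qed

lemma phi_shift:
  assumes "lam \<in> GT_plus N" "\<theta> > 0" "s > 0"
  shows "phi \<theta> (s + 1) lam = phi \<theta> s lam * (\<Prod>i<N. (spart \<theta> lam i + s) / (spart \<theta> lam i + s + \<theta>))"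
proof -
  have len: "length lam = N" using assms(1) by (simp add: GT_plus_iff GT_length)
  show ?thesis
    unfolding phi_def len prod.distrib[symmetric]
  proof (intro prod.cong refl)
    fix i assume "i \<in> {..<N}"
    then have "spart \<theta> lam i + s > 0" using spart_nonneg[OF assms(1,2), of i] assms(3) by simp
    from Gamma_ratio_step[OF this assms(2)]
    show "Gamma (spart \<theta> lam i + (s + 1)) / Gamma (spart \<theta> lam i + (s + 1) + \<theta>) =
      Gamma (spart \<theta> lam i + s) / Gamma (spart \<theta> lam i + s + \<theta>) * ((spart \<theta> lam i + s) / (spart \<theta> lam i + s + \<theta>))"
      by (simp add: add.assoc)
  qed
qed

lemma phi_bump:
  assumes "lam \<in> GT_plus N" "\<theta> > 0" "s > 0" "I \<subseteq> {..<N}"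
  shows "phi \<theta> s (bump 1 I lam) = phi \<theta> s lam * (\<Prod>i\<in>I. (spart \<theta> lam i + s) / (spart \<theta> lam i + s + \<theta>))"
proof -
  have len: "length lam = N" using assms(1) by (simp add: GT_plus_iff GT_length)
  have "phi \<theta> s (bump 1 I lam) = (\<Prod>i<N. Gamma (spart \<theta> lam i + s) / Gamma (spart \<theta> lam i + s + \<theta>) *
     (if i \<in> I then (spart \<theta> lam i + s) / (spart \<theta> lam i + s + \<theta>) else 1))"
    unfolding phi_def length_bump len
  proof (intro prod.cong refl)
    fix i assume i: "i \<in> {..<N}"
    then have "spart \<theta> lam i + s > 0" using spart_nonneg[OF assms(1,2), of i] assms(3) by simp
    from Gamma_ratio_step[OF this assms(2)]
    show "Gamma (spart \<theta> (bump 1 I lam) i + s) / Gamma (spart \<theta> (bump 1 I lam) i + s + \<theta>) =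
      Gamma (spart \<theta> lam i + s) / Gamma (spart \<theta> lam i + s + \<theta>) *
     (if i \<in> I then (spart \<theta> lam i + s) / (spart \<theta> lam i + s + \<theta>) else 1)"
      using i len by (simp add: spart_bump add_ac)
  qed
  also have "\<dots> = phi \<theta> s lam * (\<Prod>i<N. if i \<in> I then (spart \<theta> lam i + s) / (spart \<theta> lam i + s + \<theta>) else 1)"
    unfolding phi_def len prod.distrib ..
  also have "(\<Prod>i<N. if i \<in> I then (spart \<theta> lam i + s) / (spart \<theta> lam i + s + \<theta>) else 1) =
     (\<Prod>i\<in>I. (spart \<theta> lam i + s) / (spart \<theta> lam i + s + \<theta>))"
    using assms(4) by (simp add: prod.If_cases Int_absorb1)
  finally show ?thesis .
qed

text \<open>The rational identity with c = \<theta> and the two points -s and -r: raising row i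
  multiplies its Gamma quotients by (l i + s)/(l i + s + \<theta>) and the same with r, and clearing
  denominators yields \<open>prods\<close>. The N - 2 surplus rows give the power of 1 + t, the four
  subsets of a two-point set the remaining terms.\<close>

lemma pieri_phi:
  assumes lam: "lam \<in> GT_plus N" and \<theta>: "\<theta> > 0" and s: "s > 0" and r: "r > 0" and sr: "s \<noteq> r" and N: "N \<ge> 2"
  shows "(\<Sum>I\<in>Pow {..<N}. t ^ card I * cut \<theta> (spart \<theta> lam) {..<N} I * (phi \<theta> s (bump 1 I lam) * phi \<theta> r (bump 1 I lam)))
    = (1 + t) ^ (N - 2) * (phi \<theta> s lam * phi \<theta> r lam
      + t * ((s - r + \<theta>) / (s - r) * (phi \<theta> (s + 1) lam * phi \<theta> r lam)
           + (s - r - \<theta>) / (s - r) * (phi \<theta> s lam * phi \<theta> (r + 1) lam))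
      + t\<^sup>2 * (phi \<theta> (s + 1) lam * phi \<theta> (r + 1) lam))"
proof -
  let ?A = "{..<N}" and ?l = "spart \<theta> lam"
  define B :: "nat set" where "B = {0, 1}"
  define n :: "nat \<Rightarrow> real" where "n = (\<lambda>j. if j = 0 then - s else - r)"
  define D where "D z = (\<Prod>i<N. ?l i + z + \<theta>)" for z
  have D: "D z > 0" if "z > 0" for z
    unfolding D_def using spart_nonneg[OF lam \<theta>] \<theta> that by (intro prod_pos) (auto simp: add_nonneg_pos)
  have ne: "?l i + z + \<theta> \<noteq> 0" if "i < N" "z > 0" for i z
    using spart_nonneg[OF lam \<theta> that(1)] \<theta> that(2) by auto
  have pB: "prods c ?l n A' B = (\<Prod>i\<in>A'. ?l i + s + c) * (\<Prod>i\<in>A'. ?l i + r + c)" for c A'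
    by (simp add: prods_def B_def n_def prod.distrib)
  have quot: "(\<Prod>i\<in>I. (?l i + z) / (?l i + z + \<theta>)) * D z = (\<Prod>i\<in>I. ?l i + z) * (\<Prod>i\<in>?A - I. ?l i + z + \<theta>)"
    if "I \<subseteq> ?A" "z > 0" for I z
  proof -
    have "(\<Prod>i\<in>I. (?l i + z) / (?l i + z + \<theta>)) * (\<Prod>i\<in>I. ?l i + z + \<theta>) = (\<Prod>i\<in>I. ?l i + z)"
      unfolding prod.distrib[symmetric] using ne that by (intro prod.cong refl) (auto simp: subset_iff)
    then show ?thesis
      unfolding D_def prod_split[OF finite_lessThan that(1), symmetric] by (simp only: mult.assoc[symmetric])
  qed
  have left: "phi \<theta> s (bump 1 I lam) * phi \<theta> r (bump 1 I lam) * (D s * D r) =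
    phi \<theta> s lam * phi \<theta> r lam * (prods 0 ?l n I B * prods \<theta> ?l n (?A - I) B)" if I: "I \<subseteq> ?A" for I
  proof -
    have "phi \<theta> s (bump 1 I lam) * phi \<theta> r (bump 1 I lam) * (D s * D r) = phi \<theta> s lam * phi \<theta> r lam *
      (((\<Prod>i\<in>I. (?l i + s) / (?l i + s + \<theta>)) * D s) * ((\<Prod>i\<in>I. (?l i + r) / (?l i + r + \<theta>)) * D r))"
      unfolding phi_bump[OF lam \<theta> s I] phi_bump[OF lam \<theta> r I] by (simp only: mult_ac)
    also have "\<dots> = phi \<theta> s lam * phi \<theta> r lam * (prods 0 ?l n I B * prods \<theta> ?l n (?A - I) B)"
      unfolding quot[OF I s] quot[OF I r] pB by (simp add: mult_ac)
    finally show ?thesis .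
  qed
  have shift: "phi \<theta> (z + 1) lam * D z = phi \<theta> z lam * (\<Prod>i<N. ?l i + z)" if "z > 0" for z
    using quot[of ?A z] that by (simp add: phi_shift[OF lam \<theta> that] mult.assoc)
  have "(\<Sum>I\<in>Pow ?A. t ^ card I * cut \<theta> ?l ?A I * (phi \<theta> s (bump 1 I lam) * phi \<theta> r (bump 1 I lam))) * (D s * D r)
     = phi \<theta> s lam * phi \<theta> r lam * left_sum \<theta> t ?l n ?A B"
    unfolding left_sum_def sum_distrib_left sum_distrib_right
  proof (intro sum.cong refl)
    fix I assume "I \<in> Pow ?A"
    then show "t ^ card I * cut \<theta> ?l ?A I * (phi \<theta> s (bump 1 I lam) * phi \<theta> r (bump 1 I lam)) * (D s * D r) =
      phi \<theta> s lam * phi \<theta> r lam * (t ^ card I * cut \<theta> ?l ?A I * prods 0 ?l n I B * prods \<theta> ?l n (?A - I) B)"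
      using left[of I] by (simp add: mult_ac)
  qed
  also have "left_sum \<theta> t ?l n ?A B = (1 + t) ^ (N - 2) * right_sum \<theta> t ?l n ?A B"
  proof -
    have "finite B" "card B = 2" "inj_on n B" using sr by (auto simp: B_def n_def inj_on_def)
    then show ?thesis
      using left_sum_eq_right_sum[of ?A B ?l n \<theta> t] inj_spart[of lam N \<theta>] lam \<theta> N
      by (simp add: GT_plus_iff)
  qed
  also have "right_sum \<theta> t ?l n ?A B = D s * D r
     + t * ((s - r + \<theta>) / (s - r) * ((\<Prod>i<N. ?l i + s) * D r) + (s - r - \<theta>) / (s - r) * (D s * (\<Prod>i<N. ?l i + r)))
     + t\<^sup>2 * ((\<Prod>i<N. ?l i + s) * (\<Prod>i<N. ?l i + r))"
  proof -
    have P: "Pow B = {{}, {0}, {1}, {0, 1}}" by (auto simp: B_def)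
    have Bd: "B - {0} = {1}" "B - {1} = {0}" "B - {0, 1} = {}" by (auto simp: B_def)
    have c: "cut (- \<theta>) n B {} = 1" "cut (- \<theta>) n B {0, 1} = 1"
      "cut (- \<theta>) n B {0} = (s - r + \<theta>) / (s - r)" "cut (- \<theta>) n B {1} = (s - r - \<theta>) / (s - r)"
      unfolding cut_def Bd using sr by (simp_all add: n_def divide_simps) (simp_all add: algebra_simps)
    have one: "prods e ?l n ?A {0} = (\<Prod>i<N. ?l i + s + e)" "prods e ?l n ?A {1} = (\<Prod>i<N. ?l i + r + e)"
      "prods e ?l n ?A {0, 1} = (\<Prod>i<N. ?l i + s + e) * (\<Prod>i<N. ?l i + r + e)"
      "prods e ?l n ?A {} = 1" "prods e ?l n ?A B = (\<Prod>i<N. ?l i + s + e) * (\<Prod>i<N. ?l i + r + e)" for e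
      by (simp_all add: prods_def n_def B_def prod.distrib)
    have B0: "B - {} = B" by simp
    show ?thesis
      unfolding right_sum_def P
      by (simp add: Bd B0 c one D_def power2_eq_square del: One_nat_def) (simp add: algebra_simps)
  qed
  finally have "(\<Sum>I\<in>Pow ?A. t ^ card I * cut \<theta> ?l ?A I * (phi \<theta> s (bump 1 I lam) * phi \<theta> r (bump 1 I lam))) * (D s * D r)
    = (1 + t) ^ (N - 2) * (phi \<theta> s lam * phi \<theta> r lam * (D s * D r)
      + t * ((s - r + \<theta>) / (s - r) * (phi \<theta> s lam * (\<Prod>i<N. ?l i + s) * (phi \<theta> r lam * D r))
           + (s - r - \<theta>) / (s - r) * (phi \<theta> s lam * D s * (phi \<theta> r lam * (\<Prod>i<N. ?l i + r))))
      + t\<^sup>2 * (phi \<theta> s lam * (\<Prod>i<N. ?l i + s) * (phi \<theta> r lam * (\<Prod>i<N. ?l i + r))))"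
    by (simp only: distrib_left mult_ac)
  also have "\<dots> = ((1 + t) ^ (N - 2) * (phi \<theta> s lam * phi \<theta> r lam
      + t * ((s - r + \<theta>) / (s - r) * (phi \<theta> (s + 1) lam * phi \<theta> r lam)
           + (s - r - \<theta>) / (s - r) * (phi \<theta> s lam * phi \<theta> (r + 1) lam))
      + t\<^sup>2 * (phi \<theta> (s + 1) lam * phi \<theta> (r + 1) lam))) * (D s * D r)"
    unfolding shift[OF s, symmetric] shift[OF r, symmetric] by (simp only: distrib_left distrib_right mult_ac)
  finally show ?thesis using D[OF s] D[OF r] by simp
qed

text \<open>The shifted parts of the zero signature are 0, \<theta>, ..., (N - 1) \<theta>, so the
  product telescopes.\<close>

lemma phi_zero:
  assumes "\<theta> > 0" "s > 0"
  shows "phi \<theta> s (replicate N 0) = Gamma s / Gamma (s + real N * \<theta>)"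
proof -
  define G where "G j = Gamma (s + real j * \<theta>)" for j
  have G: "G j > 0" for j unfolding G_def using assms by (intro Gamma_real_pos) (auto intro: add_pos_nonneg)
  have "phi \<theta> s (replicate N 0) = (\<Prod>i<N. G (N - Suc i) / G (Suc (N - Suc i)))"
    unfolding phi_def by (intro prod.cong) (auto simp: G_def spart_def of_nat_diff algebra_simps)
  also have "\<dots> = (\<Prod>j<N. G j / G (Suc j))" by (rule prod.nat_diff_reindex)
  also have "\<dots> = G 0 / G N"
  proof (induction N)
    case (Suc N) then show ?case using G[of N] by simp
  qed (use G[of 0] in simp)
  finally show ?thesis by (simp add: G_def)
qed

lemma jack_plus_zero: "jack_plus (Suc n) \<theta> (replicate (Suc n) 0) x = 1"
proof (induction n)
  case (Suc n)
  have "{\<mu> \<in> GT_plus (Suc n). \<mu> \<prec>\<^sub>G\<^sub>T replicate (Suc (Suc n)) 0} = {replicate (Suc n) 0}"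
  proof (intro equalityI subsetI)
    fix \<mu> assume \<mu>: "\<mu> \<in> {\<mu> \<in> GT_plus (Suc n). \<mu> \<prec>\<^sub>G\<^sub>T replicate (Suc (Suc n)) 0}"
    then have "length \<mu> = Suc n" by (simp add: GT_plus_iff GT_length)
    moreover have "\<mu> ! i = 0" if "i < Suc n" for i
      using interlaces_nth[of \<mu> "replicate (Suc (Suc n)) 0" i] \<mu> that calculation by (simp del: replicate.simps)
    ultimately show "\<mu> \<in> {replicate (Suc n) 0}" by (auto intro!: nth_equalityI simp del: replicate.simps)
  qed (auto simp: GT_plus_iff GT_iff interlaces_def simp del: replicate.simps)
  moreover have "jack_psi \<theta> (replicate (Suc (Suc n)) 0) (replicate (Suc n) 0) = 1"
    unfolding jack_psi_def by (intro prod.neutral) (auto simp: Let_def simp del: replicate.simps)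
  ultimately show ?case using Suc.IH by (simp add: sum_list_replicate del: replicate.simps)
qed simp

section \<open>Pieri rules of fixed degree and induction over signatures\<close>

lemma sum_Pow_coeff:
  fixes w :: "nat set \<Rightarrow> real"
  assumes "finite A" "\<And>t. (\<Sum>I\<in>Pow A. t ^ card I * w I) = poly P t"
  shows "(\<Sum>I | I \<subseteq> A \<and> card I = r. w I) = coeff P r"
proof -
  have "poly (\<Sum>I\<in>Pow A. monom (w I) (card I)) = poly P"
    using assms(2) by (auto simp: fun_eq_iff poly_sum poly_monom mult.commute)
  then have "P = (\<Sum>I\<in>Pow A. monom (w I) (card I))" by (simp add: poly_eq_poly_eq_iff)
  then have "coeff P r = (\<Sum>I\<in>Pow A. if card I = r then w I else 0)"
    by (simp add: coeff_sum)
  also have "\<dots> = (\<Sum>I | I \<subseteq> A \<and> card I = r. w I)"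
    using assms(1) by (simp add: sum.inter_filter[symmetric] Pow_def)
  finally show ?thesis by simp
qed

text \<open>\<open>I\<close> misses as many elements of the initial segment as it has outside of it.
  Exchanging them replaces summands of at most N - R by summands of at least N - R + 1.\<close>

lemma sum_lt_initial_segment:
  fixes N R :: nat
  assumes "I \<subseteq> {..<N}" "card I = R" "I \<noteq> {..<R}"
  shows "(\<Sum>i\<in>I. int N - int i) < (\<Sum>i<R. int N - int i)"
proof -
  have fin: "finite I" using assms(1) finite_subset by blast
  have RN: "R \<le> N" using assms(1,2) card_mono[OF finite_lessThan assms(1)] by simp
  have c: "card ({..<R} - I) = card (I - {..<R})"
    using fin assms(2) by (simp add: card_Diff_subset_Int Int_commute)
  have "\<not> I \<subseteq> {..<R}" using assms(2,3) card_subset_eq[of "{..<R}" I] by auto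
  then have pos: "card (I - {..<R}) > 0" using fin by (auto simp: card_gt_0_iff)
  have "(\<Sum>i\<in>I - {..<R}. int N - int i) \<le> (\<Sum>i\<in>I - {..<R}. int N - int R)"
    by (intro sum_mono) auto
  also have "\<dots> < (\<Sum>i\<in>{..<R} - I. int N - int R + 1)"
    using c pos by (simp add: algebra_simps)
  also have "\<dots> \<le> (\<Sum>i\<in>{..<R} - I. int N - int i)" by (intro sum_mono) auto
  finally have "(\<Sum>i\<in>I - {..<R}. int N - int i) < (\<Sum>i\<in>{..<R} - I. int N - int i)" .
  moreover have "(\<Sum>i\<in>I. int N - int i) = (\<Sum>i\<in>I \<inter> {..<R}. int N - int i) + (\<Sum>i\<in>I - {..<R}. int N - int i)"
    using fin by (rule sum.Int_Diff)
  moreover have "(\<Sum>i<R. int N - int i) = (\<Sum>i\<in>I \<inter> {..<R}. int N - int i) + (\<Sum>i\<in>{..<R} - I. int N - int i)"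
    using sum.Int_Diff[of "{..<R}" "\<lambda>i. int N - int i" I] by (simp add: Int_commute)
  ultimately show ?thesis by simp
qed

text \<open>
  Every nonzero \<open>lam\<close> arises from a smaller signature \<open>\<kappa>\<close> by adding a column of height \<open>R\<close>; all other
  terms of the Pieri rule for \<open>e\<^sub>R\<close> at \<open>\<kappa>\<close> have smaller weight \<open>\<Sum>i. (N - i) * lam ! i\<close>.
\<close>

lemma GT_plus_pieri_induct [consumes 1, case_names zero step]:
  assumes "lam \<in> GT_plus N"
    and zero: "P (replicate N 0)"
    and step: "\<And>\<kappa> R. \<kappa> \<in> GT_plus N \<Longrightarrow> R \<le> N \<Longrightarrow> P \<kappa> \<Longrightarrow> bump 1 {..<R} \<kappa> \<in> GT_plus N \<Longrightarrow>
      (\<And>I. I \<subseteq> {..<N} \<Longrightarrow> card I = R \<Longrightarrow> I \<noteq> {..<R} \<Longrightarrow> bump 1 I \<kappa> \<in> GT_plus N \<Longrightarrow> P (bump 1 I \<kappa>)) \<Longrightarrow>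
      P (bump 1 {..<R} \<kappa>)"
  shows "P lam"
  using assms(1)
proof (induction "nat (\<Sum>i<N. (int N - int i) * lam ! i)" arbitrary: lam rule: less_induct)
  case less
  define wt where "wt \<mu> = (\<Sum>i<N. (int N - int i) * \<mu> ! i)" for \<mu> :: "int list"
  have len: "length lam = N" and lam: "lam \<in> GT N" and nonneg: "\<And>i. i < N \<Longrightarrow> 0 \<le> lam ! i"
    using less.prems by (auto simp: GT_plus_iff GT_length)
  have wt_nonneg: "wt \<mu> \<ge> 0" if "\<mu> \<in> GT_plus N" for \<mu>
    using that by (auto simp: wt_def GT_plus_iff intro!: sum_nonneg)
  have wt_bump: "wt (bump 1 I \<mu>) = wt \<mu> + (\<Sum>i\<in>I. int N - int i)" if "length \<mu> = N" "I \<subseteq> {..<N}" for \<mu> I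
  proof -
    have "wt (bump 1 I \<mu>) = (\<Sum>i<N. (int N - int i) * \<mu> ! i + (if i \<in> I then int N - int i else 0))"
      unfolding wt_def using that by (intro sum.cong refl) (auto simp: algebra_simps)
    then show ?thesis using that(2) by (simp add: sum.distrib wt_def sum.If_cases Int_absorb1)
  qed
  show ?case
  proof (cases "lam = replicate N 0")
    case True
    then show ?thesis using zero by simp
  next
    case False
    \<comment> \<open>The number of positive parts, that is, the height of the first column.
      Removing this column lowers each positive part by one and leaves a signature.\<close>
    define R where "R = card {i. i < N \<and> lam ! i > 0}"
    have down: "{i. i < N \<and> lam ! i > 0} = {..<R}"
    proof -
      have closed: "i \<in> {i. i < N \<and> lam ! i > 0}" if "k \<in> {i. i < N \<and> lam ! i > 0}" "i \<le> k" for i k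
        using that GT_antimono[OF lam that(2)] by auto
      define m where "m = (LEAST m. m \<notin> {i. i < N \<and> lam ! i > 0})"
      have "m \<notin> {i. i < N \<and> lam ! i > 0}"
        unfolding m_def by (rule LeastI[of _ N]) simp
      moreover have "i \<in> {i. i < N \<and> lam ! i > 0}" if "i < m" for i
        using not_less_Least[of i "\<lambda>m. m \<notin> {i. i < N \<and> lam ! i > 0}"] that unfolding m_def by blast
      ultimately have "{i. i < N \<and> lam ! i > 0} = {..<m}"
        using closed by (auto simp: not_le[symmetric])
      then show ?thesis by (simp add: R_def)
    qed
    have RN: "R \<le> N" using down by (metis (no_types, lifting) lessThan_iff linorder_not_less mem_Collect_eq less_irrefl)
    have posR: "0 < lam ! i" if "i < R" for i using down that by auto
    have zeroR: "lam ! i = 0" if "R \<le> i" "i < N" for i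
      using down that nonneg[of i] by (metis (no_types, lifting) lessThan_iff linorder_not_less mem_Collect_eq order_antisym)
    have R0: "R > 0"
    proof (rule ccontr)
      assume "\<not> R > 0"
      then have "lam = replicate N 0" using zeroR len by (intro nth_equalityI) auto
      then show False using False by simp
    qed
    define \<kappa> where "\<kappa> = bump (-1) {..<R} lam"
    have up: "bump 1 {..<R} \<kappa> = lam" unfolding \<kappa>_def by (rule bump_inverse)
    have len\<kappa>: "length \<kappa> = N" using len by (simp add: \<kappa>_def)
    have "\<kappa> ! Suc i \<le> \<kappa> ! i" if "Suc i < N" for i
      using GT_antimono[OF lam, of i "Suc i"] zeroR[of "Suc i"] posR[of i] that len by (auto simp: \<kappa>_def)
    moreover have "0 \<le> \<kappa> ! i" if "i < N" for i
      using posR[of i] nonneg[of i] that len by (auto simp: \<kappa>_def)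
    ultimately have \<kappa>: "\<kappa> \<in> GT_plus N" using len\<kappa> by (auto simp: GT_plus_iff GT_iff)
    have wl: "wt lam = wt \<kappa> + (\<Sum>i<R. int N - int i)"
      using wt_bump[OF len\<kappa>, of "{..<R}"] RN up by auto
    have "(\<Sum>i<R. int N - int i) > 0" using R0 RN by (intro sum_pos) auto
    then have IH: "P \<mu>" if "\<mu> \<in> GT_plus N" "wt \<mu> < wt lam" for \<mu>
      using less.hyps[of \<mu>] that wt_nonneg[of \<mu>] by (simp add: wt_def)
    have "P (bump 1 {..<R} \<kappa>)"
    proof (rule step[OF \<kappa> RN])
      show "P \<kappa>" using IH[OF \<kappa>] wl \<open>(\<Sum>i<R. int N - int i) > 0\<close> by simp
      show "bump 1 {..<R} \<kappa> \<in> GT_plus N" using less.prems up by simp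
      show "P (bump 1 I \<kappa>)" if "I \<subseteq> {..<N}" "card I = R" "I \<noteq> {..<R}" "bump 1 I \<kappa> \<in> GT_plus N" for I
        using IH[OF that(4)] wt_bump[OF len\<kappa> that(1)] wl sum_lt_initial_segment[OF that(1-3)] by simp
    qed
    then show ?thesis unfolding up .
  qed
qed

section \<open>The product formula\<close>

definition two_vars :: "nat \<Rightarrow> real \<Rightarrow> int list \<Rightarrow> real \<Rightarrow> real \<Rightarrow> real" where
  "two_vars N \<theta> lam u v = njack \<theta> lam ([u, v] @ replicate (N - 2) 1)"

text \<open>For 1, u + v, u v this generates the elementary symmetric polynomials in u, v and N - 2
  ones. With general entries, in which it is linear, it also generates the multipliers on the moment
  side, so both sides share the same coefficients.\<close>

definition pieri_poly :: "nat \<Rightarrow> real \<Rightarrow> real \<Rightarrow> real \<Rightarrow> real poly" where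
  "pieri_poly N a b c = [:1, 1:] ^ (N - 2) * [:a, b, c:]"

lemma poly_pieri_poly: "poly (pieri_poly N a b c) t = (1 + t) ^ (N - 2) * (a + t * b + t\<^sup>2 * c)"
  by (simp add: pieri_poly_def algebra_simps power2_eq_square)

lemma coeff_pieri_poly:
  "coeff (pieri_poly N a b c) R = a * coeff (pieri_poly N 1 0 0) R + b * coeff (pieri_poly N 0 1 0) R
     + c * coeff (pieri_poly N 0 0 1) R"
proof -
  have "pieri_poly N a b c = smult a (pieri_poly N 1 0 0) + smult b (pieri_poly N 0 1 0) + smult c (pieri_poly N 0 0 1)"
    by (simp add: pieri_poly_def mult_smult_right[symmetric] distrib_left[symmetric] del: mult_smult_right)
  then show ?thesis by simp
qed

lemma pieri_two_vars:
  assumes "lam \<in> GT_plus N" "\<theta> > 0" "N \<ge> 2" "u > 0" "v > 0"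
  shows "(\<Sum>I | I \<subseteq> {..<N} \<and> card I = R. cut \<theta> (spart \<theta> lam) {..<N} I * two_vars N \<theta> (bump 1 I lam) u v)
    = coeff (pieri_poly N 1 (u + v) (u * v)) R * two_vars N \<theta> lam u v"
proof -
  define x where "x = [u, v] @ replicate (N - 2) 1"
  obtain n where n: "N = Suc (Suc n)" using assms(3) by (metis add_2_eq_Suc le_Suc_ex)
  have x: "x ! i > 0" if "i < N" for i
  proof -
    have "x ! i \<in> set x" using that by (intro nth_mem) (simp add: x_def n)
    then show ?thesis using assms(4,5) by (auto simp: x_def split: if_splits)
  qed
  have prod: "(\<Prod>i<N. 1 + t * x ! i) = poly (pieri_poly N 1 (u + v) (u * v)) t" for t
  proof -
    have "(\<Prod>i<N. 1 + t * x ! i) = (1 + t * u) * ((1 + t * v) * (\<Prod>i<n. 1 + t))"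
      unfolding n by (subst prod.lessThan_Suc_shift, subst prod.lessThan_Suc_shift) (simp add: x_def n)
    then show ?thesis by (simp add: poly_pieri_poly n algebra_simps power2_eq_square)
  qed
  have "(\<Sum>I\<in>Pow {..<N}. t ^ card I * (cut \<theta> (spart \<theta> lam) {..<N} I * two_vars N \<theta> (bump 1 I lam) u v)) =
    poly (smult (two_vars N \<theta> lam u v) (pieri_poly N 1 (u + v) (u * v))) t" for t
    using pieri[of lam "Suc n" \<theta> x t] assms(1,2) x prod[of t]
    by (simp add: n two_vars_def x_def[unfolded n] mult_ac)
  from sum_Pow_coeff[OF _ this, of R] show ?thesis by (simp add: mult.commute)
qed

lemma pieri_phi_coeff:
  assumes "lam \<in> GT_plus N" "\<theta> > 0" "s > 0" "r > 0" "s \<noteq> r" "N \<ge> 2"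
  shows "(\<Sum>I | I \<subseteq> {..<N} \<and> card I = R. cut \<theta> (spart \<theta> lam) {..<N} I * (phi \<theta> s (bump 1 I lam) * phi \<theta> r (bump 1 I lam)))
    = coeff (pieri_poly N (phi \<theta> s lam * phi \<theta> r lam)
        ((s - r + \<theta>) / (s - r) * (phi \<theta> (s + 1) lam * phi \<theta> r lam)
           + (s - r - \<theta>) / (s - r) * (phi \<theta> s lam * phi \<theta> (r + 1) lam))
        (phi \<theta> (s + 1) lam * phi \<theta> (r + 1) lam)) R"
  using pieri_phi[OF assms] by (intro sum_Pow_coeff) (simp_all add: poly_pieri_poly mult.assoc)

lemma cut_initial_pos:
  assumes "lam \<in> GT_plus N" "\<theta> > 0" "R \<le> N"
  shows "cut \<theta> (spart \<theta> lam) {..<N} {..<R} > 0"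
  unfolding cut_def
proof (intro prod_pos divide_pos_pos ballI)
  fix i k assume "i \<in> {..<R}" "k \<in> {..<N} - {..<R}"
  then have "spart \<theta> lam i - spart \<theta> lam k \<ge> \<theta>"
    using assms by (intro spart_diff_ge) (auto simp: GT_plus_iff)
  then show "spart \<theta> lam i - spart \<theta> lam k + \<theta> > 0" "spart \<theta> lam i - spart \<theta> lam k > 0"
    using assms(2) by auto
qed

context beta_pair begin

lemma sym_moments_sum:
  assumes "finite T" "\<And>I. I \<in> T \<Longrightarrow> sym_moments (f I) (m I)"
  shows "sym_moments (\<lambda>z p. \<Sum>I\<in>T. c I * f I z p) (\<lambda>s r k. \<Sum>I\<in>T. c I * m I s r k)"
  using assms
proof (induction T rule: finite_induct)
  case empty
  show ?case using scale[OF one, of 0] by simp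
next
  case (insert I T)
  have "sym_moments (\<lambda>z p. c I * f I z p + (\<Sum>I\<in>T. c I * f I z p))
     (\<lambda>s r k. c I * m I s r k + (\<Sum>I\<in>T. c I * m I s r k))"
    using insert by (intro add scale) auto
  then show ?case using insert.hyps by simp
qed

text \<open>Both the characters and the Gamma products obey the Pieri relation at \<mu>, which is
  solved for the term with the added column. Asking that s - r is no integer, rather than s \<noteq>
  r, gives a condition that survives the unit shifts of s and r and keeps the denominators s - r
  nonzero.\<close>

lemma two_vars_moments:
  assumes lam: "lam \<in> GT_plus N" and N: "N \<ge> 2" and \<kappa>: "\<kappa> = \<theta> * (real N - 1)"
  shows "\<exists>f m. sym_moments f m \<and> (\<forall>u>0. \<forall>v>0. two_vars N \<theta> lam u v = f (u + v) (u * v)) \<and>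
    (\<forall>s>0. \<forall>r>0. s - r \<notin> \<int> \<longrightarrow> m s r 0 = 1 / at_ones \<theta> (replicate N 0) * (phi \<theta> s lam * phi \<theta> r lam))"
  using lam
proof (induction rule: GT_plus_pieri_induct)
  case zero
  define C where "C = 1 / at_ones \<theta> (replicate N 0)"
  obtain n where n: "N = Suc n" using N by (cases N) auto
  \<comment> \<open>With this value \<open>mellin s\<close> is \<open>phi\<close> of the zero
    signature, which starts the induction.\<close>
  have b: "\<theta> + \<kappa> = real N * \<theta>" by (simp add: \<kappa> algebra_simps)
  have "two_vars N \<theta> (replicate N 0) u v = C * 1" for u v
    using jack_plus_zero[of n \<theta>] by (simp add: two_vars_def njack_def C_def n del: replicate.simps)
  moreover have "C * (mellin s * mellin r * moment 0) = C * (phi \<theta> s (replicate N 0) * phi \<theta> r (replicate N 0))"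
    if "s > 0" "r > 0" for s r
    using phi_zero[OF \<theta>_pos that(1), of N] phi_zero[OF \<theta>_pos that(2), of N] by (simp add: mellin_def b moment_def)
  ultimately show ?case
    unfolding C_def[symmetric]
    by (intro exI[of _ "\<lambda>z p. C * 1"] exI[of _ "\<lambda>s r k. C * (mellin s * mellin r * moment k)"] conjI scale one) simp_all
next
  case (step \<mu> R)
  define C where "C = 1 / at_ones \<theta> (replicate N 0)"
  define w where "w I = cut \<theta> (spart \<theta> \<mu>) {..<N} I" for I
  define T where "T = {I. I \<subseteq> {..<N} \<and> card I = R \<and> I \<noteq> {..<R} \<and> bump 1 I \<mu> \<in> GT_plus N}"
  define e0 where "e0 = coeff (pieri_poly N 1 0 0) R"
  define e1 where "e1 = coeff (pieri_poly N 0 1 0) R"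
  define e2 where "e2 = coeff (pieri_poly N 0 0 1) R"
  note coeff = coeff_pieri_poly[of N _ _ _ R, folded e0_def e1_def e2_def]
  have finT: "finite T" unfolding T_def by (rule finite_subset[of _ "Pow {..<N}"]) auto
  \<comment> \<open>The coefficient of the added column is nonzero, so its term can be isolated by
    division.\<close>
  have w0: "w {..<R} > 0" unfolding w_def using step.hyps \<theta>_pos by (intro cut_initial_pos)
  have expand: "(\<Sum>I | I \<subseteq> {..<N} \<and> card I = R. w I * g I) = w {..<R} * g {..<R} + (\<Sum>I\<in>T. w I * g I)"
    for g :: "nat set \<Rightarrow> real"
  proof -
    have "(\<Sum>I | I \<subseteq> {..<N} \<and> card I = R. w I * g I) = (\<Sum>I\<in>insert {..<R} T. w I * g I)"
    proof (rule sum.mono_neutral_right)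
      show "finite {I. I \<subseteq> {..<N} \<and> card I = R}" by (rule finite_subset[of _ "Pow {..<N}"]) auto
      show "insert {..<R} T \<subseteq> {I. I \<subseteq> {..<N} \<and> card I = R}" using step.hyps(2) by (auto simp: T_def)
      show "\<forall>I\<in>{I. I \<subseteq> {..<N} \<and> card I = R} - insert {..<R} T. w I * g I = 0"
      proof
        fix I assume I: "I \<in> {I. I \<subseteq> {..<N} \<and> card I = R} - insert {..<R} T"
        then have "bump 1 I \<mu> \<notin> GT N" using bump_GT_plus[OF step.hyps(1)] by (auto simp: T_def)
        then have "w I = 0" unfolding w_def using I step.hyps(1)
          by (intro cut_bump_not_GT) (auto simp: GT_plus_iff)
        then show "w I * g I = 0" by simp
      qed
    qed
    also have "\<dots> = w {..<R} * g {..<R} + (\<Sum>I\<in>T. w I * g I)"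
      using finT by (subst sum.insert) (auto simp: T_def)
    finally show ?thesis .
  qed
  obtain f m where fm: "sym_moments f m" "\<And>u v. u > 0 \<Longrightarrow> v > 0 \<Longrightarrow> two_vars N \<theta> \<mu> u v = f (u + v) (u * v)"
    "\<And>s r. s > 0 \<Longrightarrow> r > 0 \<Longrightarrow> s - r \<notin> \<int> \<Longrightarrow> m s r 0 = C * (phi \<theta> s \<mu> * phi \<theta> r \<mu>)"
    using step.IH(1) unfolding C_def by blast
  have "\<forall>I\<in>T. \<exists>f m. sym_moments f m \<and> (\<forall>u>0. \<forall>v>0. two_vars N \<theta> (bump 1 I \<mu>) u v = f (u + v) (u * v)) \<and>
    (\<forall>s>0. \<forall>r>0. s - r \<notin> \<int> \<longrightarrow> m s r 0 = C * (phi \<theta> s (bump 1 I \<mu>) * phi \<theta> r (bump 1 I \<mu>)))"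
    using step.IH(2) unfolding C_def T_def by blast
  then obtain F M where FM: "\<And>I. I \<in> T \<Longrightarrow> sym_moments (F I) (M I)"
    "\<And>I u v. I \<in> T \<Longrightarrow> u > 0 \<Longrightarrow> v > 0 \<Longrightarrow> two_vars N \<theta> (bump 1 I \<mu>) u v = F I (u + v) (u * v)"
    "\<And>I s r. I \<in> T \<Longrightarrow> s > 0 \<Longrightarrow> r > 0 \<Longrightarrow> s - r \<notin> \<int> \<Longrightarrow>
        M I s r 0 = C * (phi \<theta> s (bump 1 I \<mu>) * phi \<theta> r (bump 1 I \<mu>))"
    by metis
  \<comment> \<open>The Pieri relation solved for the added column. \<open>m'\<close> is the same
    linear combination, with multiplication by the sum and the product replaced by their effect on
    moments.\<close>
  define f' where "f' z p = 1 / w {..<R} * (e0 * f z p + (e1 * (z * f z p) + (e2 * (p * f z p) + (\<Sum>I\<in>T. - w I * F I z p))))" for z p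
  define m' where "m' s r k = 1 / w {..<R} * (e0 * m s r k + (e1 * (m (s + 1) r k + m s (r + 1) k + diag m s r (Suc k))
     + (e2 * m (s + 1) (r + 1) k + (\<Sum>I\<in>T. - w I * M I s r k))))" for s r k
  have "sym_moments f' m'"
    unfolding f'_def[abs_def] m'_def[abs_def]
    by (intro scale add fm(1) times_sum times_prod sym_moments_sum finT FM(1))
  moreover have "two_vars N \<theta> (bump 1 {..<R} \<mu>) u v = f' (u + v) (u * v)" if uv: "u > 0" "v > 0" for u v
  proof -
    have "w {..<R} * two_vars N \<theta> (bump 1 {..<R} \<mu>) u v + (\<Sum>I\<in>T. w I * two_vars N \<theta> (bump 1 I \<mu>) u v) =
      (e0 + (u + v) * e1 + u * v * e2) * two_vars N \<theta> \<mu> u v"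
      using pieri_two_vars[OF step.hyps(1) \<theta>_pos N uv, of R] coeff[of 1 "u + v" "u * v"]
      by (simp add: expand flip: w_def)
    moreover have "(\<Sum>I\<in>T. w I * two_vars N \<theta> (bump 1 I \<mu>) u v) = (\<Sum>I\<in>T. w I * F I (u + v) (u * v))"
      using FM(2) uv by (intro sum.cong) auto
    ultimately show ?thesis
      using w0 fm(2)[OF uv] by (simp add: f'_def sum_negf field_simps)
  qed
  moreover have "m' s r 0 = C * (phi \<theta> s (bump 1 {..<R} \<mu>) * phi \<theta> r (bump 1 {..<R} \<mu>))"
    if sr: "s > 0" "r > 0" "s - r \<notin> \<int>" for s r
  proof -
    have ne: "s - r \<noteq> 0" using sr(3) by auto
    have shifted: "s + 1 - r \<notin> \<int>" "s - (r + 1) \<notin> \<int>" "s + 1 - (r + 1) \<notin> \<int>"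
    proof -
      have "s - r = (s + 1 - r) - 1" "s - r = (s - (r + 1)) + 1" "s - r = s + 1 - (r + 1)" by simp_all
      then show "s + 1 - r \<notin> \<int>" "s - (r + 1) \<notin> \<int>" "s + 1 - (r + 1) \<notin> \<int>"
        using sr(3) by (metis Ints_1 Ints_diff, metis Ints_1 Ints_add, metis)
    qed
    define p00 where "p00 = phi \<theta> s \<mu> * phi \<theta> r \<mu>"
    define p10 where "p10 = phi \<theta> (s + 1) \<mu> * phi \<theta> r \<mu>"
    define p01 where "p01 = phi \<theta> s \<mu> * phi \<theta> (r + 1) \<mu>"
    define p11 where "p11 = phi \<theta> (s + 1) \<mu> * phi \<theta> (r + 1) \<mu>"
    define P where "P I = phi \<theta> s (bump 1 I \<mu>) * phi \<theta> r (bump 1 I \<mu>)" for I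
    define q where "q = (s - r + \<theta>) / (s - r) * p10 + (s - r - \<theta>) / (s - r) * p01"
    have m: "m s r 0 = C * p00" "m (s + 1) r 0 = C * p10" "m s (r + 1) 0 = C * p01" "m (s + 1) (r + 1) 0 = C * p11"
      unfolding p00_def p10_def p01_def p11_def using sr shifted by (intro fm(3); simp)+
    have "(s - r) * (m (s + 1) r 0 + m s (r + 1) 0 + diag m s r (Suc 0)) = (s - r + \<theta>) * (C * p10) + (s - r - \<theta>) * (C * p01)"
      using times_sum_moment[OF fm(1) sr(1,2)] unfolding m .
    also have "\<dots> = (s - r) * (C * q)"
    proof -
      have "(s - r) * q = (s - r + \<theta>) * p10 + (s - r - \<theta>) * p01" using ne by (simp add: q_def distrib_left)
      then show ?thesis by (simp add: mult.left_commute[of _ C] distrib_left[symmetric])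
    qed
    finally have z: "m (s + 1) r 0 + m s (r + 1) 0 + diag m s r (Suc 0) = C * q" using ne by simp
    have "w {..<R} * P {..<R} + (\<Sum>I\<in>T. w I * P I) = p00 * e0 + q * e1 + p11 * e2"
      using pieri_phi_coeff[OF step.hyps(1) \<theta>_pos sr(1,2) _ N, of R] ne
      unfolding coeff w_def[symmetric] P_def[symmetric] expand p00_def p11_def q_def p10_def p01_def by simp
    then have "C * (w {..<R} * P {..<R} + (\<Sum>I\<in>T. w I * P I)) = C * (p00 * e0 + q * e1 + p11 * e2)" by (rule arg_cong)
    then have "w {..<R} * (C * P {..<R}) = C * (p00 * e0 + q * e1 + p11 * e2) - C * (\<Sum>I\<in>T. w I * P I)"
      by (simp add: algebra_simps)
    moreover have "(\<Sum>I\<in>T. - w I * M I s r 0) = - (C * (\<Sum>I\<in>T. w I * P I))"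
      unfolding sum_distrib_left sum_negf[symmetric] P_def using FM(3) sr by (intro sum.cong) auto
    ultimately have "w {..<R} * (C * P {..<R}) = e0 * (C * p00) + (e1 * (C * q) + (e2 * (C * p11) + (\<Sum>I\<in>T. - w I * M I s r 0)))"
      by (simp only:) (simp add: algebra_simps)
    then show ?thesis
      unfolding m'_def z m(1,4) P_def[symmetric] using w0 by (simp add: divide_simps mult.commute)
  qed
  ultimately show ?case unfolding C_def by blast
qed

lemma expect_const: "expect (\<lambda>B. a) = a"
  using expect_cmult[of a "\<lambda>B. B ^ 0"] by (simp add: expect_power moment_def del: power_0) (simp add: moment_def)

lemma product_formula:
  assumes lam: "lam \<in> GT_plus N" and N: "N \<ge> 2" and \<kappa>: "\<kappa> = \<theta> * (real N - 1)"
  obtains f where "\<And>p. continuous_on UNIV (\<lambda>z. f z p)"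
    and "\<And>u v. u > 0 \<Longrightarrow> v > 0 \<Longrightarrow> two_vars N \<theta> lam u v = f (u + v) (u * v)"
    and "\<And>x y. x > 0 \<Longrightarrow> y > 0 \<Longrightarrow> two_vars N \<theta> lam x 1 * two_vars N \<theta> lam y 1 =
       two_vars N \<theta> lam 1 1 * expect (\<lambda>B. f (x + y + B * ((1 - x) * (1 - y))) (x * y))"
proof -
  define C where "C = 1 / at_ones \<theta> (replicate N 0)"
  obtain f m where fm: "sym_moments f m" "\<And>u v. u > 0 \<Longrightarrow> v > 0 \<Longrightarrow> two_vars N \<theta> lam u v = f (u + v) (u * v)"
    "\<And>s r. s > 0 \<Longrightarrow> r > 0 \<Longrightarrow> s - r \<notin> \<int> \<Longrightarrow> m s r 0 = C * (phi \<theta> s lam * phi \<theta> r lam)"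
    using two_vars_moments[OF assms] unfolding C_def by blast
  define G where "G x y = expect (\<lambda>B. f (x + y + B * ((1 - x) * (1 - y))) (x * y))" for x y
  have C: "C > 0"
  proof -
    have "replicate N 0 \<in> GT N" by (auto simp: GT_iff)
    then show ?thesis using at_ones_pos[of "replicate N 0" N \<theta>] \<theta>_pos by (simp add: C_def)
  qed
  have "xy_moments G (\<lambda>s r. m s r 0)"
    using sym_moments_xy[OF fm(1), of 0] by (simp add: G_def[abs_def])
  \<comment> \<open>Arguments from 1, 2, ... and from 1/2, 3/2, ... are positive, and their
    differences are never integers.\<close>
  moreover have "infinite (range (\<lambda>n. real n + 1))" "infinite (range (\<lambda>n. real n + 1 / 2))"
    by (intro range_inj_infinite injI; simp)+
  moreover have "m s r 0 = C * phi \<theta> s lam * phi \<theta> r lam"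
    if "s \<in> range (\<lambda>n. real n + 1)" "r \<in> range (\<lambda>n. real n + 1 / 2)" for s r
  proof -
    obtain i j where ij: "s = real i + 1" "r = real j + 1 / 2"
      using \<open>s \<in> _\<close> \<open>r \<in> _\<close> by blast
    have "s - r \<notin> \<int>"
    proof
      assume "s - r \<in> \<int>"
      moreover have "real i - real j \<in> \<int>" by (intro Ints_diff) auto
      ultimately have "s - r - (real i - real j) \<in> \<int>" by (rule Ints_diff)
      moreover have "s - r - (real i - real j) = 1 / 2" unfolding ij by simp
      ultimately have "(1 / 2 :: real) \<in> \<int>" by (simp only:)
      then obtain k :: int where "1 / 2 = real_of_int k" by (auto elim: Ints_cases)
      then have "real_of_int (2 * k) = 1" by simp
      then have "2 * k = 1" by linarith
      then show False by presburger
    qed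
    then show ?thesis using fm(3)[of s r] ij by (simp add: mult.assoc)
  qed
  moreover have "phi \<theta> s lam > 0" if "s > 0" for s using phi_pos[OF lam \<theta>_pos that] .
  ultimately have "\<exists>P Q. \<forall>x y. G x y = P x * Q y"
    using C by (intro xy_moments_factor[where \<alpha> = "\<lambda>s. C * phi \<theta> s lam" and \<beta> = "\<lambda>r. phi \<theta> r lam" and
        S = "range (\<lambda>n. real n + 1)" and R = "range (\<lambda>n. real n + 1 / 2)"]) (fastforce simp: less_imp_neq[symmetric])+
  then obtain P Q where PQ: "\<And>x y. G x y = P x * Q y" by blast
  \<comment> \<open>If one variable is 1, then (1 - x) (1 - y) vanishes and the averaged function
    does not depend on \<open>B\<close>.\<close>
  have G1: "G x 1 = two_vars N \<theta> lam x 1" "G 1 x = two_vars N \<theta> lam x 1" if "x > 0" for x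
    using fm(2)[of x 1] that by (simp_all add: G_def expect_const add.commute)
  show ?thesis
  proof (rule that)
    show "continuous_on UNIV (\<lambda>z. f z p)" for p using sym_moments_continuous[OF fm(1)] .
    show "two_vars N \<theta> lam u v = f (u + v) (u * v)" if "u > 0" "v > 0" for u v using fm(2)[OF that] .
    show "two_vars N \<theta> lam x 1 * two_vars N \<theta> lam y 1 =
       two_vars N \<theta> lam 1 1 * expect (\<lambda>B. f (x + y + B * ((1 - x) * (1 - y))) (x * y))" if "x > 0" "y > 0" for x y
    proof -
      \<comment> \<open>Both sides are P x * Q 1 * P 1 * Q y, so the unknown factors
        disappear.\<close>
      have "G x 1 * G 1 y = G 1 1 * G x y" by (simp add: PQ)
      then show ?thesis using G1(1)[of x] G1(2)[of y] G1(1)[of 1] that by (simp add: G_def)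
    qed
  qed
qed

end

text \<open>Raising all parts by \<open>K\<close> multiplies a Jack polynomial by the K-th power of
  the product of its variables, and only u and v contribute to that product. The normalisation
  \<open>at_ones\<close> cancels between numerator and denominator.\<close>

lemma jack_char_two_vars:
  assumes "lam \<in> GT N" "N \<ge> 2" "\<theta> > 0"
  defines "K \<equiv> nat (- last lam)"
  defines "lam' \<equiv> map (\<lambda>k. k + int K) lam"
  shows "lam' \<in> GT_plus N"
    and "jack_char N \<theta> lam [u, v] = two_vars N \<theta> lam' u v / two_vars N \<theta> lam' 1 1 / (u * v) ^ K"
    and "jack_char N \<theta> lam [u] = two_vars N \<theta> lam' u 1 / two_vars N \<theta> lam' 1 1 / u ^ K"
proof -
  have len: "length lam = N" using assms(1) by (rule GT_length)
  have len': "length lam' = N" by (simp add: lam'_def len)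
  obtain n where n: "N = Suc (Suc n)" using assms(2) by (metis add_2_eq_Suc le_Suc_ex)
  have nth: "lam' ! i = lam ! i + int K" if "i < N" for i using that len by (simp add: lam'_def)
  show GT: "lam' \<in> GT_plus N"
  proof -
    have "lam ! i + int K \<ge> 0" if "i < N" for i
    proof -
      have "last lam = lam ! (N - 1)" using len n by (simp add: last_conv_nth flip: length_greater_0_conv)
      then have "last lam \<le> lam ! i" using GT_antimono[OF assms(1), of i "N - 1"] that n by simp
      then show ?thesis by (simp add: K_def)
    qed
    moreover have "lam' \<in> GT N" using assms(1) nth len' by (auto simp: GT_iff)
    ultimately show ?thesis using nth by (simp add: GT_plus_iff)
  qed
  have "at_ones \<theta> lam' > 0" using GT assms(3) at_ones_pos[of lam' N \<theta>] by (simp add: GT_plus_iff)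
  then have jack: "jack \<theta> lam ([a, b] @ replicate (N - 2) 1) = at_ones \<theta> lam' * two_vars N \<theta> lam' a b / (a * b) ^ K" for a b
    unfolding jack_def two_vars_def njack_def Let_def K_def[symmetric] lam'_def[symmetric] len len'
    by (simp add: prod_list_replicate)
  have ones: "replicate N 1 = [1, 1] @ replicate (N - 2) (1::real)" by (simp add: n)
  have one: "[u] @ replicate (N - length [u]) 1 = [u, 1] @ replicate (N - 2) 1" by (simp add: n)
  have two: "[u, v] @ replicate (N - length [u, v]) 1 = [u, v] @ replicate (N - 2) 1" by simp
  show "jack_char N \<theta> lam [u, v] = two_vars N \<theta> lam' u v / two_vars N \<theta> lam' 1 1 / (u * v) ^ K"
    unfolding jack_char_def two ones jack using \<open>at_ones \<theta> lam' > 0\<close> by simp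
  show "jack_char N \<theta> lam [u] = two_vars N \<theta> lam' u 1 / two_vars N \<theta> lam' 1 1 / u ^ K"
    unfolding jack_char_def one ones jack using \<open>at_ones \<theta> lam' > 0\<close> by simp
qed

theorem theorem0p2:
  fixes \<theta> x y :: real and N :: nat and lam :: "int list"
  assumes "\<theta> > 0" and "N \<ge> 2" and "lam \<in> GT N"
    and "1 > y" and "y > x" and "x > 0"
  shows "let f = (\<lambda>w::real.
               jack_char N \<theta> lam [x * w, y / w]
               * (1 - x * w\<^sup>2 / y)
               * (1 - x * w / y) powr (\<theta> - 1)
               * (1 / w - 1) powr (\<theta> - 1)
               * (((1 - x * w) * (1 - y / w)) / ((1 - x) * (1 - y))) powr (\<theta> * (real N - 1) - 1)
               * (1 / w\<^sup>2))
         in set_integrable lborel {y<..<1} f \<and>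
            jack_char N \<theta> lam [x] * jack_char N \<theta> lam [y] =
              Gamma (real N * \<theta>) * y powr \<theta>
              / (Gamma ((real N - 1) * \<theta>) * Gamma \<theta> * ((1 - x) * (1 - y)) powr \<theta>)
              * (LBINT w:{y<..<1}. f w)"
proof -
  define \<kappa> where "\<kappa> = \<theta> * (real N - 1)"
  have "real N - 1 > 0" using assms(2) by simp
  then interpret beta_pair \<theta> \<kappa> using assms(1) by unfold_locales (simp_all add: \<kappa>_def)
  define K where "K = nat (- last lam)"
  define lam' where "lam' = map (\<lambda>k. k + int K) lam"
  note char = jack_char_two_vars[OF assms(3,2,1), folded K_def, folded lam'_def]
  obtain f where cont: "\<And>p. continuous_on UNIV (\<lambda>z. f z p)"
    and f: "\<And>u v. u > 0 \<Longrightarrow> v > 0 \<Longrightarrow> two_vars N \<theta> lam' u v = f (u + v) (u * v)"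
    and prod: "\<And>x y. x > 0 \<Longrightarrow> y > 0 \<Longrightarrow> two_vars N \<theta> lam' x 1 * two_vars N \<theta> lam' y 1 =
       two_vars N \<theta> lam' 1 1 * expect (\<lambda>B. f (x + y + B * ((1 - x) * (1 - y))) (x * y))"
    using product_formula[OF char(1) assms(2) \<kappa>_def] by blast
  define V where "V = two_vars N \<theta> lam' 1 1"
  define E where "E = expect (\<lambda>B. f (x + y + B * ((1 - x) * (1 - y))) (x * y))"
  define q where "q = (1 - x) * (1 - y)"
  have q: "q > 0" using assms by (simp add: q_def)
  define F where "F w = f (x * w + y / w) (x * y) * kernel x y w" for w
  define g where "g = (\<lambda>w::real. jack_char N \<theta> lam [x * w, y / w]
               * (1 - x * w\<^sup>2 / y)
               * (1 - x * w / y) powr (\<theta> - 1)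
               * (1 / w - 1) powr (\<theta> - 1)
               * (((1 - x * w) * (1 - y / w)) / ((1 - x) * (1 - y))) powr (\<theta> * (real N - 1) - 1)
               * (1 / w\<^sup>2))"
  \<comment> \<open>Along the curve the product of the two variables stays x y, so both the shift
    factor and the second argument of \<open>f\<close> are constant under the integral.\<close>
  have g: "g w = 1 / (V * (x * y) ^ K) * F w" if "w \<in> {y<..<1}" for w
  proof -
    have w: "w > 0" "x * w > 0" "y / w > 0" "x * w * (y / w) = x * y" using that assms by auto
    then have "jack_char N \<theta> lam [x * w, y / w] = 1 / (V * (x * y) ^ K) * f (x * w + y / w) (x * y)"
      unfolding char(2) V_def w(4) f[OF w(2,3)] by simp
    then show ?thesis unfolding g_def F_def kernel_def unfolding \<kappa>_def by (simp only: mult_ac)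
  qed
  have xy: "0 < x" "x < y" "y < 1" using assms by auto
  note ker = kernel_integral[OF xy cont[of "x * y"], folded F_def]
  have "set_integrable lborel {y<..<1} (\<lambda>w. 1 / (V * (x * y) ^ K) * F w)"
    using ker(1) by (intro set_integrable_mult_right) auto
  then have int: "set_integrable lborel {y<..<1} g"
    by (subst set_integrable_cong[OF refl refl g]) auto
  have "(LBINT w:{y<..<1}. g w) = (LBINT w:{y<..<1}. 1 / (V * (x * y) ^ K) * F w)"
    using g by (intro set_lebesgue_integral_cong) auto
  also have "\<dots> = 1 / (V * (x * y) ^ K) * (LBINT w:{y<..<1}. F w)"
    by (rule set_integral_mult_right)
  also have "\<dots> = 1 / (V * (x * y) ^ K) * (E * Beta \<theta> \<kappa> * q powr \<theta> / y powr \<theta>)"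
    unfolding ker(2) E_def q_def ..
  finally have val: "(LBINT w:{y<..<1}. g w) = 1 / (V * (x * y) ^ K) * (E * Beta \<theta> \<kappa> * q powr \<theta> / y powr \<theta>)" .
  have "Gamma (real N * \<theta>) * y powr \<theta> / (Gamma ((real N - 1) * \<theta>) * Gamma \<theta> * q powr \<theta>) * (LBINT w:{y<..<1}. g w) =
     E / (V * (x * y) ^ K)"
  proof -
    \<comment> \<open>These identifications make the Gamma prefactor the reciprocal of
      \<open>Beta \<theta> \<kappa>\<close>; the powers of \<open>q\<close> and \<open>y\<close>
      cancel as well.\<close>
    have "\<theta> + \<kappa> = real N * \<theta>" "(real N - 1) * \<theta> = \<kappa>" by (simp_all add: \<kappa>_def algebra_simps)
    moreover have "Gamma \<theta> > 0" "Gamma \<kappa> > 0" "Gamma (\<theta> + \<kappa>) > 0"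
      using \<theta>_pos \<kappa>_pos by (auto intro!: Gamma_real_pos)
    ultimately show ?thesis unfolding val Beta_def using q xy by simp
  qed
  moreover have "jack_char N \<theta> lam [x] * jack_char N \<theta> lam [y] = E / (V * (x * y) ^ K)"
  proof -
    have "jack_char N \<theta> lam [x] * jack_char N \<theta> lam [y] =
      (two_vars N \<theta> lam' x 1 * two_vars N \<theta> lam' y 1) / (V * V * (x * y) ^ K)"
      unfolding char(3) V_def by (simp add: power_mult_distrib)
    \<comment> \<open>The product formula contributes one factor \<open>V\<close>, which cancels
      against V * V. By the convention for division by zero the equation also holds for V =
      0.\<close>
    also have "\<dots> = E / (V * (x * y) ^ K)"
      using prod[of x y] xy by (simp add: V_def E_def)
    finally show ?thesis .
  qed
  ultimately show ?thesis
    unfolding Let_def g_def[symmetric] unfolding q_def[symmetric] using int by simp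
qed

end
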